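(* Let $k$ be a field, $n$ a positive integer, $M$ an $n$-dimensional $k$-vector space, and $R\in\mathrm{End}_k(M\otimes M)$ a solution of the ${\cal D}$-equation $R^{12}R^{23}=R^{23}R^{12}$. Then: 1. There exist a coideal $I(R)$ of the comatrix coalgebra ${\cal M}^n(k)$ and a unique ${\cal D}$-map $$\sigma:{\cal M}^n(k)\otimes {\cal M}^n(k)/I(R)\to k$$ such that $R=R_\sigma$. Furthermore, if $R$ is bijective, $\sigma$ is invertible in the convolution algebra $\mathrm{Hom}_k({\cal M}^n(k)\otimes{\cal M}^n(k)/I(R),\,k)$. 2. If $R\tau=\tau R$, where $\tau:M\otimes M\to M\otimes M$ is the flip map, then there exists a coalgebra $C(R)$ and a unique strongly ${\cal D}$-map $$\tilde\sigma: C(R)\otimes C(R)\to k$$ such that $M$ has a structure of right $C(R)$-comodule and $R=R_{\tilde\sigma}$.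
   Context: All vector spaces and coalgebras are over a field $k$; $\otimes=\otimes_k$. For $R\in\mathrm{End}_k(M\otimes M)$, $R^{12}=R\otimes I$ and $R^{23}=I\otimes R$ in $\mathrm{End}_k(M\otimes M\otimes M)$. The flip map is $\tau(m\otimes n)=n\otimes m$. The comatrix coalgebra ${\cal M}^n(k)$ of order $n$ has $k$-basis $\{c_{ij}\mid i,j=1,\dots,n\}$, with $\Delta(c_{jk})=\sum_{u=1}^n c_{ju}\otimes c_{uk}$ and $\varepsilon(c_{jk})=\delta_{jk}$. Let $C$ be a coalgebra and $I$ a coideal of $C$; the class of $c\in C$ in the quotient coalgebra $C/I$ is denoted $\overline{c}$, and $C\otimes C/I$ means $C\otimes(C/I)$. A $k$-bilinear map $\sigma:C\otimes C/I\to k$ (that is, a $k$-linear map on the tensor product) is called a ${\cal D}$-map if $$\sum\sigma(c_{(1)}\otimes\overline{d})\,\overline{c_{(2)}}=\sum\sigma(c_{(2)}\otimes\overline{d})\,\overline{c_{(1)}}$$ for all $c\in C$, $\overline{d}\in C/I$. If $I=0$, $\sigma$ is called a strongly ${\cal D}$-map. For a right $C$-comodule $(M,\rho)$, with $\rho(m)=\sum m_{<0>}\otimes m_{<1>}$, the map $R_\sigma:M\otimes M\to M\otimes M$ is $$R_\sigma(m\otimes n)=\sum\sigma(m_{<1>}\otimes\overline{n_{<1>}})\,m_{<0>}\otimes n_{<0>}.$$ Remark (not part of the statement): item 1 does not name the right ${\cal M}^n(k)$-comodule structure on $M$ with respect to which $R_\sigma$ is formed; the proof takes a basis $\{m_1,\dots,m_n\}$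 of $M$ and uses $\rho(m_l)=\sum_{v=1}^n m_v\otimes c_{vl}$. *)

theory Defs
  imports "HOL-Algebra.Module" "HOL-Algebra.AbelCoset"
begin

section \<open>Linear algebra over a field\<close>

text \<open>Vector spaces over a field \<open>K\<close> are modules \<open>V\<close> with \<^term>\<open>module K V\<close>.\<close>

definition self_module :: "('k, 'x) ring_scheme \<Rightarrow> ('k, 'k) module" where
  "self_module K = \<lparr>carrier = carrier K, mult = mult K, one = one K, zero = zero K,
     add = add K, smult = mult K\<rparr>"

definition linear_map ::
  "('k, 'x) ring_scheme \<Rightarrow> ('k, 'v, 'y) module_scheme \<Rightarrow> ('k, 'w, 'z) module_scheme
    \<Rightarrow> ('v \<Rightarrow> 'w) \<Rightarrow> bool" where
  "linear_map K V W f \<longleftrightarrow>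
     f \<in> carrier V \<rightarrow> carrier W \<and>
     (\<forall>x\<in>carrier V. \<forall>y\<in>carrier V. f (x \<oplus>\<^bsub>V\<^esub> y) = f x \<oplus>\<^bsub>W\<^esub> f y) \<and>
     (\<forall>a\<in>carrier K. \<forall>x\<in>carrier V. f (a \<odot>\<^bsub>V\<^esub> x) = a \<odot>\<^bsub>W\<^esub> f x)"

text \<open>The linear maps as a set; they are extensional, so that equality of elements is equality
  on the carrier.\<close>

definition lin_hom ::
  "('k, 'x) ring_scheme \<Rightarrow> ('k, 'v, 'y) module_scheme \<Rightarrow> ('k, 'w, 'z) module_scheme
    \<Rightarrow> ('v \<Rightarrow> 'w) set" where
  "lin_hom K V W = {f \<in> extensional (carrier V). linear_map K V W f}"

definition is_basis ::
  "('k, 'x) ring_scheme \<Rightarrow> ('k, 'v, 'y) module_scheme \<Rightarrow> nat \<Rightarrow> (nat \<Rightarrow> 'v) \<Rightarrow> bool" where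
  "is_basis K V n b \<longleftrightarrow>
     b \<in> {1..n} \<rightarrow> carrier V \<and>
     (\<forall>x\<in>carrier V. \<exists>!a. a \<in> {1..n} \<rightarrow>\<^sub>E carrier K \<and> x = (\<Oplus>\<^bsub>V\<^esub>i\<in>{1..n}. a i \<odot>\<^bsub>V\<^esub> b i))"

definition has_dim :: "('k, 'x) ring_scheme \<Rightarrow> ('k, 'v, 'y) module_scheme \<Rightarrow> nat \<Rightarrow> bool" where
  "has_dim K V n \<longleftrightarrow> (\<exists>b. is_basis K V n b)"

definition lspan ::
  "('k, 'x) ring_scheme \<Rightarrow> ('k, 'v, 'y) module_scheme \<Rightarrow> 'v set \<Rightarrow> 'v set" where
  "lspan K V S = \<Inter>{N. submodule N K V \<and> S \<subseteq> N}"

text \<open>The quotient by a subspace; its elements are the cosets \<open>N +>\<^bsub>V\<^esub> x\<close>.\<close>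

definition quot_mod :: "('k, 'x) ring_scheme \<Rightarrow> ('k, 'v, 'y) module_scheme \<Rightarrow> 'v set
    \<Rightarrow> ('k, 'v set) module" where
  "quot_mod K V N = \<lparr>carrier = a_rcosets\<^bsub>V\<^esub> N, mult = undefined, one = undefined, zero = N,
     add = set_add V, smult = (\<lambda>a X. \<Union>x\<in>X. N +>\<^bsub>V\<^esub> (a \<odot>\<^bsub>V\<^esub> x))\<rparr>"

definition free_mod :: "('k, 'x) ring_scheme \<Rightarrow> 's set \<Rightarrow> ('k, 's \<Rightarrow> 'k) module" where
  "free_mod K S = \<lparr>
     carrier = {f. (\<forall>s. f s \<in> carrier K) \<and> (\<forall>s. s \<notin> S \<longrightarrow> f s = \<zero>\<^bsub>K\<^esub>) \<and> finite {s. f s \<noteq> \<zero>\<^bsub>K\<^esub>}},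
     mult = undefined, one = undefined, zero = (\<lambda>s. \<zero>\<^bsub>K\<^esub>),
     add = (\<lambda>f g s. f s \<oplus>\<^bsub>K\<^esub> g s), smult = (\<lambda>a f s. a \<otimes>\<^bsub>K\<^esub> f s)\<rparr>"

definition free_gen :: "('k, 'x) ring_scheme \<Rightarrow> 's \<Rightarrow> ('s \<Rightarrow> 'k)" where
  "free_gen K s = (\<lambda>t. if t = s then \<one>\<^bsub>K\<^esub> else \<zero>\<^bsub>K\<^esub>)"


section \<open>Tensor products\<close>

definition tensor_rels ::
  "('k, 'x) ring_scheme \<Rightarrow> ('k, 'v, 'y) module_scheme \<Rightarrow> ('k, 'w, 'z) module_scheme
    \<Rightarrow> ('v \<times> 'w \<Rightarrow> 'k) set" where
  "tensor_rels K V W =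
    (let F = free_mod K (carrier V \<times> carrier W); g = free_gen K in
      {g (v \<oplus>\<^bsub>V\<^esub> v', w) \<ominus>\<^bsub>F\<^esub> (g (v, w) \<oplus>\<^bsub>F\<^esub> g (v', w)) | v v' w.
         v \<in> carrier V \<and> v' \<in> carrier V \<and> w \<in> carrier W} \<union>
      {g (v, w \<oplus>\<^bsub>W\<^esub> w') \<ominus>\<^bsub>F\<^esub> (g (v, w) \<oplus>\<^bsub>F\<^esub> g (v, w')) | v w w'.
         v \<in> carrier V \<and> w \<in> carrier W \<and> w' \<in> carrier W} \<union>
      {g (a \<odot>\<^bsub>V\<^esub> v, w) \<ominus>\<^bsub>F\<^esub> (a \<odot>\<^bsub>F\<^esub> g (v, w)) | a v w.
         a \<in> carrier K \<and> v \<in> carrier V \<and> w \<in> carrier W} \<union>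
      {g (v, a \<odot>\<^bsub>W\<^esub> w) \<ominus>\<^bsub>F\<^esub> (a \<odot>\<^bsub>F\<^esub> g (v, w)) | a v w.
         a \<in> carrier K \<and> v \<in> carrier V \<and> w \<in> carrier W})"

definition tensor_null ::
  "('k, 'x) ring_scheme \<Rightarrow> ('k, 'v, 'y) module_scheme \<Rightarrow> ('k, 'w, 'z) module_scheme
    \<Rightarrow> ('v \<times> 'w \<Rightarrow> 'k) set" where
  "tensor_null K V W = lspan K (free_mod K (carrier V \<times> carrier W)) (tensor_rels K V W)"

type_synonym ('k, 'v, 'w) tens = "('v \<times> 'w \<Rightarrow> 'k) set"

definition tensor ::
  "('k, 'x) ring_scheme \<Rightarrow> ('k, 'v, 'y) module_scheme \<Rightarrow> ('k, 'w, 'z) module_scheme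
    \<Rightarrow> ('k, ('k, 'v, 'w) tens) module" where
  "tensor K V W = quot_mod K (free_mod K (carrier V \<times> carrier W)) (tensor_null K V W)"

text \<open>\<open>tens K V W v w\<close> is the pure tensor \<open>v \<otimes> w\<close>.\<close>

definition tens ::
  "('k, 'x) ring_scheme \<Rightarrow> ('k, 'v, 'y) module_scheme \<Rightarrow> ('k, 'w, 'z) module_scheme
    \<Rightarrow> 'v \<Rightarrow> 'w \<Rightarrow> ('k, 'v, 'w) tens" where
  "tens K V W v w =
     tensor_null K V W +>\<^bsub>free_mod K (carrier V \<times> carrier W)\<^esub> free_gen K (v, w)"

text \<open>For a bilinear \<open>b\<close>, the unique linear map \<open>V \<otimes> W \<rightarrow> U\<close> with \<open>v \<otimes> w \<mapsto> b v w\<close>. Thus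
  \<open>tens_lift K V W U b t\<close> is the value of a Sweedler-style sum \<open>\<Sum> b t\<^sub>1 t\<^sub>2\<close> for
  \<open>t = \<Sum> t\<^sub>1 \<otimes> t\<^sub>2\<close>. It is only used for bilinear \<open>b\<close>.\<close>

definition tens_lift ::
  "('k, 'x) ring_scheme \<Rightarrow> ('k, 'v, 'y) module_scheme \<Rightarrow> ('k, 'w, 'z) module_scheme
    \<Rightarrow> ('k, 'u, 'p) module_scheme \<Rightarrow> ('v \<Rightarrow> 'w \<Rightarrow> 'u) \<Rightarrow> (('k, 'v, 'w) tens \<Rightarrow> 'u)" where
  "tens_lift K V W U b = (THE f. f \<in> lin_hom K (tensor K V W) U \<and>
     (\<forall>v\<in>carrier V. \<forall>w\<in>carrier W. f (tens K V W v w) = b v w))"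

definition tens_map ::
  "('k, 'x) ring_scheme \<Rightarrow> ('k, 'v, 'y) module_scheme \<Rightarrow> ('k, 'w, 'z) module_scheme
    \<Rightarrow> ('k, 'v1, 'p) module_scheme \<Rightarrow> ('k, 'w1, 'q) module_scheme
    \<Rightarrow> ('v \<Rightarrow> 'v1) \<Rightarrow> ('w \<Rightarrow> 'w1) \<Rightarrow> ('k, 'v, 'w) tens \<Rightarrow> ('k, 'v1, 'w1) tens" where
  "tens_map K V W V' W' f g =
     tens_lift K V W (tensor K V' W') (\<lambda>v w. tens K V' W' (f v) (g w))"

definition flip ::
  "('k, 'x) ring_scheme \<Rightarrow> ('k, 'm, 'y) module_scheme \<Rightarrow> ('k, 'm, 'm) tens \<Rightarrow> ('k, 'm, 'm) tens"
  where "flip K M = tens_lift K M M (tensor K M M) (\<lambda>m n. tens K M M n m)"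

text \<open>The canonical isomorphism \<open>(M \<otimes> M) \<otimes> M \<rightarrow> M \<otimes> (M \<otimes> M)\<close>.\<close>

definition tens_assoc ::
  "('k, 'x) ring_scheme \<Rightarrow> ('k, 'm, 'y) module_scheme
    \<Rightarrow> ('k, ('k, 'm, 'm) tens, 'm) tens \<Rightarrow> ('k, 'm, ('k, 'm, 'm) tens) tens" where
  "tens_assoc K M =
     (let MM = tensor K M M; T = tensor K M MM in
       tens_lift K MM M T (\<lambda>t w. tens_lift K M M T (\<lambda>u v. tens K M MM u (tens K M M v w)) t))"

text \<open>\<open>M \<otimes> M \<otimes> M\<close> is taken to be \<open>M \<otimes> (M \<otimes> M)\<close>; hence \<open>R \<otimes> I\<close> is conjugated by
  \<^const>\<open>tens_assoc\<close>.\<close>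

definition op12 ::
  "('k, 'x) ring_scheme \<Rightarrow> ('k, 'm, 'y) module_scheme
    \<Rightarrow> (('k, 'm, 'm) tens \<Rightarrow> ('k, 'm, 'm) tens)
    \<Rightarrow> ('k, 'm, ('k, 'm, 'm) tens) tens \<Rightarrow> ('k, 'm, ('k, 'm, 'm) tens) tens" where
  "op12 K M R t =
     (let MM = tensor K M M in
       tens_assoc K M (tens_map K MM M MM M R (\<lambda>m. m)
         (inv_into (carrier (tensor K MM M)) (tens_assoc K M) t)))"

definition op23 ::
  "('k, 'x) ring_scheme \<Rightarrow> ('k, 'm, 'y) module_scheme
    \<Rightarrow> (('k, 'm, 'm) tens \<Rightarrow> ('k, 'm, 'm) tens)
    \<Rightarrow> ('k, 'm, ('k, 'm, 'm) tens) tens \<Rightarrow> ('k, 'm, ('k, 'm, 'm) tens) tens" where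
  "op23 K M R = (let MM = tensor K M M in tens_map K M MM M MM (\<lambda>m. m) R)"

definition D_equation ::
  "('k, 'x) ring_scheme \<Rightarrow> ('k, 'm, 'y) module_scheme
    \<Rightarrow> (('k, 'm, 'm) tens \<Rightarrow> ('k, 'm, 'm) tens) \<Rightarrow> bool" where
  "D_equation K M R \<longleftrightarrow>
     (\<forall>t\<in>carrier (tensor K M (tensor K M M)).
        op12 K M R (op23 K M R t) = op23 K M R (op12 K M R t))"


section \<open>Coalgebras and comodules\<close>

record ('k, 'c) coalg = "('k, 'c) module" +
  comult :: "'c \<Rightarrow> ('k, 'c, 'c) tens"
  counit :: "'c \<Rightarrow> 'k"

text \<open>\<open>sweedler K C U b c\<close> is \<open>\<Sum> b c\<^sub>(\<^sub>1\<^sub>) c\<^sub>(\<^sub>2\<^sub>)\<close>, an element of \<open>U\<close>.\<close>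

definition sweedler ::
  "('k, 'x) ring_scheme \<Rightarrow> ('k, 'c, 'y) coalg_scheme \<Rightarrow> ('k, 'u, 'p) module_scheme
    \<Rightarrow> ('c \<Rightarrow> 'c \<Rightarrow> 'u) \<Rightarrow> 'c \<Rightarrow> 'u" where
  "sweedler K C U b c = tens_lift K C C U b (comult C c)"

locale coalgebra =
  fixes K :: "('k, 'x) ring_scheme" and C :: "('k, 'c, 'y) coalg_scheme"
  assumes vector_space: "module K C"
    and comult_linear: "linear_map K C (tensor K C C) (comult C)"
    and counit_linear: "linear_map K C (self_module K) (counit C)"
    and coassoc: "c \<in> carrier C \<Longrightarrow>
      sweedler K C (tensor K C (tensor K C C)) (\<lambda>x y. tens K C (tensor K C C) x (comult C y)) c =
      sweedler K C (tensor K C (tensor K C C))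
        (\<lambda>x y. sweedler K C (tensor K C (tensor K C C))
          (\<lambda>x1 x2. tens K C (tensor K C C) x1 (tens K C C x2 y)) x) c"
    and counit_left: "c \<in> carrier C \<Longrightarrow> sweedler K C C (\<lambda>x y. counit C x \<odot>\<^bsub>C\<^esub> y) c = c"
    and counit_right: "c \<in> carrier C \<Longrightarrow> sweedler K C C (\<lambda>x y. counit C y \<odot>\<^bsub>C\<^esub> x) c = c"

locale right_comodule =
  fixes K :: "('k, 'x) ring_scheme" and C :: "('k, 'c, 'y) coalg_scheme"
    and M :: "('k, 'm, 'z) module_scheme" and \<rho> :: "'m \<Rightarrow> ('k, 'm, 'c) tens"
  assumes vector_space: "module K M"
    and coaction_linear: "linear_map K M (tensor K M C) \<rho>"
    and coaction_coassoc: "m \<in> carrier M \<Longrightarrow>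
      tens_lift K M C (tensor K M (tensor K C C))
        (\<lambda>x c. tens K M (tensor K C C) x (comult C c)) (\<rho> m) =
      tens_lift K M C (tensor K M (tensor K C C))
        (\<lambda>x c. tens_lift K M C (tensor K M (tensor K C C))
          (\<lambda>x0 x1. tens K M (tensor K C C) x0 (tens K C C x1 c)) (\<rho> x)) (\<rho> m)"
    and coaction_counit: "m \<in> carrier M \<Longrightarrow>
      tens_lift K M C M (\<lambda>x c. counit C c \<odot>\<^bsub>M\<^esub> x) (\<rho> m) = m"

definition coideal ::
  "('k, 'x) ring_scheme \<Rightarrow> ('k, 'c, 'y) coalg_scheme \<Rightarrow> 'c set \<Rightarrow> bool" where
  "coideal K C I \<longleftrightarrow>
     submodule I K C \<and>
     comult C ` I \<subseteq> lspan K (tensor K C C)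
       ({tens K C C x c | x c. x \<in> I \<and> c \<in> carrier C} \<union>
        {tens K C C c x | x c. x \<in> I \<and> c \<in> carrier C}) \<and>
     (\<forall>x\<in>I. counit C x = \<zero>\<^bsub>K\<^esub>)"

text \<open>The structure maps of \<open>C/I\<close> are computed on all representatives of a class; for a coideal
  \<open>I\<close> they all give the same value.\<close>

definition quot_coalg ::
  "('k, 'x) ring_scheme \<Rightarrow> ('k, 'c, 'y) coalg_scheme \<Rightarrow> 'c set \<Rightarrow> ('k, 'c set) coalg" where
  "quot_coalg K C I =
     (let Q = quot_mod K C I in
       module.extend Q (coalg.fields
         (\<lambda>X. the_elem (sweedler K C (tensor K Q Q)
                 (\<lambda>x y. tens K Q Q (I +>\<^bsub>C\<^esub> x) (I +>\<^bsub>C\<^esub> y)) ` X))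
         (\<lambda>X. the_elem (counit C ` X))))"

definition tensor_coalg ::
  "('k, 'x) ring_scheme \<Rightarrow> ('k, 'c, 'y) coalg_scheme \<Rightarrow> ('k, 'd, 'z) coalg_scheme
    \<Rightarrow> ('k, ('k, 'c, 'd) tens) coalg" where
  "tensor_coalg K C D =
     (let T = tensor K C D; TT = tensor K T T in
       module.extend T (coalg.fields
         (tens_lift K C D TT
           (\<lambda>c d. sweedler K C TT
             (\<lambda>c1 c2. sweedler K D TT
               (\<lambda>d1 d2. tens K T T (tens K C D c1 d1) (tens K C D c2 d2)) d) c))
         (tens_lift K C D (self_module K) (\<lambda>c d. counit C c \<otimes>\<^bsub>K\<^esub> counit D d))))"

definition convolution_algebra ::
  "('k, 'x) ring_scheme \<Rightarrow> ('k, 'c, 'y) coalg_scheme \<Rightarrow> ('k, 'c \<Rightarrow> 'k) module" where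
  "convolution_algebra K C = \<lparr>
     carrier = lin_hom K C (self_module K),
     mult = (\<lambda>f g. \<lambda>c\<in>carrier C. sweedler K C (self_module K) (\<lambda>x y. f x \<otimes>\<^bsub>K\<^esub> g y) c),
     one = (\<lambda>c\<in>carrier C. counit C c),
     zero = (\<lambda>c\<in>carrier C. \<zero>\<^bsub>K\<^esub>),
     add = (\<lambda>f g. \<lambda>c\<in>carrier C. f c \<oplus>\<^bsub>K\<^esub> g c),
     smult = (\<lambda>a f. \<lambda>c\<in>carrier C. a \<otimes>\<^bsub>K\<^esub> f c)\<rparr>"

text \<open>The comatrix coalgebra of order \<open>n\<close>, free on the \<open>c\<^sub>i\<^sub>j = free_gen K (i, j)\<close> with
  \<open>1 \<le> i, j \<le> n\<close>; comultiplication and counit are extended linearly from the basis.\<close>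

definition comatrix :: "('k, 'x) ring_scheme \<Rightarrow> nat \<Rightarrow> ('k, nat \<times> nat \<Rightarrow> 'k) coalg" where
  "comatrix K n =
     (let F = free_mod K ({1..n} \<times> {1..n}); FF = tensor K F F in
       module.extend F (coalg.fields
         (\<lambda>f. \<Oplus>\<^bsub>FF\<^esub>j\<in>{1..n}. \<Oplus>\<^bsub>FF\<^esub>l\<in>{1..n}.
            f (j, l) \<odot>\<^bsub>FF\<^esub> (\<Oplus>\<^bsub>FF\<^esub>u\<in>{1..n}. tens K F F (free_gen K (j, u)) (free_gen K (u, l))))
         (\<lambda>f. \<Oplus>\<^bsub>K\<^esub>j\<in>{1..n}. \<Oplus>\<^bsub>K\<^esub>l\<in>{1..n}.
            f (j, l) \<otimes>\<^bsub>K\<^esub> (if j = l then \<one>\<^bsub>K\<^esub> else \<zero>\<^bsub>K\<^esub>))))"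

text \<open>The coaction \<open>m\<^sub>l \<mapsto> \<Sum>\<^sub>v m\<^sub>v \<otimes> c\<^sub>v\<^sub>l\<close> of the comatrix coalgebra attached to a basis \<open>m\<close>.\<close>

definition basis_coaction ::
  "('k, 'x) ring_scheme \<Rightarrow> ('k, 'm, 'y) module_scheme \<Rightarrow> nat \<Rightarrow> (nat \<Rightarrow> 'm)
    \<Rightarrow> 'm \<Rightarrow> ('k, 'm, nat \<times> nat \<Rightarrow> 'k) tens" where
  "basis_coaction K M n m =
     (THE \<rho>. \<rho> \<in> lin_hom K M (tensor K M (comatrix K n)) \<and>
       (\<forall>l\<in>{1..n}. \<rho> (m l) = (\<Oplus>\<^bsub>tensor K M (comatrix K n)\<^esub>v\<in>{1..n}.
          tens K M (comatrix K n) (m v) (free_gen K (v, l)))))"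


section \<open>\<open>\<D>\<close>-maps\<close>

text \<open>The notions below are stated for a projection \<open>p\<close> from \<open>C\<close> to \<open>Q\<close>. It is the class map
  \<open>C \<rightarrow> C/I\<close> in general, and for \<open>I = 0\<close>, where \<open>C/0\<close> is identified with \<open>C\<close>, the identity.\<close>

definition D_condition ::
  "('k, 'x) ring_scheme \<Rightarrow> ('k, 'c, 'y) coalg_scheme \<Rightarrow> ('k, 'q, 'z) module_scheme \<Rightarrow> ('c \<Rightarrow> 'q)
    \<Rightarrow> (('k, 'c, 'q) tens \<Rightarrow> 'k) \<Rightarrow> bool" where
  "D_condition K C Q p \<sigma> \<longleftrightarrow>
     \<sigma> \<in> lin_hom K (tensor K C Q) (self_module K) \<and>
     (\<forall>c\<in>carrier C. \<forall>d\<in>carrier Q.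
        sweedler K C Q (\<lambda>x y. \<sigma> (tens K C Q x d) \<odot>\<^bsub>Q\<^esub> p y) c =
        sweedler K C Q (\<lambda>x y. \<sigma> (tens K C Q y d) \<odot>\<^bsub>Q\<^esub> p x) c)"

definition induced_op ::
  "('k, 'x) ring_scheme \<Rightarrow> ('k, 'c, 'y) coalg_scheme \<Rightarrow> ('k, 'q, 'z) module_scheme \<Rightarrow> ('c \<Rightarrow> 'q)
    \<Rightarrow> ('k, 'm, 'w) module_scheme \<Rightarrow> ('m \<Rightarrow> ('k, 'm, 'c) tens) \<Rightarrow> (('k, 'c, 'q) tens \<Rightarrow> 'k)
    \<Rightarrow> ('k, 'm, 'm) tens \<Rightarrow> ('k, 'm, 'm) tens" where
  "induced_op K C Q p M \<rho> \<sigma> =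
     (let MM = tensor K M M in
       tens_lift K M M MM
         (\<lambda>m n. tens_lift K M C MM
           (\<lambda>m0 m1. tens_lift K M C MM
             (\<lambda>n0 n1. \<sigma> (tens K C Q m1 (p n1)) \<odot>\<^bsub>MM\<^esub> tens K M M m0 n0) (\<rho> n)) (\<rho> m)))"

definition D_map ::
  "('k, 'x) ring_scheme \<Rightarrow> ('k, 'c, 'y) coalg_scheme \<Rightarrow> 'c set \<Rightarrow> (('k, 'c, 'c set) tens \<Rightarrow> 'k)
    \<Rightarrow> bool" where
  "D_map K C I \<sigma> \<longleftrightarrow> D_condition K C (quot_coalg K C I) (\<lambda>c. I +>\<^bsub>C\<^esub> c) \<sigma>"

definition R_of ::
  "('k, 'x) ring_scheme \<Rightarrow> ('k, 'c, 'y) coalg_scheme \<Rightarrow> 'c set \<Rightarrow> ('k, 'm, 'w) module_scheme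
    \<Rightarrow> ('m \<Rightarrow> ('k, 'm, 'c) tens) \<Rightarrow> (('k, 'c, 'c set) tens \<Rightarrow> 'k)
    \<Rightarrow> ('k, 'm, 'm) tens \<Rightarrow> ('k, 'm, 'm) tens" where
  "R_of K C I M \<rho> \<sigma> = induced_op K C (quot_coalg K C I) (\<lambda>c. I +>\<^bsub>C\<^esub> c) M \<rho> \<sigma>"

definition strongly_D_map ::
  "('k, 'x) ring_scheme \<Rightarrow> ('k, 'c, 'y) coalg_scheme \<Rightarrow> (('k, 'c, 'c) tens \<Rightarrow> 'k) \<Rightarrow> bool" where
  "strongly_D_map K C \<sigma> \<longleftrightarrow> D_condition K C C (\<lambda>c. c) \<sigma>"

definition strong_R_of ::
  "('k, 'x) ring_scheme \<Rightarrow> ('k, 'c, 'y) coalg_scheme \<Rightarrow> ('k, 'm, 'w) module_scheme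
    \<Rightarrow> ('m \<Rightarrow> ('k, 'm, 'c) tens) \<Rightarrow> (('k, 'c, 'c) tens \<Rightarrow> 'k)
    \<Rightarrow> ('k, 'm, 'm) tens \<Rightarrow> ('k, 'm, 'm) tens" where
  "strong_R_of K C M \<rho> \<sigma> = induced_op K C C (\<lambda>c. c) M \<rho> \<sigma>"

end

(* In a basis of M, write R(m_a (x) m_b) as the sum of r i j a b (m_i (x) m_j).  For the coaction
   m_l |-> sum_v m_v (x) c_vl, the equation R = R_sigma says sigma(c_ia (x) [c_jb]) = r i j a b, so
   sigma is unique.  The D-condition for such a sigma holds modulo I exactly when the elements
   sum_u r i j u b c_ua - r u j a b c_iu lie in I; their span is a coideal, and sigma vanishes on
   it precisely because of the D-equation.  If R is bijective then the inverse S satisfies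
   S^12 R^23 = R^23 S^12, so its coefficients descend to C (x) C/I as well, and convolution of
   forms is composition of operators.  If R commutes with the flip then r is symmetric, and the
   form also descends in the first argument, to the quotient coalgebra C/I. *)

theory Submission
  imports Defs
begin

section \<open>Linear maps and subspaces\<close>

text \<open>In C/I the classes of the matrix units still span but are in general linearly dependent,
  so nothing on the quotient can be prescribed on a basis. Forms and structure maps are built on C,
  where the matrix units are free, and descend because they vanish on I; identities on C/I are
  tested on the spanning classes. Since the coalgebra axioms depend only on the matrix shape of the
  comultiplication, one locale serves both C and C/I. Vanishing on I is an index computation:
  pairing c_pq with a generator of I gives two sums that are the same entry of R^23 R^12 and of R^12
  R^23. If another operator A supplies the values of the form while R still supplies I, they are
  entries of R^23 A^12 and A^12 R^23; this is why S appears in position 12 and R in position 23. The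
  coideal property comes from one mixed double sum, inserted into the comultiplication of a
  generator with both signs. For symmetric r the form satisfies s(c, [d]) = s(d, [c]), which carries
  the vanishing on I over to the first argument.\<close>

lemma self_module_simps [simp]:
  "carrier (self_module K) = carrier K" "add (self_module K) = add K"
  "zero (self_module K) = zero K" "smult (self_module K) = mult K"
  by (simp_all add: self_module_def)

lemma module_self_module:
  assumes "cring K" shows "module K (self_module K)"
proof -
  interpret cring K by fact
  have "abelian_group (self_module K)"
    by (rule abelian_groupI) (auto simp: a_assoc intro: a_comm l_neg)
  then show ?thesis
    by (rule moduleI[OF assms]) (auto simp: l_distr r_distr m_assoc)
qed

lemma finsum_self_module [simp]: "finsum (self_module K) f A = finsum K f A"
  by (simp add: finsum_def finprod_def)

lemma module_finsum_closed:
  assumes "module K V" "\<And>i. i \<in> A \<Longrightarrow> f i \<in> carrier V"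
  shows "finsum V f A \<in> carrier V"
proof -
  interpret V: module K V by fact
  show ?thesis by (rule V.M.finsum_closed) (use assms(2) in auto)
qed

lemma module_finsum_cong:
  assumes "module K V" "\<And>i. i \<in> A \<Longrightarrow> g i \<in> carrier V" "\<And>i. i \<in> A \<Longrightarrow> f i = g i"
  shows "finsum V f A = finsum V g A"
proof -
  interpret V: module K V by fact
  show ?thesis by (rule V.M.finsum_cong') (use assms in auto)
qed

lemma module_finsum_add:
  assumes "module K V" "\<And>i. i \<in> A \<Longrightarrow> f i \<in> carrier V" "\<And>i. i \<in> A \<Longrightarrow> g i \<in> carrier V"
  shows "(\<Oplus>\<^bsub>V\<^esub>i\<in>A. f i \<oplus>\<^bsub>V\<^esub> g i) = finsum V f A \<oplus>\<^bsub>V\<^esub> finsum V g A"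
proof -
  interpret V: module K V by fact
  show ?thesis by (rule V.M.finsum_addf) (use assms in auto)
qed

lemma module_finsum_swap:
  assumes "module K V" "finite A" "finite B" "\<And>i j. i \<in> A \<Longrightarrow> j \<in> B \<Longrightarrow> f i j \<in> carrier V"
  shows "(\<Oplus>\<^bsub>V\<^esub>i\<in>A. \<Oplus>\<^bsub>V\<^esub>j\<in>B. f i j) = (\<Oplus>\<^bsub>V\<^esub>j\<in>B. \<Oplus>\<^bsub>V\<^esub>i\<in>A. f i j)"
  using assms(2,4)
proof (induction A rule: finite_induct)
  case empty
  interpret V: module K V by fact
  show ?case by simp
next
  case (insert x F)
  interpret V: module K V by fact
  have "(\<Oplus>\<^bsub>V\<^esub>i\<in>insert x F. finsum V (f i) B) = finsum V (f x) B \<oplus>\<^bsub>V\<^esub> (\<Oplus>\<^bsub>V\<^esub>i\<in>F. finsum V (f i) B)"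
    using insert by (intro V.M.finsum_insert) (auto intro!: V.M.finsum_closed)
  also have "\<dots> = finsum V (f x) B \<oplus>\<^bsub>V\<^esub> (\<Oplus>\<^bsub>V\<^esub>j\<in>B. \<Oplus>\<^bsub>V\<^esub>i\<in>F. f i j)"
    using insert by simp
  also have "\<dots> = (\<Oplus>\<^bsub>V\<^esub>j\<in>B. f x j \<oplus>\<^bsub>V\<^esub> (\<Oplus>\<^bsub>V\<^esub>i\<in>F. f i j))"
    using insert by (intro module_finsum_add[symmetric, OF assms(1)]) (auto intro!: V.M.finsum_closed)
  also have "\<dots> = (\<Oplus>\<^bsub>V\<^esub>j\<in>B. \<Oplus>\<^bsub>V\<^esub>i\<in>insert x F. f i j)"
    using insert by (intro module_finsum_cong[OF assms(1)]) (auto intro!: V.M.finsum_closed)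
  finally show ?case .
qed

lemma module_finsum_single:
  assumes "module K V" "finite A" "i \<in> A" "\<And>j. j \<in> A \<Longrightarrow> f j \<in> carrier V"
    "\<And>j. j \<in> A \<Longrightarrow> j \<noteq> i \<Longrightarrow> f j = \<zero>\<^bsub>V\<^esub>"
  shows "finsum V f A = f i"
proof -
  interpret V: module K V by fact
  have "finsum V f A = (\<Oplus>\<^bsub>V\<^esub>j\<in>A. if i = j then f j else \<zero>\<^bsub>V\<^esub>)"
    using assms by (intro module_finsum_cong[OF assms(1)]) auto
  also have "\<dots> = f i" using assms by (intro V.M.finsum_singleton) auto
  finally show ?thesis .
qed

lemma module_finsum_zero:
  assumes "module K V" "\<And>i. i \<in> A \<Longrightarrow> f i = \<zero>\<^bsub>V\<^esub>"
  shows "finsum V f A = \<zero>\<^bsub>V\<^esub>"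
proof -
  interpret V: module K V by fact
  show ?thesis by (rule V.M.add.finprod_one_eqI) (simp add: assms(2))
qed

text \<open>Evaluating a map given by coefficients on a pair of basis elements always leaves such a
  Kronecker sum; the expansion in M \<otimes> M, the comatrix structure maps and forms on free
  modules all reduce to it.\<close>

lemma double_sum_delta:
  assumes "module K U" "finite A" "finite B" "a \<in> A" "b \<in> B"
    "\<And>u v. u \<in> A \<Longrightarrow> v \<in> B \<Longrightarrow> g u v \<in> carrier U"
  shows "(\<Oplus>\<^bsub>U\<^esub>u\<in>A. \<Oplus>\<^bsub>U\<^esub>v\<in>B. (if u = a \<and> v = b then \<one>\<^bsub>K\<^esub> else \<zero>\<^bsub>K\<^esub>) \<odot>\<^bsub>U\<^esub> g u v) = g a b"
proof -
  interpret U: module K U by fact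
  have c: "(\<Oplus>\<^bsub>U\<^esub>v\<in>B. (if u = a \<and> v = b then \<one>\<^bsub>K\<^esub> else \<zero>\<^bsub>K\<^esub>) \<odot>\<^bsub>U\<^esub> g u v) \<in> carrier U"
    if "u \<in> A" for u
    by (rule module_finsum_closed[OF assms(1)]) (use that assms(6) in auto)
  have "(\<Oplus>\<^bsub>U\<^esub>u\<in>A. \<Oplus>\<^bsub>U\<^esub>v\<in>B. (if u = a \<and> v = b then \<one>\<^bsub>K\<^esub> else \<zero>\<^bsub>K\<^esub>) \<odot>\<^bsub>U\<^esub> g u v)
      = (\<Oplus>\<^bsub>U\<^esub>v\<in>B. (if a = a \<and> v = b then \<one>\<^bsub>K\<^esub> else \<zero>\<^bsub>K\<^esub>) \<odot>\<^bsub>U\<^esub> g a v)"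
    by (rule module_finsum_single[OF assms(1,2,4) c])
      (use assms in \<open>auto intro!: module_finsum_zero[OF assms(1)]\<close>)
  also have "\<dots> = (if a = a \<and> b = b then \<one>\<^bsub>K\<^esub> else \<zero>\<^bsub>K\<^esub>) \<odot>\<^bsub>U\<^esub> g a b"
    by (rule module_finsum_single[OF assms(1,3,5)]) (use assms in auto)
  finally show ?thesis using assms by simp
qed

lemma linear_mapI:
  assumes "\<And>x. x \<in> carrier V \<Longrightarrow> f x \<in> carrier W"
    "\<And>x y. x \<in> carrier V \<Longrightarrow> y \<in> carrier V \<Longrightarrow> f (x \<oplus>\<^bsub>V\<^esub> y) = f x \<oplus>\<^bsub>W\<^esub> f y"
    "\<And>a x. a \<in> carrier K \<Longrightarrow> x \<in> carrier V \<Longrightarrow> f (a \<odot>\<^bsub>V\<^esub> x) = a \<odot>\<^bsub>W\<^esub> f x"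
  shows "linear_map K V W f"
  using assms by (auto simp: linear_map_def)

lemma linear_map_closed: "linear_map K V W f \<Longrightarrow> x \<in> carrier V \<Longrightarrow> f x \<in> carrier W"
  by (auto simp: linear_map_def)

lemma linear_map_add:
  "linear_map K V W f \<Longrightarrow> x \<in> carrier V \<Longrightarrow> y \<in> carrier V \<Longrightarrow> f (x \<oplus>\<^bsub>V\<^esub> y) = f x \<oplus>\<^bsub>W\<^esub> f y"
  by (auto simp: linear_map_def)

lemma linear_map_smult:
  "linear_map K V W f \<Longrightarrow> a \<in> carrier K \<Longrightarrow> x \<in> carrier V \<Longrightarrow> f (a \<odot>\<^bsub>V\<^esub> x) = a \<odot>\<^bsub>W\<^esub> f x"
  by (auto simp: linear_map_def)

lemma linear_map_zero:
  assumes "linear_map K V W f" "module K V" "module K W"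
  shows "f \<zero>\<^bsub>V\<^esub> = \<zero>\<^bsub>W\<^esub>"
proof -
  interpret V: module K V by fact
  interpret W: module K W by fact
  have "f (\<zero>\<^bsub>K\<^esub> \<odot>\<^bsub>V\<^esub> \<zero>\<^bsub>V\<^esub>) = \<zero>\<^bsub>K\<^esub> \<odot>\<^bsub>W\<^esub> f \<zero>\<^bsub>V\<^esub>"
    by (rule linear_map_smult[OF assms(1)]) auto
  then show ?thesis using linear_map_closed[OF assms(1)] by simp
qed

lemma linear_map_uminus:
  assumes "linear_map K V W f" "module K V" "module K W" "x \<in> carrier V"
  shows "f (\<ominus>\<^bsub>V\<^esub> x) = \<ominus>\<^bsub>W\<^esub> f x"
proof -
  interpret V: module K V by fact
  interpret W: module K W by fact
  have "f ((\<ominus>\<^bsub>K\<^esub> \<one>\<^bsub>K\<^esub>) \<odot>\<^bsub>V\<^esub> x) = (\<ominus>\<^bsub>K\<^esub> \<one>\<^bsub>K\<^esub>) \<odot>\<^bsub>W\<^esub> f x"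
    by (rule linear_map_smult[OF assms(1)]) (use assms in auto)
  then show ?thesis using linear_map_closed[OF assms(1)] assms(4)
    by (simp add: V.smult_l_minus W.smult_l_minus)
qed

lemma linear_map_minus:
  assumes "linear_map K V W f" "module K V" "module K W" "x \<in> carrier V" "y \<in> carrier V"
  shows "f (x \<ominus>\<^bsub>V\<^esub> y) = f x \<ominus>\<^bsub>W\<^esub> f y"
proof -
  interpret V: module K V by fact
  interpret W: module K W by fact
  show ?thesis
    using assms(4,5) linear_map_add[OF assms(1), of x "\<ominus>\<^bsub>V\<^esub> y"] linear_map_uminus[OF assms(1-3)]
    by (simp add: a_minus_def)
qed

lemma linear_map_finsum:
  assumes "linear_map K V W f" "module K V" "module K W" "finite A" "\<And>i. i \<in> A \<Longrightarrow> g i \<in> carrier V"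
  shows "f (finsum V g A) = (\<Oplus>\<^bsub>W\<^esub>i\<in>A. f (g i))"
  using assms(4,5)
proof (induction A rule: finite_induct)
  case empty
  interpret V: module K V by fact
  interpret W: module K W by fact
  show ?case by (simp add: linear_map_zero[OF assms(1-3)])
next
  case (insert x F)
  interpret V: module K V by fact
  interpret W: module K W by fact
  have "f (finsum V g (insert x F)) = f (g x \<oplus>\<^bsub>V\<^esub> finsum V g F)"
    using insert by (subst V.M.finsum_insert) auto
  also have "\<dots> = f (g x) \<oplus>\<^bsub>W\<^esub> f (finsum V g F)"
    using insert by (intro linear_map_add[OF assms(1)] V.M.finsum_closed) auto
  also have "\<dots> = (\<Oplus>\<^bsub>W\<^esub>i\<in>insert x F. f (g i))"
    using insert linear_map_closed[OF assms(1)] by (subst W.M.finsum_insert) auto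
  finally show ?case .
qed

lemma module_finsum_minus:
  assumes "module K V" "finite A" "\<And>i. i \<in> A \<Longrightarrow> f i \<in> carrier V" "\<And>i. i \<in> A \<Longrightarrow> g i \<in> carrier V"
  shows "(\<Oplus>\<^bsub>V\<^esub>i\<in>A. f i \<ominus>\<^bsub>V\<^esub> g i) = finsum V f A \<ominus>\<^bsub>V\<^esub> finsum V g A"
proof -
  interpret V: module K V by fact
  \<comment> \<open>Negation is linear, so it may be moved through the sum like any other linear
    map.\<close>
  have "linear_map K V V (a_inv V)"
    by (rule linear_mapI) (auto simp: V.M.minus_add V.smult_r_minus)
  from linear_map_finsum[OF this assms(1,1,2,4)]
  have "\<ominus>\<^bsub>V\<^esub> finsum V g A = (\<Oplus>\<^bsub>V\<^esub>i\<in>A. \<ominus>\<^bsub>V\<^esub> g i)" .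
  then show ?thesis unfolding a_minus_def
    by (subst module_finsum_add[OF assms(1)]) (simp_all add: assms)
qed

lemma linear_map_cong:
  assumes "linear_map K V W f" "module K V" "\<And>x. x \<in> carrier V \<Longrightarrow> g x = f x"
  shows "linear_map K V W g"
proof -
  interpret V: module K V by fact
  show ?thesis using assms(1,3) by (auto simp: linear_map_def)
qed

lemma linear_map_ident: "linear_map K V V (\<lambda>x. x)"
  by (auto simp: linear_map_def)

lemma linear_map_comp:
  "linear_map K V W f \<Longrightarrow> linear_map K U V g \<Longrightarrow> linear_map K U W (\<lambda>x. f (g x))"
  by (rule linear_mapI) (auto simp: linear_map_closed linear_map_add linear_map_smult)

lemma linear_map_scale:
  assumes "module K W" "linear_map K V (self_module K) f" "w \<in> carrier W"
  shows "linear_map K V W (\<lambda>x. f x \<odot>\<^bsub>W\<^esub> w)"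
proof -
  interpret W: module K W by fact
  show ?thesis
    using linear_map_closed[OF assms(2)] linear_map_add[OF assms(2)] linear_map_smult[OF assms(2)] assms(3)
    by (intro linear_mapI) (auto simp: W.smult_l_distr W.smult_assoc1)
qed

lemma linear_map_smult_fun:
  assumes "module K W" "linear_map K V W f" "a \<in> carrier K"
  shows "linear_map K V W (\<lambda>x. a \<odot>\<^bsub>W\<^esub> f x)"
proof -
  interpret W: module K W by fact
  show ?thesis
    using linear_map_closed[OF assms(2)] linear_map_add[OF assms(2)] linear_map_smult[OF assms(2)] assms(3)
    by (intro linear_mapI) (auto simp: W.smult_r_distr W.smult_assoc1[symmetric] W.R.m_comm)
qed

lemma linear_map_mult_left:
  assumes "cring K" "linear_map K V (self_module K) f" "a \<in> carrier K"
  shows "linear_map K V (self_module K) (\<lambda>x. a \<otimes>\<^bsub>K\<^esub> f x)"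
  using linear_map_smult_fun[OF module_self_module[OF assms(1)] assms(2,3)] by simp

lemma linear_map_mult_right:
  assumes "cring K" "linear_map K V (self_module K) f" "a \<in> carrier K"
  shows "linear_map K V (self_module K) (\<lambda>x. f x \<otimes>\<^bsub>K\<^esub> a)"
  using linear_map_scale[OF module_self_module[OF assms(1)] assms(2)] assms(3) by simp

lemma linear_map_zero_fun:
  assumes "module K W"
  shows "linear_map K V W (\<lambda>x. \<zero>\<^bsub>W\<^esub>)"
proof -
  interpret W: module K W by fact
  show ?thesis by (rule linear_mapI) auto
qed

lemma linear_map_add_fun:
  assumes "module K W" "linear_map K V W f" "linear_map K V W g"
  shows "linear_map K V W (\<lambda>x. f x \<oplus>\<^bsub>W\<^esub> g x)"
proof -
  interpret W: module K W by fact
  show ?thesis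
    using linear_map_closed[OF assms(2)] linear_map_add[OF assms(2)] linear_map_smult[OF assms(2)]
      linear_map_closed[OF assms(3)] linear_map_add[OF assms(3)] linear_map_smult[OF assms(3)]
    by (intro linear_mapI) (auto simp: W.smult_r_distr W.M.a_ac)
qed

lemma linear_map_finsum_fun:
  assumes "module K W" "\<And>i. i \<in> A \<Longrightarrow> linear_map K V W (f i)" "finite A"
  shows "linear_map K V W (\<lambda>x. \<Oplus>\<^bsub>W\<^esub>i\<in>A. f i x)"
proof -
  interpret W: module K W by fact
  note f = assms(2)[THEN linear_map_closed] assms(2)[THEN linear_map_add] assms(2)[THEN linear_map_smult]
  show ?thesis
  proof (rule linear_mapI)
    fix x y assume xy: "x \<in> carrier V" "y \<in> carrier V"
    then have "(\<Oplus>\<^bsub>W\<^esub>i\<in>A. f i (x \<oplus>\<^bsub>V\<^esub> y)) = (\<Oplus>\<^bsub>W\<^esub>i\<in>A. f i x \<oplus>\<^bsub>W\<^esub> f i y)"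
      using f by (intro module_finsum_cong[OF assms(1)]) auto
    also have "\<dots> = (\<Oplus>\<^bsub>W\<^esub>i\<in>A. f i x) \<oplus>\<^bsub>W\<^esub> (\<Oplus>\<^bsub>W\<^esub>i\<in>A. f i y)"
      using xy f by (intro module_finsum_add[OF assms(1)]) auto
    finally show "(\<Oplus>\<^bsub>W\<^esub>i\<in>A. f i (x \<oplus>\<^bsub>V\<^esub> y)) = (\<Oplus>\<^bsub>W\<^esub>i\<in>A. f i x) \<oplus>\<^bsub>W\<^esub> (\<Oplus>\<^bsub>W\<^esub>i\<in>A. f i y)" .
  next
    fix a x assume "a \<in> carrier K" "x \<in> carrier V"
    then show "(\<Oplus>\<^bsub>W\<^esub>i\<in>A. f i (a \<odot>\<^bsub>V\<^esub> x)) = a \<odot>\<^bsub>W\<^esub> (\<Oplus>\<^bsub>W\<^esub>i\<in>A. f i x)"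
      using f assms(3) by (subst W.finsum_smult_ldistr) (auto intro!: module_finsum_cong[OF assms(1)])
  qed (auto intro!: W.M.finsum_closed f)
qed

lemma lin_homD: "f \<in> lin_hom K V W \<Longrightarrow> linear_map K V W f"
  by (simp add: lin_hom_def)

lemma restrict_in_lin_hom:
  assumes "module K V" "linear_map K V W f"
  shows "restrict f (carrier V) \<in> lin_hom K V W"
  using linear_map_cong[OF assms(2,1), of "restrict f (carrier V)"] by (simp add: lin_hom_def)

lemma lin_hom_eqI:
  "f \<in> lin_hom K V W \<Longrightarrow> g \<in> lin_hom K V W \<Longrightarrow> (\<And>x. x \<in> carrier V \<Longrightarrow> f x = g x) \<Longrightarrow> f = g"
  by (auto simp: lin_hom_def intro: extensionalityI)

lemma submodule_preimage:
  assumes "module K V" "module K W" "linear_map K V W f" "submodule N K W"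
  shows "submodule {x \<in> carrier V. f x \<in> N} K V"
proof -
  interpret V: module K V by fact
  interpret W: module K W by fact
  note N = W.submoduleE[OF assms(4)]
  have "\<zero>\<^bsub>W\<^esub> \<in> N" using subgroup.one_closed[OF submodule.axioms(1)[OF assms(4)]] by simp
  then show ?thesis
    by (intro V.submoduleI)
      (auto simp: linear_map_zero[OF assms(3,1,2)] linear_map_uminus[OF assms(3,1,2)] N
        linear_map_add[OF assms(3)] linear_map_smult[OF assms(3)])
qed

lemma submodule_zero:
  assumes "module K V" shows "submodule {\<zero>\<^bsub>V\<^esub>} K V"
proof -
  interpret V: module K V by fact
  show ?thesis by (rule V.submoduleI) auto
qed

lemma submodule_equalizer:
  assumes "module K V" "module K W" "linear_map K V W f" "linear_map K V W g"
  shows "submodule {x \<in> carrier V. f x = g x} K V"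
proof -
  interpret V: module K V by fact
  interpret W: module K W by fact
  note fg = assms(3,4)[THEN linear_map_zero, OF assms(1,2)] 
     assms(3,4)[THEN linear_map_uminus, OF assms(1,2)]
     assms(3,4)[THEN linear_map_add] assms(3,4)[THEN linear_map_smult]
  show ?thesis by (rule V.submoduleI) (auto simp: fg)
qed

lemma lspan_least: "submodule N K V \<Longrightarrow> S \<subseteq> N \<Longrightarrow> lspan K V S \<subseteq> N"
  by (auto simp: lspan_def)

lemma lspan_base: "S \<subseteq> lspan K V S"
  by (auto simp: lspan_def)

lemma submodule_lspan:
  assumes "module K V" "S \<subseteq> carrier V"
  shows "submodule (lspan K V S) K V"
proof -
  interpret V: module K V by fact
  note E = V.submoduleE
  have Z: "\<zero>\<^bsub>V\<^esub> \<in> N" if "submodule N K V" for N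
    using subgroup.one_closed[OF submodule.axioms(1)[OF that]] by simp
  show ?thesis
    by (rule V.submoduleI)
      (use V.carrier_is_submodule assms(2) in \<open>auto simp: lspan_def intro: E Z\<close>)
qed

text \<open>The equalizer of two linear maps is a submodule, so it contains the span of any set it
  contains. This is the principle behind every test on generators, also where the generators are
  dependent.\<close>

lemma linear_map_eq_on_lspan:
  assumes "module K V" "module K W" "linear_map K V W f" "linear_map K V W g"
    "carrier V \<subseteq> lspan K V S" "S \<subseteq> carrier V" "\<And>x. x \<in> S \<Longrightarrow> f x = g x" "x \<in> carrier V"
  shows "f x = g x"
  using lspan_least[OF submodule_equalizer[OF assms(1-4)], of S] assms(5-8) by blast

lemma submodule_finsum:
  assumes "module K V" "submodule N K V" "finite A" "\<And>i. i \<in> A \<Longrightarrow> f i \<in> N"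
  shows "finsum V f A \<in> N"
  using assms(3,4)
proof (induction A rule: finite_induct)
  case empty
  interpret V: module K V by fact
  show ?case using subgroup.one_closed[OF submodule.axioms(1)[OF assms(2)]] by simp
next
  case (insert x F)
  interpret V: module K V by fact
  note N = V.submoduleE[OF assms(2)]
  show ?case using insert N(1) by (subst V.M.finsum_insert) (auto intro!: N(5))
qed

section \<open>Quotients\<close>

lemma quot_mod_simps [simp]:
  "carrier (quot_mod K V N) = a_rcosets\<^bsub>V\<^esub> N" "zero (quot_mod K V N) = N"
  "add (quot_mod K V N) = set_add V"
  by (simp_all add: quot_mod_def)

lemma abelian_subgroup_submodule:
  assumes "module K V" "submodule N K V"
  shows "abelian_subgroup N V"
proof -
  interpret V: module K V by fact
  show ?thesis
    using submodule.axioms(1)[OF assms(2)] V.M.abelian_group_axioms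
    by (intro abelian_subgroupI3 additive_subgroupI)
qed

lemma coset_in_quot_mod: "x \<in> carrier V \<Longrightarrow> N +>\<^bsub>V\<^esub> x \<in> carrier (quot_mod K V N)"
  by (auto simp: A_RCOSETS_def RCOSETS_def a_r_coset_def)

lemma quot_mod_carrierE:
  assumes "module K V" "submodule N K V" "X \<in> carrier (quot_mod K V N)"
  obtains x where "x \<in> carrier V" "X = N +>\<^bsub>V\<^esub> x"
  using assms(3) by (auto simp: A_RCOSETS_def RCOSETS_def a_r_coset_def)

lemma quot_mod_eq_iff:
  assumes "module K V" "submodule N K V" "x \<in> carrier V" "y \<in> carrier V"
  shows "N +>\<^bsub>V\<^esub> x = N +>\<^bsub>V\<^esub> y \<longleftrightarrow> x \<ominus>\<^bsub>V\<^esub> y \<in> N"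
proof -
  interpret V: module K V by fact
  interpret N: abelian_subgroup N V by (rule abelian_subgroup_submodule) fact+
  have "x \<ominus>\<^bsub>V\<^esub> y \<in> N \<longleftrightarrow> x \<in> N +>\<^bsub>V\<^esub> y"
    by (subst N.a_rcos_module[OF assms(4,3)]) (simp add: a_minus_def)
  then show ?thesis
    by (metis N.a_repr_independence' N.a_rcos_self assms(3,4))
qed

text \<open>The scalar action on cosets is a union over all representatives. Two representatives
  differ by an element of \<open>N\<close>, and so do their multiples, hence all members of the
  union are one and the same coset.\<close>

lemma quot_mod_smult:
  assumes "module K V" "submodule N K V" "a \<in> carrier K" "x \<in> carrier V"
  shows "a \<odot>\<^bsub>quot_mod K V N\<^esub> (N +>\<^bsub>V\<^esub> x) = N +>\<^bsub>V\<^esub> (a \<odot>\<^bsub>V\<^esub> x)"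
proof -
  interpret V: module K V by fact
  interpret N: abelian_subgroup N V by (rule abelian_subgroup_submodule) fact+
  note sub = V.submoduleE[OF assms(2)]
  have "N +>\<^bsub>V\<^esub> (a \<odot>\<^bsub>V\<^esub> y) = N +>\<^bsub>V\<^esub> (a \<odot>\<^bsub>V\<^esub> x)" if "y \<in> N +>\<^bsub>V\<^esub> x" for y
  proof -
    have y: "y \<in> carrier V" "N +>\<^bsub>V\<^esub> x = N +>\<^bsub>V\<^esub> y"
      using N.a_elemrcos_carrier[OF assms(4) that] N.a_repr_independence'[OF that assms(4)] by simp_all
    then have "y \<ominus>\<^bsub>V\<^esub> x \<in> N"
      using quot_mod_eq_iff[OF assms(1,2) y(1) assms(4)] by simp
    then have "a \<odot>\<^bsub>V\<^esub> (y \<ominus>\<^bsub>V\<^esub> x) \<in> N" using sub(4) assms(3) by blast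
    moreover have "a \<odot>\<^bsub>V\<^esub> (y \<ominus>\<^bsub>V\<^esub> x) = a \<odot>\<^bsub>V\<^esub> y \<ominus>\<^bsub>V\<^esub> a \<odot>\<^bsub>V\<^esub> x"
      using y assms(3,4) by (simp add: a_minus_def V.smult_r_distr V.smult_r_minus)
    ultimately show ?thesis
      using y(1) assms(3,4) by (subst quot_mod_eq_iff[OF assms(1,2)]) simp_all
  qed
  moreover have "x \<in> N +>\<^bsub>V\<^esub> x" using N.a_rcos_self assms(4) .
  moreover have "a \<odot>\<^bsub>quot_mod K V N\<^esub> (N +>\<^bsub>V\<^esub> x) = (\<Union>y\<in>N +>\<^bsub>V\<^esub> x. N +>\<^bsub>V\<^esub> (a \<odot>\<^bsub>V\<^esub> y))"
    by (simp add: quot_mod_def)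
  ultimately show ?thesis by blast
qed

lemma quot_mod_add:
  assumes "module K V" "submodule N K V" "x \<in> carrier V" "y \<in> carrier V"
  shows "(N +>\<^bsub>V\<^esub> x) \<oplus>\<^bsub>quot_mod K V N\<^esub> (N +>\<^bsub>V\<^esub> y) = N +>\<^bsub>V\<^esub> (x \<oplus>\<^bsub>V\<^esub> y)"
proof -
  interpret N: abelian_subgroup N V by (rule abelian_subgroup_submodule) fact+
  show ?thesis using N.a_rcos_sum[OF assms(3,4)] by simp
qed

lemma module_quot_mod:
  assumes "module K V" "submodule N K V"
  shows "module K (quot_mod K V N)"
proof -
  interpret V: module K V by fact
  interpret N: abelian_subgroup N V by (rule abelian_subgroup_submodule) fact+
  let ?Q = "quot_mod K V N"
  \<comment> \<open>The additive axioms are borrowed from the factor group, which has the same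
    carrier and the same addition of cosets.\<close>
  interpret Q: comm_group "V A_Mod N" by (rule N.a_factorgroup_is_comm_group)
  have Q: "carrier (V A_Mod N) = carrier ?Q" "mult (V A_Mod N) = add ?Q" "one (V A_Mod N) = zero ?Q"
    by (simp_all add: A_FactGroup_def FactGroup_def A_RCOSETS_def set_add_def)
  have "abelian_group ?Q"
    by (rule abelian_groupI; (fact Q.m_closed[unfolded Q] Q.m_assoc[unfolded Q] Q.one_closed[unfolded Q]
      Q.l_one[unfolded Q] Q.m_comm[unfolded Q] Q.l_inv_ex[unfolded Q]))
  note S = quot_mod_smult[OF assms] and A = quot_mod_add[OF assms]
  show ?thesis
    by (rule moduleI[OF V.R.is_cring \<open>abelian_group ?Q\<close>]; (elim quot_mod_carrierE[OF assms])?; hypsubst?)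
      (simp_all only: S A coset_in_quot_mod V.smult_closed V.M.a_closed V.R.a_closed V.R.m_closed
        V.R.one_closed V.smult_one V.smult_r_distr V.smult_l_distr V.smult_assoc1)
qed

lemma linear_map_coset:
  assumes "module K V" "submodule N K V"
  shows "linear_map K V (quot_mod K V N) (\<lambda>x. N +>\<^bsub>V\<^esub> x)"
  by (rule linear_mapI)
    (simp_all only: coset_in_quot_mod quot_mod_smult[OF assms] quot_mod_add[OF assms])

lemma coset_eq_zero_iff:
  assumes "module K V" "submodule N K V" "x \<in> carrier V"
  shows "N +>\<^bsub>V\<^esub> x = \<zero>\<^bsub>quot_mod K V N\<^esub> \<longleftrightarrow> x \<in> N"
proof -
  interpret V: module K V by fact
  have "\<zero>\<^bsub>quot_mod K V N\<^esub> = N +>\<^bsub>V\<^esub> \<zero>\<^bsub>V\<^esub>"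
    using linear_map_zero[OF linear_map_coset assms(1) module_quot_mod] assms by simp
  moreover have "x \<ominus>\<^bsub>V\<^esub> \<zero>\<^bsub>V\<^esub> = x" 
    using assms(3) V.smult_r_minus[of "\<zero>\<^bsub>K\<^esub>" "\<zero>\<^bsub>V\<^esub>"] by (simp add: a_minus_def)
  ultimately show ?thesis using quot_mod_eq_iff[OF assms, of "\<zero>\<^bsub>V\<^esub>"] by simp
qed

text \<open>A linear map that vanishes on \<open>N\<close> is constant on cosets, so the image of a
  coset is a singleton. This is how maps pass to a quotient without choosing representatives, in the
  form in which \<open>quot_coalg\<close> states its structure maps.\<close>

lemma the_elem_image_coset:
  assumes "module K V" "module K W" "submodule N K V" "linear_map K V W f"
    "\<And>x. x \<in> N \<Longrightarrow> f x = \<zero>\<^bsub>W\<^esub>" "x \<in> carrier V"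
  shows "the_elem (f ` (N +>\<^bsub>V\<^esub> x)) = f x"
proof -
  interpret V: module K V by fact
  interpret W: module K W by fact
  interpret N: abelian_subgroup N V by (rule abelian_subgroup_submodule) fact+
  have "f y = f x" if "y \<in> N +>\<^bsub>V\<^esub> x" for y
  proof -
    have y: "y \<in> carrier V" "N +>\<^bsub>V\<^esub> x = N +>\<^bsub>V\<^esub> y"
      using N.a_elemrcos_carrier[OF assms(6) that] N.a_repr_independence'[OF that assms(6)] by simp_all
    then have "y \<ominus>\<^bsub>V\<^esub> x \<in> N"
      using quot_mod_eq_iff[OF assms(1,3) y(1) assms(6)] by simp
    then have "f y \<ominus>\<^bsub>W\<^esub> f x = \<zero>\<^bsub>W\<^esub>"
      using assms(5) linear_map_minus[OF assms(4,1,2) y(1) assms(6)] by simp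
    moreover have "f y = (f y \<ominus>\<^bsub>W\<^esub> f x) \<oplus>\<^bsub>W\<^esub> f x"
      using linear_map_closed[OF assms(4)] y(1) assms(6) by (simp add: a_minus_def W.M.a_assoc W.M.l_neg)
    ultimately show ?thesis using linear_map_closed[OF assms(4) assms(6)] by simp
  qed
  then have "f ` (N +>\<^bsub>V\<^esub> x) = {f x}" using N.a_rcos_self[OF assms(6)] by blast
  then show ?thesis by simp
qed

lemma linear_map_quot_mod:
  assumes "module K V" "module K W" "submodule N K V" "linear_map K V W f"
    "\<And>x. x \<in> N \<Longrightarrow> f x = \<zero>\<^bsub>W\<^esub>"
  shows "linear_map K (quot_mod K V N) W (\<lambda>X. the_elem (f ` X))"
proof -
  interpret V: module K V by fact
  note simps = quot_mod_smult[OF assms(1,3)]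
    quot_mod_add[OF assms(1,3)] the_elem_image_coset[OF assms]
    linear_map_add[OF assms(4)] linear_map_smult[OF assms(4)] V.M.a_closed V.smult_closed
  show ?thesis
    by (rule linear_mapI; elim quot_mod_carrierE[OF assms(1,3)]; hypsubst)
      (simp_all only: simps linear_map_closed[OF assms(4)])
qed

section \<open>Free modules\<close>

lemma free_mod_simps [simp]:
  "zero (free_mod K S) = (\<lambda>s. \<zero>\<^bsub>K\<^esub>)"
  "(f \<oplus>\<^bsub>free_mod K S\<^esub> g) = (\<lambda>s. f s \<oplus>\<^bsub>K\<^esub> g s)"
  "(a \<odot>\<^bsub>free_mod K S\<^esub> f) = (\<lambda>s. a \<otimes>\<^bsub>K\<^esub> f s)"
  by (simp_all add: free_mod_def)

lemma free_mod_carrier: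
  "f \<in> carrier (free_mod K S) \<longleftrightarrow> (\<forall>s. f s \<in> carrier K) \<and> (\<forall>s. s \<notin> S \<longrightarrow> f s = \<zero>\<^bsub>K\<^esub>)
    \<and> finite {s. f s \<noteq> \<zero>\<^bsub>K\<^esub>}"
  by (simp add: free_mod_def)

lemma module_free_mod:
  assumes "cring K" shows "module K (free_mod K S)"
proof -
  interpret cring K by fact
  have add: "(\<lambda>s. f s \<oplus>\<^bsub>K\<^esub> g s) \<in> carrier (free_mod K S)"
    if fg: "f \<in> carrier (free_mod K S)" "g \<in> carrier (free_mod K S)" for f g
  proof -
    have "{s. f s \<oplus>\<^bsub>K\<^esub> g s \<noteq> \<zero>\<^bsub>K\<^esub>} \<subseteq> {s. f s \<noteq> \<zero>\<^bsub>K\<^esub>} \<union> {s. g s \<noteq> \<zero>\<^bsub>K\<^esub>}"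
      by auto
    then have "finite {s. f s \<oplus>\<^bsub>K\<^esub> g s \<noteq> \<zero>\<^bsub>K\<^esub>}"
      by (rule finite_subset) (use fg in \<open>simp add: free_mod_carrier\<close>)
    then show ?thesis using fg by (simp add: free_mod_carrier)
  qed
  have smult: "(\<lambda>s. a \<otimes>\<^bsub>K\<^esub> f s) \<in> carrier (free_mod K S)"
    if f: "f \<in> carrier (free_mod K S)" "a \<in> carrier K" for f a
  proof -
    have "{s. a \<otimes>\<^bsub>K\<^esub> f s \<noteq> \<zero>\<^bsub>K\<^esub>} \<subseteq> {s. f s \<noteq> \<zero>\<^bsub>K\<^esub>}"
      using f by auto
    then have "finite {s. a \<otimes>\<^bsub>K\<^esub> f s \<noteq> \<zero>\<^bsub>K\<^esub>}"
      by (rule finite_subset) (use f in \<open>simp add: free_mod_carrier\<close>)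
    then show ?thesis using f by (simp add: free_mod_carrier)
  qed
  have neg: "\<exists>g\<in>carrier (free_mod K S). (\<lambda>s. g s \<oplus>\<^bsub>K\<^esub> f s) = (\<lambda>s. \<zero>\<^bsub>K\<^esub>)"
    if f: "f \<in> carrier (free_mod K S)" for f
    using that smult[OF f, of "\<ominus>\<^bsub>K\<^esub> \<one>\<^bsub>K\<^esub>"]
    by (intro bexI[of _ "\<lambda>s. (\<ominus>\<^bsub>K\<^esub> \<one>\<^bsub>K\<^esub>) \<otimes>\<^bsub>K\<^esub> f s"]) (auto simp: free_mod_carrier l_minus l_neg fun_eq_iff)
  have "abelian_group (free_mod K S)"
  proof (rule abelian_groupI)
    fix f g assume "f \<in> carrier (free_mod K S)" "g \<in> carrier (free_mod K S)"
    then show "f \<oplus>\<^bsub>free_mod K S\<^esub> g \<in> carrier (free_mod K S)" using add by simp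
  next
    fix f assume "f \<in> carrier (free_mod K S)"
    then show "\<exists>g\<in>carrier (free_mod K S). g \<oplus>\<^bsub>free_mod K S\<^esub> f = \<zero>\<^bsub>free_mod K S\<^esub>" using neg by simp
  qed (auto simp: free_mod_carrier a_assoc intro: a_comm)
  then show ?thesis
  proof (rule moduleI[OF assms])
    fix a f assume "a \<in> carrier K" "f \<in> carrier (free_mod K S)"
    then show "a \<odot>\<^bsub>free_mod K S\<^esub> f \<in> carrier (free_mod K S)" using smult by simp
  qed (auto simp: free_mod_carrier l_distr r_distr m_assoc)
qed

lemma free_gen_closed:
  assumes "cring K" "s \<in> S" shows "free_gen K s \<in> carrier (free_mod K S)"
proof -
  interpret cring K by fact
  have "{t. free_gen K s t \<noteq> \<zero>\<^bsub>K\<^esub>} \<subseteq> {s}" by (auto simp: free_gen_def)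
  then have "finite {t. free_gen K s t \<noteq> \<zero>\<^bsub>K\<^esub>}" by (rule finite_subset) simp
  then show ?thesis using assms(2) by (auto simp: free_mod_carrier free_gen_def)
qed

lemma linear_map_eval:
  "linear_map K (free_mod K S) (self_module K) (\<lambda>f. f s)"
  by (rule linear_mapI) (auto simp: free_mod_carrier)

lemma free_mod_expansion:
  assumes "cring K" "f \<in> carrier (free_mod K S)"
  shows "f = (\<Oplus>\<^bsub>free_mod K S\<^esub>s\<in>{s. f s \<noteq> \<zero>\<^bsub>K\<^esub>}. f s \<odot>\<^bsub>free_mod K S\<^esub> free_gen K s)" (is "_ = ?g")
proof
  fix t
  interpret cring K by fact
  interpret F: module K "free_mod K S" by (rule module_free_mod) fact
  note f = assms(2)[unfolded free_mod_carrier]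
  have gen: "f s \<odot>\<^bsub>free_mod K S\<^esub> free_gen K s \<in> carrier (free_mod K S)" if "f s \<noteq> \<zero>\<^bsub>K\<^esub>" for s
    using f that by (intro F.smult_closed free_gen_closed[OF assms(1)]) auto
  \<comment> \<open>Evaluation at \<open>t\<close> is linear, so the sum of functions is computed
    pointwise; at most the summand with index \<open>t\<close> survives.\<close>
  have "?g t = (\<Oplus>\<^bsub>self_module K\<^esub>s\<in>{s. f s \<noteq> \<zero>\<^bsub>K\<^esub>}. (f s \<odot>\<^bsub>free_mod K S\<^esub> free_gen K s) t)"
    by (rule linear_map_finsum[OF linear_map_eval F.module_axioms module_self_module[OF assms(1)]])
      (use f gen in auto)
  also have "\<dots> = f t"
  proof (cases "f t = \<zero>\<^bsub>K\<^esub>")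
    case True
    then show ?thesis using f
      by (simp del: finsum_self_module) (subst module_finsum_zero[OF module_self_module[OF assms(1)]], auto simp: free_gen_def)
  next
    case False
    show ?thesis
      by (subst module_finsum_single[OF module_self_module[OF assms(1)], where i = t])
       (use f False in \<open>auto simp: free_gen_def\<close>)
  qed
  finally show "f t = ?g t" ..
qed

lemma lspan_free_gen:
  assumes "cring K" "\<And>s. s \<in> S \<Longrightarrow> free_gen K s \<in> B" "B \<subseteq> carrier (free_mod K S)"
  shows "carrier (free_mod K S) \<subseteq> lspan K (free_mod K S) B"
proof
  fix f assume f: "f \<in> carrier (free_mod K S)"
  interpret F: module K "free_mod K S" by (rule module_free_mod) fact
  note N = submodule_lspan[OF F.module_axioms assms(3)]
  note sub = F.submoduleE[OF N]
  show "f \<in> lspan K (free_mod K S) B"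
    using f assms(2) lspan_base[of B K "free_mod K S"] unfolding free_mod_carrier
    by (subst free_mod_expansion[OF assms(1) f]) (intro submodule_finsum[OF F.module_axioms N] sub(4); blast)
qed

definition free_ext :: "('k, 'x) ring_scheme \<Rightarrow> ('k, 'u, 'y) module_scheme \<Rightarrow> ('s \<Rightarrow> 'u) \<Rightarrow> ('s \<Rightarrow> 'k) \<Rightarrow> 'u" where
  "free_ext K U \<phi> f = (\<Oplus>\<^bsub>U\<^esub>s\<in>{s. f s \<noteq> \<zero>\<^bsub>K\<^esub>}. f s \<odot>\<^bsub>U\<^esub> \<phi> s)"

text \<open>\<open>free_ext\<close> sums over the support, and the supports of \<open>f\<close>,
  \<open>g\<close> and \<open>f + g\<close> differ. Enlarging the index set by zero terms brings all
  three to one common finite set, where additivity is termwise.\<close>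

lemma free_ext_superset:
  assumes "module K U" "f \<in> carrier (free_mod K S)" "\<And>s. s \<in> S \<Longrightarrow> \<phi> s \<in> carrier U"
    "finite T" "T \<subseteq> S" "{s. f s \<noteq> \<zero>\<^bsub>K\<^esub>} \<subseteq> T"
  shows "free_ext K U \<phi> f = (\<Oplus>\<^bsub>U\<^esub>s\<in>T. f s \<odot>\<^bsub>U\<^esub> \<phi> s)"
proof -
  interpret U: module K U by fact
  show ?thesis unfolding free_ext_def using assms(2-)
    by (intro U.M.add.finprod_mono_neutral_cong_left) (auto simp: free_mod_carrier subset_iff)
qed

lemma linear_map_free_ext:
  assumes "module K U" "\<And>s. s \<in> S \<Longrightarrow> \<phi> s \<in> carrier U"
  shows "linear_map K (free_mod K S) U (free_ext K U \<phi>)"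
proof -
  interpret U: module K U by fact
  interpret F: module K "free_mod K S" by (rule module_free_mod) (rule U.R.is_cring)
  have S: "finite {s. f s \<noteq> \<zero>\<^bsub>K\<^esub>}" "{s. f s \<noteq> \<zero>\<^bsub>K\<^esub>} \<subseteq> S" "\<And>s. f s \<in> carrier K"
    if "f \<in> carrier (free_mod K S)" for f
    using that by (auto simp: free_mod_carrier)
  show ?thesis
  proof (rule linear_mapI)
    fix f assume f: "f \<in> carrier (free_mod K S)"
    then show "free_ext K U \<phi> f \<in> carrier U" unfolding free_ext_def
      using S[OF f] assms(2) by (intro U.M.finsum_closed) auto
  next
    fix f g assume fg: "f \<in> carrier (free_mod K S)" "g \<in> carrier (free_mod K S)"
    let ?T = "{s. f s \<noteq> \<zero>\<^bsub>K\<^esub>} \<union> {s. g s \<noteq> \<zero>\<^bsub>K\<^esub>}"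
    have T: "finite ?T" "?T \<subseteq> S" using S[OF fg(1)] S[OF fg(2)] by auto
    have h: "f \<oplus>\<^bsub>free_mod K S\<^esub> g \<in> carrier (free_mod K S)" using fg by (rule F.M.a_closed)
    note E = free_ext_superset[where \<phi> = \<phi>, OF assms(1) _ assms(2) T]
    show "free_ext K U \<phi> (f \<oplus>\<^bsub>free_mod K S\<^esub> g) = free_ext K U \<phi> f \<oplus>\<^bsub>U\<^esub> free_ext K U \<phi> g"
    proof -
      have "free_ext K U \<phi> (f \<oplus>\<^bsub>free_mod K S\<^esub> g) = (\<Oplus>\<^bsub>U\<^esub>s\<in>?T. (f \<oplus>\<^bsub>free_mod K S\<^esub> g) s \<odot>\<^bsub>U\<^esub> \<phi> s)"
        using S(3)[OF fg(1)] S(3)[OF fg(2)] by (intro E[OF h]) auto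
      also have "\<dots> = (\<Oplus>\<^bsub>U\<^esub>s\<in>?T. f s \<odot>\<^bsub>U\<^esub> \<phi> s \<oplus>\<^bsub>U\<^esub> g s \<odot>\<^bsub>U\<^esub> \<phi> s)"
        using S(3)[OF fg(1)] S(3)[OF fg(2)] T(2) assms(2)
        by (intro module_finsum_cong[OF assms(1)]) (auto simp: U.smult_l_distr subset_iff)
      also have "\<dots> = (\<Oplus>\<^bsub>U\<^esub>s\<in>?T. f s \<odot>\<^bsub>U\<^esub> \<phi> s) \<oplus>\<^bsub>U\<^esub> (\<Oplus>\<^bsub>U\<^esub>s\<in>?T. g s \<odot>\<^bsub>U\<^esub> \<phi> s)"
        using S(3)[OF fg(1)] S(3)[OF fg(2)] T(2) assms(2)
        by (intro module_finsum_add[OF assms(1)]) (auto simp: subset_iff)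
      also have "\<dots> = free_ext K U \<phi> f \<oplus>\<^bsub>U\<^esub> free_ext K U \<phi> g"
        by (simp only: E[OF fg(1) _ Un_upper1] E[OF fg(2) _ Un_upper2])
      finally show ?thesis .
    qed
  next
    fix a f assume a: "a \<in> carrier K" and f: "f \<in> carrier (free_mod K S)"
    have h: "a \<odot>\<^bsub>free_mod K S\<^esub> f \<in> carrier (free_mod K S)" using a f by (rule F.smult_closed)
    note E = free_ext_superset[OF assms(1) _ assms(2) S(1,2)[OF f]]
    show "free_ext K U \<phi> (a \<odot>\<^bsub>free_mod K S\<^esub> f) = a \<odot>\<^bsub>U\<^esub> free_ext K U \<phi> f"
      using S[OF f] a assms(2)
      by (subst E[OF h], (auto)[2], subst E[OF f], (auto)[2], subst U.finsum_smult_ldistr)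
       (auto intro!: module_finsum_cong[OF assms(1)] simp: U.smult_assoc1 subset_iff)
  qed
qed

lemma free_ext_gen:
  assumes "module K U" "\<And>s. s \<in> S \<Longrightarrow> \<phi> s \<in> carrier U" "s \<in> S"
  shows "free_ext K U \<phi> (free_gen K s) = \<phi> s"
proof -
  interpret U: module K U by fact
  show ?thesis
    using assms(2)[of s] assms(3)
    by (subst free_ext_superset[OF assms(1) free_gen_closed[OF U.R.is_cring assms(3)] assms(2), where T = "{s}"])
      (auto simp: free_gen_def split: if_splits)
qed

section \<open>Tensor products\<close>

definition bilinear ::
  "('k, 'x) ring_scheme \<Rightarrow> ('k, 'v, 'y) module_scheme \<Rightarrow> ('k, 'w, 'z) module_scheme
    \<Rightarrow> ('k, 'u, 'p) module_scheme \<Rightarrow> ('v \<Rightarrow> 'w \<Rightarrow> 'u) \<Rightarrow> bool" where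
  "bilinear K V W U b \<longleftrightarrow>
     (\<forall>v\<in>carrier V. linear_map K W U (b v)) \<and> (\<forall>w\<in>carrier W. linear_map K V U (\<lambda>v. b v w))"

lemma bilinearI:
  "(\<And>v. v \<in> carrier V \<Longrightarrow> linear_map K W U (b v)) \<Longrightarrow>
    (\<And>w. w \<in> carrier W \<Longrightarrow> linear_map K V U (\<lambda>v. b v w)) \<Longrightarrow> bilinear K V W U b"
  by (simp add: bilinear_def)

lemma bilinear_right: "bilinear K V W U b \<Longrightarrow> v \<in> carrier V \<Longrightarrow> linear_map K W U (b v)"
  by (simp add: bilinear_def)

lemma bilinear_left: "bilinear K V W U b \<Longrightarrow> w \<in> carrier W \<Longrightarrow> linear_map K V U (\<lambda>v. b v w)"
  by (simp add: bilinear_def)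

lemma bilinear_closed:
  "bilinear K V W U b \<Longrightarrow> v \<in> carrier V \<Longrightarrow> w \<in> carrier W \<Longrightarrow> b v w \<in> carrier U"
  by (rule linear_map_closed[OF bilinear_right])

lemma tensor_rels_subset:
  assumes "module K V" "module K W"
  shows "tensor_rels K V W \<subseteq> carrier (free_mod K (carrier V \<times> carrier W))"
proof -
  interpret V: module K V by fact
  interpret W: module K W by fact
  interpret F: module K "free_mod K (carrier V \<times> carrier W)" by (rule module_free_mod) (rule V.R.is_cring)
  have g: "free_gen K (v, w) \<in> carrier (free_mod K (carrier V \<times> carrier W))"
    if "v \<in> carrier V" "w \<in> carrier W" for v w
    using that by (intro free_gen_closed V.R.is_cring) auto
  show ?thesis unfolding tensor_rels_def Let_def
    by (intro Un_least subsetI; elim CollectE exE conjE; hypsubst)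
      (intro F.M.minus_closed F.M.a_closed F.smult_closed g V.M.a_closed W.M.a_closed V.smult_closed W.smult_closed; assumption)+
qed

lemma tensor_rels_mem:
  fixes K V W
  defines "F \<equiv> free_mod K (carrier V \<times> carrier W)" and "g \<equiv> free_gen K"
  shows "v \<in> carrier V \<Longrightarrow> v' \<in> carrier V \<Longrightarrow> w \<in> carrier W \<Longrightarrow>
      g (v \<oplus>\<^bsub>V\<^esub> v', w) \<ominus>\<^bsub>F\<^esub> (g (v, w) \<oplus>\<^bsub>F\<^esub> g (v', w)) \<in> tensor_rels K V W"
    and "v \<in> carrier V \<Longrightarrow> w \<in> carrier W \<Longrightarrow> w' \<in> carrier W \<Longrightarrow>
      g (v, w \<oplus>\<^bsub>W\<^esub> w') \<ominus>\<^bsub>F\<^esub> (g (v, w) \<oplus>\<^bsub>F\<^esub> g (v, w')) \<in> tensor_rels K V W"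
    and "a \<in> carrier K \<Longrightarrow> v \<in> carrier V \<Longrightarrow> w \<in> carrier W \<Longrightarrow>
      g (a \<odot>\<^bsub>V\<^esub> v, w) \<ominus>\<^bsub>F\<^esub> (a \<odot>\<^bsub>F\<^esub> g (v, w)) \<in> tensor_rels K V W"
    and "a \<in> carrier K \<Longrightarrow> v \<in> carrier V \<Longrightarrow> w \<in> carrier W \<Longrightarrow>
      g (v, a \<odot>\<^bsub>W\<^esub> w) \<ominus>\<^bsub>F\<^esub> (a \<odot>\<^bsub>F\<^esub> g (v, w)) \<in> tensor_rels K V W"
  unfolding tensor_rels_def Let_def F_def g_def
  subgoal by (rule UnI1, rule UnI1, rule UnI1) (intro CollectI exI conjI; (rule refl | assumption))
  subgoal by (rule UnI1, rule UnI1, rule UnI2) (intro CollectI exI conjI; (rule refl | assumption))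
  subgoal by (rule UnI1, rule UnI2) (intro CollectI exI conjI; (rule refl | assumption))
  subgoal by (rule UnI2) (intro CollectI exI conjI; (rule refl | assumption))
  done

lemma submodule_tensor_null:
  assumes "module K V" "module K W"
  shows "submodule (tensor_null K V W) K (free_mod K (carrier V \<times> carrier W))"
proof -
  interpret V: module K V by fact
  show ?thesis unfolding tensor_null_def
    by (intro submodule_lspan module_free_mod V.R.is_cring tensor_rels_subset assms)
qed

lemma module_tensor:
  assumes "module K V" "module K W"
  shows "module K (tensor K V W)"
proof -
  interpret V: module K V by fact
  show ?thesis unfolding tensor_def
    by (intro module_quot_mod module_free_mod V.R.is_cring submodule_tensor_null assms)
qed

text \<open>Each of the four families in \<open>tensor_rels\<close> is one of the four laws of
  bilinearity: the difference of its two sides lies in the subspace that is divided out.\<close>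

lemma bilinear_tens:
  assumes "module K V" "module K W"
  shows "bilinear K V W (tensor K V W) (tens K V W)"
proof -
  interpret V: module K V by fact
  interpret W: module K W by fact
  let ?F = "free_mod K (carrier V \<times> carrier W)"
  let ?N = "tensor_null K V W"
  have F: "module K ?F" by (intro module_free_mod V.R.is_cring)
  interpret F: module K ?F by (rule F)
  note N = submodule_tensor_null[OF assms]
  have g: "free_gen K (v, w) \<in> carrier ?F" if "v \<in> carrier V" "w \<in> carrier W" for v w
    using that by (intro free_gen_closed V.R.is_cring) auto
  note add = quot_mod_add[OF F N] and smult = quot_mod_smult[OF F N]
  have rel: "r \<in> ?N" if "r \<in> tensor_rels K V W" for r
    using that unfolding tensor_null_def by (rule subsetD[OF lspan_base])
  note eq = quot_mod_eq_iff[OF F N, THEN iffD2]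
  note closed = F.M.a_closed F.smult_closed V.M.a_closed W.M.a_closed V.smult_closed W.smult_closed g
  let ?t = "\<lambda>v w. ?N +>\<^bsub>?F\<^esub> free_gen K (v, w)"
  let ?T = "quot_mod K ?F ?N"
  have tc: "?t v w \<in> carrier ?T" if "v \<in> carrier V" "w \<in> carrier W" for v w
    by (rule coset_in_quot_mod[OF g[OF that]])
  have t1: "?t (v \<oplus>\<^bsub>V\<^esub> v') w = ?t v w \<oplus>\<^bsub>?T\<^esub> ?t v' w"
    if "v \<in> carrier V" "v' \<in> carrier V" "w \<in> carrier W" for v v' w
    unfolding add[OF g[OF that(1,3)] g[OF that(2,3)]]
    by (rule eq[OF _ _ rel[OF tensor_rels_mem(1)[OF that]]]) (intro closed that)+
  have t2: "?t v (w \<oplus>\<^bsub>W\<^esub> w') = ?t v w \<oplus>\<^bsub>?T\<^esub> ?t v w'"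
    if "v \<in> carrier V" "w \<in> carrier W" "w' \<in> carrier W" for v w w'
    unfolding add[OF g[OF that(1,2)] g[OF that(1,3)]]
    by (rule eq[OF _ _ rel[OF tensor_rels_mem(2)[OF that]]]) (intro closed that)+
  have t3: "?t (a \<odot>\<^bsub>V\<^esub> v) w = a \<odot>\<^bsub>?T\<^esub> ?t v w"
    if "a \<in> carrier K" "v \<in> carrier V" "w \<in> carrier W" for a v w
    unfolding smult[OF that(1) g[OF that(2,3)]]
    by (rule eq[OF _ _ rel[OF tensor_rels_mem(3)[OF that]]]) (intro closed that)+
  have t4: "?t v (a \<odot>\<^bsub>W\<^esub> w) = a \<odot>\<^bsub>?T\<^esub> ?t v w"
    if "a \<in> carrier K" "v \<in> carrier V" "w \<in> carrier W" for a v w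
    unfolding smult[OF that(1) g[OF that(2,3)]]
    by (rule eq[OF _ _ rel[OF tensor_rels_mem(4)[OF that]]]) (intro closed that)+
  show ?thesis unfolding tensor_def bilinear_def linear_map_def tens_def
    by (intro conjI ballI funcsetI tc t1 t2 t3 t4; assumption)
qed

lemma tens_closed:
  "module K V \<Longrightarrow> module K W \<Longrightarrow> v \<in> carrier V \<Longrightarrow> w \<in> carrier W \<Longrightarrow> tens K V W v w \<in> carrier (tensor K V W)"
  by (rule bilinear_closed[OF bilinear_tens])

text \<open>Being in the span is a submodule condition, so it is extended one variable at a time:
  first \<open>w\<close> runs from \<open>T\<close> over all of \<open>W\<close> with
  \<open>v\<close> fixed in \<open>S\<close>, then \<open>v\<close> runs over all of
  \<open>V\<close>. The classes of the free generators are exactly the pure tensors.\<close>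

lemma tensor_lspan:
  assumes "module K V" "module K W" "carrier V \<subseteq> lspan K V S" "S \<subseteq> carrier V"
    "carrier W \<subseteq> lspan K W T" "T \<subseteq> carrier W"
  shows "carrier (tensor K V W) \<subseteq> lspan K (tensor K V W) ((\<lambda>(v, w). tens K V W v w) ` (S \<times> T))"
    (is "_ \<subseteq> ?L")
proof -
  interpret V: module K V by fact
  let ?F = "free_mod K (carrier V \<times> carrier W)"
  let ?N = "tensor_null K V W"
  have F: "module K ?F" by (intro module_free_mod V.R.is_cring)
  note N = submodule_tensor_null[OF assms(1,2)] and b = bilinear_tens[OF assms(1,2)]
  note VW = module_tensor[OF assms(1,2)]
  have L: "submodule ?L K (tensor K V W)"
    by (rule submodule_lspan[OF VW]) (use assms(4,6) tens_closed[OF assms(1,2)] in auto)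
  have base: "tens K V W v w \<in> ?L" if "v \<in> S" "w \<in> T" for v w
    by (rule subsetD[OF lspan_base]) (use that in auto)
  have 1: "tens K V W v w \<in> ?L" if "v \<in> S" "w \<in> carrier W" for v w
  proof -
    have "v \<in> carrier V" using that(1) assms(4) by blast
    then have "lspan K W T \<subseteq> {w \<in> carrier W. tens K V W v w \<in> ?L}"
      by (intro lspan_least submodule_preimage[OF assms(2) VW bilinear_right[OF b] L])
        (use base[OF that(1)] assms(6) in auto)
    then show ?thesis using assms(5) that(2) by blast
  qed
  have 2: "tens K V W v w \<in> ?L" if "v \<in> carrier V" "w \<in> carrier W" for v w
  proof -
    have "lspan K V S \<subseteq> {v \<in> carrier V. tens K V W v w \<in> ?L}"
      by (intro lspan_least submodule_preimage[OF assms(1) VW bilinear_left[OF b that(2)] L])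
        (use 1[OF _ that(2)] assms(4) in auto)
    then show ?thesis using assms(3) that(1) by blast
  qed
  have g: "s \<in> carrier V \<times> carrier W \<Longrightarrow> free_gen K s \<in> carrier ?F" for s
    by (rule free_gen_closed[OF V.R.is_cring])
  have "lspan K ?F (free_gen K ` (carrier V \<times> carrier W)) \<subseteq> {x \<in> carrier ?F. ?N +>\<^bsub>?F\<^esub> x \<in> ?L}"
  proof (rule lspan_least[OF submodule_preimage[OF F VW _ L]])
    show "linear_map K ?F (tensor K V W) (\<lambda>x. ?N +>\<^bsub>?F\<^esub> x)"
      unfolding tensor_def by (rule linear_map_coset[OF F N])
    show "free_gen K ` (carrier V \<times> carrier W) \<subseteq> {x \<in> carrier ?F. ?N +>\<^bsub>?F\<^esub> x \<in> ?L}"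
    proof (intro image_subsetI CollectI conjI g)
      fix s assume "s \<in> carrier V \<times> carrier W"
      then show "?N +>\<^bsub>?F\<^esub> free_gen K s \<in> ?L" using 2[of "fst s" "snd s"] by (auto simp: tens_def)
    qed
  qed
  moreover have "carrier ?F \<subseteq> lspan K ?F (free_gen K ` (carrier V \<times> carrier W))"
    by (rule lspan_free_gen[OF V.R.is_cring]) (use g in auto)
  ultimately have *: "?N +>\<^bsub>?F\<^esub> x \<in> ?L" if "x \<in> carrier ?F" for x using that by blast
  show ?thesis
  proof
    fix t assume "t \<in> carrier (tensor K V W)"
    then obtain x where x: "x \<in> carrier ?F" "t = ?N +>\<^bsub>?F\<^esub> x"
      unfolding tensor_def by (rule quot_mod_carrierE[OF F N])
    show "t \<in> ?L" unfolding x(2) by (rule *[OF x(1)])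
  qed
qed

lemma tensor_eq_on_lspan:
  assumes "module K V" "module K W" "carrier V \<subseteq> lspan K V S" "S \<subseteq> carrier V"
    "carrier W \<subseteq> lspan K W T" "T \<subseteq> carrier W" "module K U"
    "linear_map K (tensor K V W) U f" "linear_map K (tensor K V W) U g"
    "\<And>v w. v \<in> S \<Longrightarrow> w \<in> T \<Longrightarrow> f (tens K V W v w) = g (tens K V W v w)"
    "t \<in> carrier (tensor K V W)"
  shows "f t = g t"
proof (rule linear_map_eq_on_lspan[OF module_tensor[OF assms(1,2)] assms(7-9) tensor_lspan[OF assms(1-6)] _ _ assms(11)])
  show "(\<lambda>(v, w). tens K V W v w) ` (S \<times> T) \<subseteq> carrier (tensor K V W)"
    using tens_closed[OF assms(1,2)] assms(4,6) by auto
  show "f x = g x" if "x \<in> (\<lambda>(v, w). tens K V W v w) ` (S \<times> T)" for x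
    using that assms(10) by auto
qed

lemma tensor_eq_on_tens:
  assumes "module K V" "module K W" "module K U"
    "linear_map K (tensor K V W) U f" "linear_map K (tensor K V W) U g"
    "\<And>v w. v \<in> carrier V \<Longrightarrow> w \<in> carrier W \<Longrightarrow> f (tens K V W v w) = g (tens K V W v w)"
    "t \<in> carrier (tensor K V W)"
  shows "f t = g t"
  by (rule tensor_eq_on_lspan[OF assms(1,2) lspan_base subset_refl lspan_base subset_refl assms(3-7)])

text \<open>The universal property, which gives the definite description in \<open>tens_lift\<close>
  its meaning. Existence: the free extension of \<open>b\<close> kills the tensor relations and
  therefore descends. Uniqueness: pure tensors span, and members of \<open>lin_hom\<close> are
  extensional.\<close>

lemma tens_lift_ex:
  assumes "module K V" "module K W" "module K U" "bilinear K V W U b"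
  shows "\<exists>!f. f \<in> lin_hom K (tensor K V W) U \<and>
     (\<forall>v\<in>carrier V. \<forall>w\<in>carrier W. f (tens K V W v w) = b v w)"
proof -
  interpret V: module K V by fact
  interpret W: module K W by fact
  interpret U: module K U by fact
  let ?F = "free_mod K (carrier V \<times> carrier W)"
  let ?N = "tensor_null K V W"
  have F: "module K ?F" by (intro module_free_mod V.R.is_cring)
  interpret F: module K ?F by (rule F)
  note N = submodule_tensor_null[OF assms(1,2)]
  let ?h = "free_ext K U (\<lambda>s. b (fst s) (snd s))"
  have b: "s \<in> carrier V \<times> carrier W \<Longrightarrow> b (fst s) (snd s) \<in> carrier U" for s
    using bilinear_closed[OF assms(4)] by auto
  have h: "linear_map K ?F U ?h" by (rule linear_map_free_ext[OF assms(3) b])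
  have hg: "?h (free_gen K (v, w)) = b v w" if "v \<in> carrier V" "w \<in> carrier W" for v w
    using free_ext_gen[where \<phi> = "\<lambda>s. b (fst s) (snd s)" and s = "(v, w)", OF assms(3) b] that by auto
  have g: "free_gen K (v, w) \<in> carrier ?F" if "v \<in> carrier V" "w \<in> carrier W" for v w
    using that by (intro free_gen_closed V.R.is_cring) auto
  note closed = F.M.a_closed F.smult_closed V.M.a_closed W.M.a_closed V.smult_closed W.smult_closed g
  note simps = linear_map_minus[OF h F assms(3)] linear_map_add[OF h] linear_map_smult[OF h] closed hg
    linear_map_add[OF bilinear_left[OF assms(4)]] linear_map_add[OF bilinear_right[OF assms(4)]]
    linear_map_smult[OF bilinear_left[OF assms(4)]] linear_map_smult[OF bilinear_right[OF assms(4)]]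
    bilinear_closed[OF assms(4)] U.M.a_closed U.smult_closed
  have minus_self: "x \<ominus>\<^bsub>U\<^esub> x = \<zero>\<^bsub>U\<^esub>" if "x \<in> carrier U" for x
    using that by (simp add: a_minus_def U.M.r_neg)
  \<comment> \<open>By bilinearity of \<open>b\<close> both terms of a relation have the same image,
    so the relation is sent to a difference of equal elements.\<close>
  have "?h r = \<zero>\<^bsub>U\<^esub>" if "r \<in> tensor_rels K V W" for r
    using that unfolding tensor_rels_def Let_def
    by (elim UnE CollectE exE conjE; hypsubst) (simp_all only: simps minus_self)
  then have "tensor_rels K V W \<subseteq> {x \<in> carrier ?F. ?h x \<in> {\<zero>\<^bsub>U\<^esub>}}"
    using tensor_rels_subset[OF assms(1,2)] by blast
  then have "?N \<subseteq> {x \<in> carrier ?F. ?h x \<in> {\<zero>\<^bsub>U\<^esub>}}" unfolding tensor_null_def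
    by (intro lspan_least submodule_preimage[OF F assms(3) h] submodule_zero assms)
  then have h0: "?h x = \<zero>\<^bsub>U\<^esub>" if "x \<in> ?N" for x using that by auto
  let ?f = "restrict (\<lambda>X. the_elem (?h ` X)) (carrier (tensor K V W))"
  have f: "?f \<in> lin_hom K (tensor K V W) U"
    using linear_map_quot_mod[OF F assms(3) N h h0]
    by (intro restrict_in_lin_hom module_tensor assms) (simp add: tensor_def)
  have ft: "?f (tens K V W v w) = b v w" if "v \<in> carrier V" "w \<in> carrier W" for v w
    using tens_closed[OF assms(1,2) that] the_elem_image_coset[OF F assms(3) N h h0 g[OF that]] hg[OF that]
    by (simp add: tens_def)
  have "f' = ?f" if f': "f' \<in> lin_hom K (tensor K V W) U"
      "\<forall>v\<in>carrier V. \<forall>w\<in>carrier W. f' (tens K V W v w) = b v w" for f'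
  proof (rule lin_hom_eqI[OF f'(1) f])
    have "f' (tens K V W v w) = ?f (tens K V W v w)" if "v \<in> carrier V" "w \<in> carrier W" for v w
      using f'(2) ft[OF that] that by simp
    then show "f' x = ?f x" if "x \<in> carrier (tensor K V W)" for x
      using tensor_eq_on_tens[OF assms(1-3) lin_homD[OF f'(1)] lin_homD[OF f] _ that] by blast
  qed
  then show ?thesis using f ft by blast
qed

lemma tens_lift_lin_hom:
  "module K V \<Longrightarrow> module K W \<Longrightarrow> module K U \<Longrightarrow> bilinear K V W U b \<Longrightarrow>
    tens_lift K V W U b \<in> lin_hom K (tensor K V W) U"
  unfolding tens_lift_def using theI'[OF tens_lift_ex] by blast

lemma linear_map_tens_lift:
  "module K V \<Longrightarrow> module K W \<Longrightarrow> module K U \<Longrightarrow> bilinear K V W U b \<Longrightarrow>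
    linear_map K (tensor K V W) U (tens_lift K V W U b)"
  by (rule lin_homD[OF tens_lift_lin_hom])

lemma tens_lift_tens:
  assumes "module K V" "module K W" "module K U" "bilinear K V W U b" "v \<in> carrier V" "w \<in> carrier W"
  shows "tens_lift K V W U b (tens K V W v w) = b v w"
  using theI'[OF tens_lift_ex[OF assms(1-4)]] assms(5,6) unfolding tens_lift_def by blast

section \<open>Multilinear expressions\<close>

lemma linear_map_tens_left:
  assumes "module K A" "module K B" "linear_map K V A f" "w \<in> carrier B"
  shows "linear_map K V (tensor K A B) (\<lambda>x. tens K A B (f x) w)"
  using linear_map_comp[OF bilinear_left[OF bilinear_tens[OF assms(1,2)] assms(4)] assms(3)] .

lemma linear_map_tens_right:
  assumes "module K A" "module K B" "linear_map K V B f" "w \<in> carrier A"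
  shows "linear_map K V (tensor K A B) (\<lambda>x. tens K A B w (f x))"
  using linear_map_comp[OF bilinear_right[OF bilinear_tens[OF assms(1,2)] assms(4)] assms(3)] .

lemma linear_map_tens_lift_arg:
  assumes "module K A" "module K B" "module K U" "bilinear K A B U b" "linear_map K V (tensor K A B) f"
  shows "linear_map K V U (\<lambda>x. tens_lift K A B U b (f x))"
  by (rule linear_map_comp[OF linear_map_tens_lift[OF assms(1-4)] assms(5)])

text \<open>Nested Sweedler sums put a variable into the bilinear map rather than into the tensor.
  For fixed parameters both sides of each linearity law are linear in \<open>t\<close>, so they are
  compared on pure tensors, where \<open>b\<close> itself is linear in the parameter.\<close>

lemma linear_map_tens_lift_param:
  assumes "module K A" "module K B" "module K U" "module K V"
    "\<And>x. x \<in> carrier V \<Longrightarrow> bilinear K A B U (b x)"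
    "\<And>a c. a \<in> carrier A \<Longrightarrow> c \<in> carrier B \<Longrightarrow> linear_map K V U (\<lambda>x. b x a c)"
    "t \<in> carrier (tensor K A B)"
  shows "linear_map K V U (\<lambda>x. tens_lift K A B U (b x) t)"
proof -
  interpret U: module K U by fact
  interpret V: module K V by fact
  note L = linear_map_tens_lift[OF assms(1-3,5)] and T = tens_lift_tens[OF assms(1-3,5)]
  show ?thesis
  proof (rule linear_mapI)
    fix x assume "x \<in> carrier V"
    then show "tens_lift K A B U (b x) t \<in> carrier U" by (intro linear_map_closed[OF L] assms(7))
  next
    fix x y assume xy: "x \<in> carrier V" "y \<in> carrier V"
    show "tens_lift K A B U (b (x \<oplus>\<^bsub>V\<^esub> y)) t = tens_lift K A B U (b x) t \<oplus>\<^bsub>U\<^esub> tens_lift K A B U (b y) t"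
      by (rule tensor_eq_on_tens[OF assms(1-3) _ _ _ assms(7)])
        (use xy in \<open>simp_all add: T L linear_map_add_fun[OF assms(3)] linear_map_add[OF assms(6)]\<close>)
  next
    fix a x assume xy: "a \<in> carrier K" "x \<in> carrier V"
    show "tens_lift K A B U (b (a \<odot>\<^bsub>V\<^esub> x)) t = a \<odot>\<^bsub>U\<^esub> tens_lift K A B U (b x) t"
      by (rule tensor_eq_on_tens[OF assms(1-3) _ _ _ assms(7)])
        (use xy in \<open>simp_all add: T L linear_map_smult_fun[OF assms(3)] linear_map_smult[OF assms(6)]\<close>)
  qed
qed

section \<open>Coordinates\<close>

locale based_module =
  fixes K :: "('k, 'x) ring_scheme" and M :: "('k, 'm, 'y) module_scheme"
    and n :: nat and m :: "nat \<Rightarrow> 'm"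
  assumes is_module: "module K M" and basis: "is_basis K M n m"
begin

abbreviation "N \<equiv> {1..n}"
abbreviation "KK \<equiv> self_module K"

lemma cring: "cring K"
  using is_module by (simp add: module_def)

lemma self: "module K (KK)"
  by (rule module_self_module[OF cring])

lemma basis_closed: "i \<in> N \<Longrightarrow> m i \<in> carrier M"
  using basis by (auto simp: is_basis_def)

definition coord :: "nat \<Rightarrow> 'm \<Rightarrow> 'k" where
  "coord i x = (THE a. a \<in> N \<rightarrow>\<^sub>E carrier K \<and> x = (\<Oplus>\<^bsub>M\<^esub>i\<in>N. a i \<odot>\<^bsub>M\<^esub> m i)) i"

lemma coord:
  assumes "x \<in> carrier M"
  shows "i \<in> N \<Longrightarrow> coord i x \<in> carrier K" "x = (\<Oplus>\<^bsub>M\<^esub>i\<in>N. coord i x \<odot>\<^bsub>M\<^esub> m i)"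
proof -
  have "\<exists>!a. a \<in> N \<rightarrow>\<^sub>E carrier K \<and> x = (\<Oplus>\<^bsub>M\<^esub>i\<in>N. a i \<odot>\<^bsub>M\<^esub> m i)"
    using basis assms by (simp add: is_basis_def)
  then have *: "(THE a. a \<in> N \<rightarrow>\<^sub>E carrier K \<and> x = (\<Oplus>\<^bsub>M\<^esub>i\<in>N. a i \<odot>\<^bsub>M\<^esub> m i)) \<in> N \<rightarrow>\<^sub>E carrier K
      \<and> x = (\<Oplus>\<^bsub>M\<^esub>i\<in>N. (THE a. a \<in> N \<rightarrow>\<^sub>E carrier K \<and> x = (\<Oplus>\<^bsub>M\<^esub>i\<in>N. a i \<odot>\<^bsub>M\<^esub> m i)) i \<odot>\<^bsub>M\<^esub> m i)"
    by (rule theI')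
  show "coord i x \<in> carrier K" if "i \<in> N"
    unfolding coord_def by (rule PiE_mem[OF conjunct1[OF *] that])
  show "x = (\<Oplus>\<^bsub>M\<^esub>i\<in>N. coord i x \<odot>\<^bsub>M\<^esub> m i)"
    unfolding coord_def by (rule conjunct2[OF *])
qed

lemma coord_unique:
  assumes "\<And>i. i \<in> N \<Longrightarrow> a i \<in> carrier K" "x = (\<Oplus>\<^bsub>M\<^esub>i\<in>N. a i \<odot>\<^bsub>M\<^esub> m i)" "i \<in> N"
  shows "coord i x = a i"
proof -
  interpret M: module K M by (rule is_module)
  have a: "a i \<odot>\<^bsub>M\<^esub> m i \<in> carrier M" if "i \<in> N" for i
    by (rule M.smult_closed[OF assms(1)[OF that] basis_closed[OF that]])
  then have x: "x \<in> carrier M" unfolding assms(2) by (rule module_finsum_closed[OF is_module])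
  have u: "\<exists>!a. a \<in> N \<rightarrow>\<^sub>E carrier K \<and> x = (\<Oplus>\<^bsub>M\<^esub>i\<in>N. a i \<odot>\<^bsub>M\<^esub> m i)"
    using basis x by (simp add: is_basis_def)
  \<comment> \<open>\<open>is_basis\<close> asserts uniqueness among extensional families, so
    \<open>a\<close> is cut down to \<open>N\<close> before it is compared with the chosen
    one.\<close>
  have "x = (\<Oplus>\<^bsub>M\<^esub>i\<in>N. restrict a N i \<odot>\<^bsub>M\<^esub> m i)"
    unfolding assms(2) by (rule module_finsum_cong[OF is_module]) (simp_all add: a)
  moreover have "restrict a N \<in> N \<rightarrow>\<^sub>E carrier K"
    using assms(1) by auto
  ultimately have "(THE a. a \<in> N \<rightarrow>\<^sub>E carrier K \<and> x = (\<Oplus>\<^bsub>M\<^esub>i\<in>N. a i \<odot>\<^bsub>M\<^esub> m i)) = restrict a N"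
    by (intro the1_equality[OF u] conjI)
  then show ?thesis unfolding coord_def using assms(3) by simp
qed

lemma linear_coord:
  assumes "i \<in> N"
  shows "linear_map K M (KK) (coord i)"
proof -
  interpret M: module K M by (rule is_module)
  have sm: "a \<odot>\<^bsub>M\<^esub> m j \<in> carrier M" if "a \<in> carrier K" "j \<in> N" for a j
    by (rule M.smult_closed[OF that(1) basis_closed[OF that(2)]])
  show ?thesis
  proof (rule linear_mapI)
    fix x assume "x \<in> carrier M"
    then show "coord i x \<in> carrier (KK)" using coord(1) assms by simp
  next
    fix x y assume xy: "x \<in> carrier M" "y \<in> carrier M"
    have "x \<oplus>\<^bsub>M\<^esub> y = (\<Oplus>\<^bsub>M\<^esub>i\<in>N. coord i x \<odot>\<^bsub>M\<^esub> m i) \<oplus>\<^bsub>M\<^esub> (\<Oplus>\<^bsub>M\<^esub>i\<in>N. coord i y \<odot>\<^bsub>M\<^esub> m i)"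
      using coord(2)[OF xy(1)] coord(2)[OF xy(2)] by simp
    also have "\<dots> = (\<Oplus>\<^bsub>M\<^esub>i\<in>N. coord i x \<odot>\<^bsub>M\<^esub> m i \<oplus>\<^bsub>M\<^esub> coord i y \<odot>\<^bsub>M\<^esub> m i)"
      by (rule module_finsum_add[OF is_module, symmetric]) (intro sm coord(1) xy; assumption)+
    also have "\<dots> = (\<Oplus>\<^bsub>M\<^esub>i\<in>N. (coord i x \<oplus>\<^bsub>K\<^esub> coord i y) \<odot>\<^bsub>M\<^esub> m i)"
      by (rule module_finsum_cong[OF is_module])
        (use coord(1)[OF xy(1)] coord(1)[OF xy(2)] basis_closed in \<open>simp_all add: M.smult_l_distr sm\<close>)
    finally have "coord i (x \<oplus>\<^bsub>M\<^esub> y) = coord i x \<oplus>\<^bsub>K\<^esub> coord i y"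
      by (intro coord_unique[where a = "\<lambda>i. coord i x \<oplus>\<^bsub>K\<^esub> coord i y"] M.R.a_closed coord(1) xy assms)
    then show "coord i (x \<oplus>\<^bsub>M\<^esub> y) = coord i x \<oplus>\<^bsub>KK\<^esub> coord i y" by simp
  next
    fix a x assume a: "a \<in> carrier K" and x: "x \<in> carrier M"
    have "a \<odot>\<^bsub>M\<^esub> x = a \<odot>\<^bsub>M\<^esub> (\<Oplus>\<^bsub>M\<^esub>i\<in>N. coord i x \<odot>\<^bsub>M\<^esub> m i)"
      using coord(2)[OF x] by simp
    also have "\<dots> = (\<Oplus>\<^bsub>M\<^esub>i\<in>N. a \<odot>\<^bsub>M\<^esub> (coord i x \<odot>\<^bsub>M\<^esub> m i))"
      by (rule M.finsum_smult_ldistr) (use a x coord(1) sm in auto)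
    also have "\<dots> = (\<Oplus>\<^bsub>M\<^esub>i\<in>N. (a \<otimes>\<^bsub>K\<^esub> coord i x) \<odot>\<^bsub>M\<^esub> m i)"
      by (rule module_finsum_cong[OF is_module])
        (use a coord(1)[OF x] basis_closed in \<open>simp_all add: M.smult_assoc1 sm\<close>)
    finally have "coord i (a \<odot>\<^bsub>M\<^esub> x) = a \<otimes>\<^bsub>K\<^esub> coord i x"
      by (intro coord_unique[where a = "\<lambda>i. a \<otimes>\<^bsub>K\<^esub> coord i x"] M.R.m_closed coord(1) x a assms)
    then show "coord i (a \<odot>\<^bsub>M\<^esub> x) = a \<odot>\<^bsub>KK\<^esub> coord i x" by simp
  qed
qed

lemma coord_basis:
  assumes "i \<in> N" "j \<in> N"
  shows "coord i (m j) = (if i = j then \<one>\<^bsub>K\<^esub> else \<zero>\<^bsub>K\<^esub>)"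
proof (rule coord_unique[where a = "\<lambda>i. if i = j then \<one>\<^bsub>K\<^esub> else \<zero>\<^bsub>K\<^esub>", OF _ _ assms(1)])
  interpret M: module K M by (rule is_module)
  show "m j = (\<Oplus>\<^bsub>M\<^esub>i\<in>N. (if i = j then \<one>\<^bsub>K\<^esub> else \<zero>\<^bsub>K\<^esub>) \<odot>\<^bsub>M\<^esub> m i)"
    by (subst module_finsum_single[OF is_module, where i = j]) (use assms basis_closed in auto)
qed (use cring in \<open>auto intro: cring.cring_simprules\<close>)

lemma span: "carrier M \<subseteq> lspan K M (m ` N)"
proof
  interpret M: module K M by (rule is_module)
  have L: "submodule (lspan K M (m ` N)) K M"
    by (rule submodule_lspan[OF is_module]) (use basis_closed in auto)
  fix x assume x: "x \<in> carrier M"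
  have b: "m i \<in> lspan K M (m ` N)" if "i \<in> N" for i
    by (rule subsetD[OF lspan_base]) (use that in auto)
  show "x \<in> lspan K M (m ` N)"
    by (subst coord(2)[OF x], rule submodule_finsum[OF is_module L], simp)
      (rule M.submoduleE(4)[OF L coord(1)[OF x] b])
qed

lemma m_subset: "m ` N \<subseteq> carrier M"
  using basis_closed by auto

lemma linear_eq_on_basis:
  assumes "module K U" "linear_map K M U f" "linear_map K M U g"
    "\<And>i. i \<in> N \<Longrightarrow> f (m i) = g (m i)" "x \<in> carrier M"
  shows "f x = g x"
  by (rule linear_map_eq_on_lspan[OF is_module assms(1-3) span m_subset _ assms(5)]) (use assms(4) in auto)

lemma tensor_eq_on_basis:
  assumes "module K U" "linear_map K (tensor K M M) U f" "linear_map K (tensor K M M) U g"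
    "\<And>i j. i \<in> N \<Longrightarrow> j \<in> N \<Longrightarrow> f (tens K M M (m i) (m j)) = g (tens K M M (m i) (m j))"
    "t \<in> carrier (tensor K M M)"
  shows "f t = g t"
  by (rule tensor_eq_on_lspan[OF is_module is_module span m_subset span m_subset assms(1-3) _ assms(5)])
    (use assms(4) in auto)

definition basis_ext :: "('k, 'u, 'p) module_scheme \<Rightarrow> (nat \<Rightarrow> 'u) \<Rightarrow> 'm \<Rightarrow> 'u" where
  "basis_ext U \<phi> x = (\<Oplus>\<^bsub>U\<^esub>i\<in>N. coord i x \<odot>\<^bsub>U\<^esub> \<phi> i)"

lemma linear_basis_ext:
  assumes "module K U" "\<And>i. i \<in> N \<Longrightarrow> \<phi> i \<in> carrier U"
  shows "linear_map K M U (basis_ext U \<phi>)"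
  unfolding basis_ext_def
  by (intro linear_map_finsum_fun linear_map_scale assms linear_coord finite_atLeastAtMost)

lemma basis_ext_basis:
  assumes "module K U" "\<And>i. i \<in> N \<Longrightarrow> \<phi> i \<in> carrier U" "j \<in> N"
  shows "basis_ext U \<phi> (m j) = \<phi> j"
proof -
  interpret U: module K U by fact
  show ?thesis unfolding basis_ext_def
    by (subst module_finsum_single[OF assms(1), where i = j]) (use assms coord_basis in auto)
qed

section \<open>Coordinates on M \<otimes> M\<close>

abbreviation "MM \<equiv> tensor K M M"
abbreviation "mm i j \<equiv> tens K M M (m i) (m j)"

lemma MM: "module K MM"
  by (rule module_tensor[OF is_module is_module])

lemma mm_closed: "i \<in> N \<Longrightarrow> j \<in> N \<Longrightarrow> mm i j \<in> carrier MM"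
  by (intro tens_closed is_module basis_closed)

context
  notes atLeastAtMost_iff [simp del] One_nat_def [simp del]
begin

text \<open>The product of two coordinate functionals. Being supplied by the universal property, it
  is well defined on tensors, and its values on the \<open>mm a b\<close> show that these are
  linearly independent.\<close>

definition tcoord :: "nat \<Rightarrow> nat \<Rightarrow> ('k, 'm, 'm) tens \<Rightarrow> 'k" where
  "tcoord i j = tens_lift K M M (KK) (\<lambda>x y. coord i x \<otimes>\<^bsub>K\<^esub> coord j y)"

lemma bilinear_coord:
  assumes "i \<in> N" "j \<in> N"
  shows "bilinear K M M (KK) (\<lambda>x y. coord i x \<otimes>\<^bsub>K\<^esub> coord j y)"
  by (intro bilinearI linear_map_mult_left linear_map_mult_right linear_coord cring assms)
    (use coord(1) assms in auto)

lemma linear_tcoord: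
  "i \<in> N \<Longrightarrow> j \<in> N \<Longrightarrow> linear_map K MM (KK) (tcoord i j)"
  unfolding tcoord_def by (intro linear_map_tens_lift is_module self bilinear_coord)

lemma tcoord_closed:
  "i \<in> N \<Longrightarrow> j \<in> N \<Longrightarrow> t \<in> carrier MM \<Longrightarrow> tcoord i j t \<in> carrier K"
  using linear_map_closed[OF linear_tcoord] by simp

lemma tcoord_tens:
  "i \<in> N \<Longrightarrow> j \<in> N \<Longrightarrow> x \<in> carrier M \<Longrightarrow> y \<in> carrier M \<Longrightarrow>
    tcoord i j (tens K M M x y) = coord i x \<otimes>\<^bsub>K\<^esub> coord j y"
  unfolding tcoord_def by (intro tens_lift_tens is_module self bilinear_coord)

lemma tcoord_mm:
  assumes "i \<in> N" "j \<in> N" "a \<in> N" "b \<in> N"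
  shows "tcoord i j (mm a b) = (if i = a \<and> j = b then \<one>\<^bsub>K\<^esub> else \<zero>\<^bsub>K\<^esub>)"
proof -
  interpret cring K by (rule cring)
  show ?thesis using assms by (simp add: tcoord_tens basis_closed coord_basis)
qed

text \<open>Both sides are linear in \<open>t\<close> and agree on the \<open>mm i j\<close>. The
  identity for \<open>f\<close> gives the expansion in the product basis; a coordinate functional
  composed with operators for \<open>f\<close> gives the formula for a product of matrices.\<close>

lemma tensor_expansion:
  assumes "module K U" "linear_map K MM U f" "t \<in> carrier MM"
  shows "f t = (\<Oplus>\<^bsub>U\<^esub>u\<in>N. \<Oplus>\<^bsub>U\<^esub>v\<in>N. tcoord u v t \<odot>\<^bsub>U\<^esub> f (mm u v))"
proof (rule tensor_eq_on_basis[OF assms(1,2) _ _ assms(3)])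
  interpret U: module K U by fact
  have f: "f (mm u v) \<in> carrier U" if "u \<in> N" "v \<in> N" for u v
    by (rule linear_map_closed[OF assms(2) mm_closed[OF that]])
  show "linear_map K MM U (\<lambda>t. \<Oplus>\<^bsub>U\<^esub>u\<in>N. \<Oplus>\<^bsub>U\<^esub>v\<in>N. tcoord u v t \<odot>\<^bsub>U\<^esub> f (mm u v))"
    by (intro linear_map_finsum_fun linear_map_scale linear_tcoord f assms(1) finite_atLeastAtMost)
  fix i j assume ij: "i \<in> N" "j \<in> N"
  have "(\<Oplus>\<^bsub>U\<^esub>u\<in>N. \<Oplus>\<^bsub>U\<^esub>v\<in>N. tcoord u v (mm i j) \<odot>\<^bsub>U\<^esub> f (mm u v)) =
    (\<Oplus>\<^bsub>U\<^esub>u\<in>N. \<Oplus>\<^bsub>U\<^esub>v\<in>N. (if u = i \<and> v = j then \<one>\<^bsub>K\<^esub> else \<zero>\<^bsub>K\<^esub>) \<odot>\<^bsub>U\<^esub> f (mm u v))"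
    using ij f by (intro module_finsum_cong[OF assms(1)] module_finsum_closed[OF assms(1)]) (auto simp: tcoord_mm)
  also have "\<dots> = f (mm i j)"
    by (rule double_sum_delta[OF assms(1) finite_atLeastAtMost finite_atLeastAtMost ij f])
  finally show "f (mm i j) = (\<Oplus>\<^bsub>U\<^esub>u\<in>N. \<Oplus>\<^bsub>U\<^esub>v\<in>N. tcoord u v (mm i j) \<odot>\<^bsub>U\<^esub> f (mm u v))" ..
qed

lemma tensor_eqI:
  assumes "s \<in> carrier MM" "t \<in> carrier MM"
    "\<And>i j. i \<in> N \<Longrightarrow> j \<in> N \<Longrightarrow> tcoord i j s = tcoord i j t"
  shows "s = t"
proof -
  interpret MM: module K MM by (rule MM)
  have "s = (\<Oplus>\<^bsub>MM\<^esub>u\<in>N. \<Oplus>\<^bsub>MM\<^esub>v\<in>N. tcoord u v s \<odot>\<^bsub>MM\<^esub> mm u v)"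
    by (rule tensor_expansion[OF MM linear_map_ident assms(1)])
  also have "\<dots> = (\<Oplus>\<^bsub>MM\<^esub>u\<in>N. \<Oplus>\<^bsub>MM\<^esub>v\<in>N. tcoord u v t \<odot>\<^bsub>MM\<^esub> mm u v)"
    using assms by (intro module_finsum_cong[OF MM] module_finsum_closed[OF MM] MM.smult_closed
      tcoord_closed mm_closed) auto
  also have "\<dots> = t"
    by (rule tensor_expansion[OF MM linear_map_ident assms(2), symmetric])
  finally show ?thesis .
qed

lemma tcoord_sum:
  assumes "\<And>u v. u \<in> N \<Longrightarrow> v \<in> N \<Longrightarrow> s u v \<in> carrier K" "i \<in> N" "j \<in> N"
  shows "tcoord i j (\<Oplus>\<^bsub>MM\<^esub>u\<in>N. \<Oplus>\<^bsub>MM\<^esub>v\<in>N. s u v \<odot>\<^bsub>MM\<^esub> mm u v) = s i j"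
proof -
  interpret MM: module K MM by (rule MM)
  interpret cring K by (rule cring)
  note N = finite_atLeastAtMost
  have c: "s u v \<odot>\<^bsub>MM\<^esub> mm u v \<in> carrier MM" if "u \<in> N" "v \<in> N" for u v
    by (intro MM.smult_closed mm_closed assms that)
  note lin = linear_map_finsum[OF linear_tcoord[OF assms(2,3)] MM self N]
  have "tcoord i j (\<Oplus>\<^bsub>MM\<^esub>u\<in>N. \<Oplus>\<^bsub>MM\<^esub>v\<in>N. s u v \<odot>\<^bsub>MM\<^esub> mm u v)
    = (\<Oplus>\<^bsub>KK\<^esub>u\<in>N. tcoord i j (\<Oplus>\<^bsub>MM\<^esub>v\<in>N. s u v \<odot>\<^bsub>MM\<^esub> mm u v))"
    by (rule lin) (rule module_finsum_closed[OF MM c])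
  also have "\<dots> = (\<Oplus>\<^bsub>KK\<^esub>u\<in>N. \<Oplus>\<^bsub>KK\<^esub>v\<in>N.
      (if u = i \<and> v = j then \<one>\<^bsub>K\<^esub> else \<zero>\<^bsub>K\<^esub>) \<odot>\<^bsub>KK\<^esub> s u v)"
  proof (rule module_finsum_cong[OF self])
    fix u assume u: "u \<in> N"
    have "tcoord i j (\<Oplus>\<^bsub>MM\<^esub>v\<in>N. s u v \<odot>\<^bsub>MM\<^esub> mm u v)
      = (\<Oplus>\<^bsub>KK\<^esub>v\<in>N. tcoord i j (s u v \<odot>\<^bsub>MM\<^esub> mm u v))"
      by (rule lin) (rule c[OF u])
    also have "\<dots> = (\<Oplus>\<^bsub>KK\<^esub>v\<in>N.
      (if u = i \<and> v = j then \<one>\<^bsub>K\<^esub> else \<zero>\<^bsub>K\<^esub>) \<odot>\<^bsub>KK\<^esub> s u v)"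
      by (rule module_finsum_cong[OF self])
        (use u assms in \<open>auto simp: linear_map_smult[OF linear_tcoord] mm_closed tcoord_mm\<close>)
    finally show "tcoord i j (\<Oplus>\<^bsub>MM\<^esub>v\<in>N. s u v \<odot>\<^bsub>MM\<^esub> mm u v) = (\<Oplus>\<^bsub>KK\<^esub>v\<in>N.
      (if u = i \<and> v = j then \<one>\<^bsub>K\<^esub> else \<zero>\<^bsub>K\<^esub>) \<odot>\<^bsub>KK\<^esub> s u v)" .
    show "(\<Oplus>\<^bsub>KK\<^esub>v\<in>N. (if u = i \<and> v = j then \<one>\<^bsub>K\<^esub> else \<zero>\<^bsub>K\<^esub>) \<odot>\<^bsub>KK\<^esub> s u v)
      \<in> carrier (KK)"
      by (rule module_finsum_closed[OF self]) (use assms u in auto)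
  qed
  also have "\<dots> = s i j"
    by (rule double_sum_delta[OF self finite_atLeastAtMost finite_atLeastAtMost assms(2,3), where g = s]) (simp only: self_module_simps assms(1))
  finally show ?thesis .
qed

section \<open>The D-equation in coordinates\<close>

abbreviation "MtMM \<equiv> tensor K M MM"
abbreviation "MMtM \<equiv> tensor K MM M"

lemma MtMM: "module K MtMM" and MMtM: "module K MMtM"
  by (intro module_tensor MM is_module)+

abbreviation "assoc \<equiv> tens_assoc K M"

text \<open>An explicit inverse of \<open>tens_assoc\<close>. It replaces the choice of preimages by
  \<open>inv_into\<close> in \<open>op12\<close> and makes the linearity of that inverse
  visible.\<close>

definition unassoc :: "('k, 'm, ('k, 'm, 'm) tens) tens \<Rightarrow> ('k, ('k, 'm, 'm) tens, 'm) tens" where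
  "unassoc = tens_lift K M MM MMtM (\<lambda>u s. tens_lift K M M MMtM (\<lambda>v w. tens K MM M (tens K M M u v) w) s)"

lemmas lin_intros = linear_map_tens_left linear_map_tens_right linear_map_ident

lemma bilinear_assoc1:
  assumes "w \<in> carrier M"
  shows "bilinear K M M MtMM (\<lambda>u v. tens K M MM u (tens K M M v w))"
  by (intro bilinearI lin_intros is_module MM tens_closed assms)

lemma bilinear_assoc:
  "bilinear K MM M MtMM (\<lambda>t w. tens_lift K M M MtMM (\<lambda>u v. tens K M MM u (tens K M M v w)) t)"
  by (intro bilinearI linear_map_tens_lift_param linear_map_tens_lift_arg bilinear_assoc1 lin_intros
      is_module MM MtMM tens_closed)

lemma linear_assoc: "linear_map K MMtM MtMM assoc"
  unfolding tens_assoc_def Let_def by (intro linear_map_tens_lift MM is_module MtMM bilinear_assoc)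

lemma assoc_tens:
  assumes "u \<in> carrier M" "v \<in> carrier M" "w \<in> carrier M"
  shows "assoc (tens K MM M (tens K M M u v) w) = tens K M MM u (tens K M M v w)"
  unfolding tens_assoc_def Let_def
  by (subst tens_lift_tens[OF MM is_module MtMM bilinear_assoc _ assms(3)], intro tens_closed is_module assms)
    (rule tens_lift_tens[OF is_module is_module MtMM bilinear_assoc1[OF assms(3)] assms(1,2)])

lemma bilinear_unassoc1:
  assumes "u \<in> carrier M"
  shows "bilinear K M M MMtM (\<lambda>v w. tens K MM M (tens K M M u v) w)"
  by (intro bilinearI lin_intros is_module MM tens_closed assms)

lemma bilinear_unassoc:
  "bilinear K M MM MMtM (\<lambda>u s. tens_lift K M M MMtM (\<lambda>v w. tens K MM M (tens K M M u v) w) s)"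
  by (intro bilinearI linear_map_tens_lift_param linear_map_tens_lift_arg bilinear_unassoc1 lin_intros
      is_module MM MMtM tens_closed)

lemma linear_unassoc: "linear_map K MtMM MMtM unassoc"
  unfolding unassoc_def by (intro linear_map_tens_lift MM is_module MMtM bilinear_unassoc)

lemma unassoc_tens:
  assumes "u \<in> carrier M" "v \<in> carrier M" "w \<in> carrier M"
  shows "unassoc (tens K M MM u (tens K M M v w)) = tens K MM M (tens K M M u v) w"
  unfolding unassoc_def
  by (subst tens_lift_tens[OF is_module MM MMtM bilinear_unassoc assms(1)], intro tens_closed is_module assms)
    (rule tens_lift_tens[OF is_module is_module MMtM bilinear_unassoc1[OF assms(1)] assms(2,3)])

text \<open>With pure tensors as a spanning set of M \<otimes> M, maps on a triple tensor product
  need only be compared on tensors of three vectors.\<close>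

lemmas MM_span = tensor_lspan[OF is_module is_module lspan_base subset_refl lspan_base subset_refl]

lemma MM_span_subset: "(\<lambda>(v, w). tens K M M v w) ` (carrier M \<times> carrier M) \<subseteq> carrier MM"
  using tens_closed[OF is_module is_module] by auto

lemma unassoc_assoc:
  assumes "t \<in> carrier MMtM" shows "unassoc (assoc t) = t"
  by (rule tensor_eq_on_lspan[OF MM is_module MM_span MM_span_subset lspan_base subset_refl MMtM
        linear_map_comp[OF linear_unassoc linear_assoc] linear_map_ident _ assms])
    (auto simp: assoc_tens unassoc_tens)

lemma assoc_unassoc:
  assumes "t \<in> carrier MtMM" shows "assoc (unassoc t) = t"
  by (rule tensor_eq_on_lspan[OF is_module MM lspan_base subset_refl MM_span MM_span_subset MtMM
        linear_map_comp[OF linear_assoc linear_unassoc] linear_map_ident _ assms])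
    (auto simp: assoc_tens unassoc_tens)

lemma inv_assoc:
  assumes "t \<in> carrier MtMM" shows "inv_into (carrier MMtM) assoc t = unassoc t"
proof (rule inv_into_f_eq)
  show "inj_on assoc (carrier MMtM)" by (rule inj_on_inverseI[where g = unassoc]) (rule unassoc_assoc)
qed (use assms assoc_unassoc linear_map_closed[OF linear_unassoc] in auto)

section \<open>Operators acting on two of three tensor factors\<close>

abbreviation "tens1 A \<equiv> tens_map K MM M MM M A (\<lambda>x. x)"

lemma bilinear_tens1:
  assumes "linear_map K MM MM A"
  shows "bilinear K MM M MMtM (\<lambda>v w. tens K MM M (A v) w)"
  by (intro bilinearI lin_intros is_module MM linear_map_closed[OF assms] assms)

lemma linear_tens1: "linear_map K MM MM A \<Longrightarrow> linear_map K MMtM MMtM (tens1 A)"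
  unfolding tens_map_def by (intro linear_map_tens_lift MM is_module MMtM bilinear_tens1)

lemma tens1_tens:
  "linear_map K MM MM A \<Longrightarrow> s \<in> carrier MM \<Longrightarrow> x \<in> carrier M \<Longrightarrow>
    tens1 A (tens K MM M s x) = tens K MM M (A s) x"
  unfolding tens_map_def by (intro tens_lift_tens MM is_module MMtM bilinear_tens1)

lemma op12_eq: "t \<in> carrier MtMM \<Longrightarrow> op12 K M A t = assoc (tens1 A (unassoc t))"
  by (simp add: op12_def Let_def inv_assoc)

lemma linear_op12:
  assumes "linear_map K MM MM A"
  shows "linear_map K MtMM MtMM (op12 K M A)"
  by (rule linear_map_cong[OF linear_map_comp[OF linear_assoc linear_map_comp[OF linear_tens1[OF assms] linear_unassoc]] MtMM op12_eq])

lemma op12_tens: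
  assumes "linear_map K MM MM A" "x \<in> carrier M" "y \<in> carrier M" "z \<in> carrier M"
  shows "op12 K M A (tens K M MM x (tens K M M y z)) = assoc (tens K MM M (A (tens K M M x y)) z)"
  using assms by (simp add: op12_eq tens_closed is_module MM unassoc_tens tens1_tens)

text \<open>Applied to \<open>R\<close> and its inverse in both orders: R^12 and S^12 are then
  inverse to each other. Rebracketing cancels between the two operators, which leaves A \<otimes> I
  after B \<otimes> I.\<close>

lemma op12_comp:
  assumes "linear_map K MM MM A" "linear_map K MM MM B" "\<And>s. s \<in> carrier MM \<Longrightarrow> A (B s) = s"
    "t \<in> carrier MtMM"
  shows "op12 K M A (op12 K M B t) = t"
proof -
  have 1: "tens1 A (tens1 B s) = s" if "s \<in> carrier MMtM" for s
    by (rule tensor_eq_on_tens[OF MM is_module MMtM linear_map_comp[OF linear_tens1[OF assms(1)]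
      linear_tens1[OF assms(2)]] linear_map_ident _ that])
      (simp add: tens1_tens assms(1,2) linear_map_closed[OF assms(2)] assms(3))
  have c: "unassoc t \<in> carrier MMtM" by (rule linear_map_closed[OF linear_unassoc assms(4)])
  then have c1: "tens1 B (unassoc t) \<in> carrier MMtM" by (rule linear_map_closed[OF linear_tens1[OF assms(2)]])
  have "op12 K M A (op12 K M B t) = assoc (tens1 A (unassoc (assoc (tens1 B (unassoc t)))))"
    by (simp add: op12_eq assms(4) linear_map_closed[OF linear_assoc] c1)
  then show ?thesis by (simp add: unassoc_assoc c1 1 c assoc_unassoc assms(4))
qed

lemma bilinear_op23:
  assumes "linear_map K MM MM B"
  shows "bilinear K M MM MtMM (\<lambda>v w. tens K M MM v (B w))"
  by (intro bilinearI lin_intros is_module MM linear_map_closed[OF assms] assms)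

lemma linear_op23: "linear_map K MM MM B \<Longrightarrow> linear_map K MtMM MtMM (op23 K M B)"
  unfolding op23_def Let_def tens_map_def by (intro linear_map_tens_lift MM is_module MtMM bilinear_op23)

lemma op23_tens:
  "linear_map K MM MM B \<Longrightarrow> x \<in> carrier M \<Longrightarrow> s \<in> carrier MM \<Longrightarrow>
    op23 K M B (tens K M MM x s) = tens K M MM x (B s)"
  unfolding op23_def Let_def tens_map_def by (intro tens_lift_tens MM is_module MtMM bilinear_op23)

definition tcoord3 :: "nat \<Rightarrow> nat \<Rightarrow> nat \<Rightarrow> ('k, 'm, ('k, 'm, 'm) tens) tens \<Rightarrow> 'k" where
  "tcoord3 p i j = tens_lift K M MM (KK) (\<lambda>x s. coord p x \<otimes>\<^bsub>K\<^esub> tcoord i j s)"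

lemma bilinear_tcoord3:
  assumes "p \<in> N" "i \<in> N" "j \<in> N"
  shows "bilinear K M MM (KK) (\<lambda>x s. coord p x \<otimes>\<^bsub>K\<^esub> tcoord i j s)"
  by (intro bilinearI linear_map_mult_left linear_map_mult_right linear_coord linear_tcoord cring assms
      coord(1) tcoord_closed)

lemma linear_tcoord3:
  "p \<in> N \<Longrightarrow> i \<in> N \<Longrightarrow> j \<in> N \<Longrightarrow> linear_map K MtMM (KK) (tcoord3 p i j)"
  unfolding tcoord3_def by (intro linear_map_tens_lift is_module MM self bilinear_tcoord3)

lemma tcoord3_tens:
  "p \<in> N \<Longrightarrow> i \<in> N \<Longrightarrow> j \<in> N \<Longrightarrow> x \<in> carrier M \<Longrightarrow> s \<in> carrier MM \<Longrightarrow>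
    tcoord3 p i j (tens K M MM x s) = coord p x \<otimes>\<^bsub>K\<^esub> tcoord i j s"
  unfolding tcoord3_def by (intro tens_lift_tens is_module MM self bilinear_tcoord3)

text \<open>After an operator in position 12 the result is known as an element of (M \<otimes> M)
  \<otimes> M. This reads off its coordinates with respect to the other bracketing; both sides are
  linear in \<open>s\<close>, so pure tensors decide.\<close>

lemma tcoord3_assoc:
  assumes "p \<in> N" "i \<in> N" "j \<in> N" "s \<in> carrier MM" "y \<in> carrier M"
  shows "tcoord3 p i j (assoc (tens K MM M s y)) = tcoord p i s \<otimes>\<^bsub>K\<^esub> coord j y"
proof -
  interpret cring K by (rule cring)
  show ?thesis
    by (rule tensor_eq_on_tens[OF is_module is_module self _ _ _ assms(4)],
        intro linear_map_comp[OF linear_tcoord3[OF assms(1-3)]] linear_map_comp[OF linear_assoc]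
          lin_intros MM is_module assms(5),
        intro linear_map_mult_right cring linear_tcoord assms(1,2) coord(1)[OF assms(5,3)])
      (simp add: assms assoc_tens tcoord3_tens tcoord_tens coord(1) tens_closed is_module m_assoc)
qed

text \<open>The matrix of \<open>A\<close> in the product basis: the first index pair is the output
  (row), the second pair the input (column).\<close>

definition mat :: "(('k, 'm, 'm) tens \<Rightarrow> ('k, 'm, 'm) tens) \<Rightarrow> nat \<Rightarrow> nat \<Rightarrow> nat \<Rightarrow> nat \<Rightarrow> 'k" where
  "mat A i j a b = tcoord i j (A (mm a b))"

lemma mat_closed:
  assumes "linear_map K MM MM A" "i \<in> N" "j \<in> N" "a \<in> N" "b \<in> N"
  shows "mat A i j a b \<in> carrier K"
  unfolding mat_def by (intro tcoord_closed linear_map_closed[OF assms(1)] mm_closed assms)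

text \<open>\<open>A\<close> acts first, on m_q \<otimes> m_a. Since \<open>B\<close> leaves the
  first factor alone, only terms with first index \<open>p\<close> survive, and the sum runs over
  the middle index \<open>u\<close> that is output of \<open>A\<close> and input of
  \<open>B\<close>.\<close>

lemma mat_op12_op23:
  assumes A: "linear_map K MM MM A" and B: "linear_map K MM MM B"
    and i: "p \<in> N" "i \<in> N" "j \<in> N" "q \<in> N" "a \<in> N" "b \<in> N"
  shows "tcoord3 p i j (op23 K M B (op12 K M A (tens K M MM (m q) (mm a b))))
    = (\<Oplus>\<^bsub>K\<^esub>u\<in>N. mat A p u q a \<otimes>\<^bsub>K\<^esub> mat B i j u b)"
proof -
  interpret cring K by (rule cring)
  let ?f = "\<lambda>s. tcoord3 p i j (op23 K M B (assoc (tens K MM M s (m b))))"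
  have f: "linear_map K MM (KK) ?f"
    by (intro linear_map_comp[OF linear_tcoord3[OF i(1-3)]] linear_map_comp[OF linear_op23[OF B]]
        linear_map_comp[OF linear_assoc] lin_intros MM is_module basis_closed i)
  have fm: "?f (mm u v) = (if p = u then \<one>\<^bsub>K\<^esub> else \<zero>\<^bsub>K\<^esub>) \<otimes>\<^bsub>K\<^esub> mat B i j v b"
    if "u \<in> N" "v \<in> N" for u v
    by (simp add: that i basis_closed assoc_tens op23_tens[OF B] tcoord3_tens mm_closed linear_map_closed[OF B]
        coord_basis mat_def)
  have c: "mat A u v q a \<otimes>\<^bsub>K\<^esub> ((if p = u then \<one>\<^bsub>K\<^esub> else \<zero>\<^bsub>K\<^esub>) \<otimes>\<^bsub>K\<^esub> mat B i j v b) \<in> carrier K"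
    if "u \<in> N" "v \<in> N" for u v
    by (simp add: that i mat_closed A B)
  have "tcoord3 p i j (op23 K M B (op12 K M A (tens K M MM (m q) (mm a b)))) = ?f (A (mm q a))"
    by (simp add: op12_tens[OF A] basis_closed i)
  also have "\<dots> = (\<Oplus>\<^bsub>KK\<^esub>u\<in>N. \<Oplus>\<^bsub>KK\<^esub>v\<in>N. tcoord u v (A (mm q a)) \<odot>\<^bsub>KK\<^esub> ?f (mm u v))"
    by (rule tensor_expansion[OF self f linear_map_closed[OF A mm_closed[OF i(4,5)]]])
  also have "\<dots> = (\<Oplus>\<^bsub>KK\<^esub>u\<in>N. \<Oplus>\<^bsub>KK\<^esub>v\<in>N.
      mat A u v q a \<otimes>\<^bsub>K\<^esub> ((if p = u then \<one>\<^bsub>K\<^esub> else \<zero>\<^bsub>K\<^esub>) \<otimes>\<^bsub>K\<^esub> mat B i j v b))"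
    by (intro module_finsum_cong[OF self] module_finsum_closed[OF self])
      (simp_all add: c fm mat_def[symmetric] del: finsum_self_module)
  \<comment> \<open>The outer sum is over the first tensor index, which the Kronecker delta fixes to
    \<open>p\<close>.\<close>
  also have "\<dots> = (\<Oplus>\<^bsub>KK\<^esub>v\<in>N.
      mat A p v q a \<otimes>\<^bsub>K\<^esub> ((if p = p then \<one>\<^bsub>K\<^esub> else \<zero>\<^bsub>K\<^esub>) \<otimes>\<^bsub>K\<^esub> mat B i j v b))"
  proof (rule module_finsum_single[OF self _ i(1)])
    fix u assume u: "u \<in> N"
    show "(\<Oplus>\<^bsub>KK\<^esub>v\<in>N. mat A u v q a \<otimes>\<^bsub>K\<^esub>
        ((if p = u then \<one>\<^bsub>K\<^esub> else \<zero>\<^bsub>K\<^esub>) \<otimes>\<^bsub>K\<^esub> mat B i j v b)) \<in> carrier (KK)"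
      by (rule module_finsum_closed[OF self]) (simp add: mat_closed A B i u)
    show "(\<Oplus>\<^bsub>KK\<^esub>v\<in>N. mat A u v q a \<otimes>\<^bsub>K\<^esub>
        ((if p = u then \<one>\<^bsub>K\<^esub> else \<zero>\<^bsub>K\<^esub>) \<otimes>\<^bsub>K\<^esub> mat B i j v b)) = \<zero>\<^bsub>KK\<^esub>" if "u \<noteq> p"
      by (rule module_finsum_zero[OF self]) (use that in \<open>simp add: mat_closed A B i u\<close>)
  qed simp
  also have "\<dots> = (\<Oplus>\<^bsub>KK\<^esub>u\<in>N. mat A p u q a \<otimes>\<^bsub>K\<^esub> mat B i j u b)"
    by (intro module_finsum_cong[OF self]) (simp_all add: mat_closed A B i)
  finally show ?thesis by simp
qed

text \<open>The opposite order: \<open>B\<close> acts first, on m_a \<otimes> m_b, and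
  \<open>A\<close> leaves the last factor alone. Hence the last index is fixed to \<open>j\<close>,
  and the middle index \<open>u\<close> is now output of \<open>B\<close> and input of
  \<open>A\<close>.\<close>

lemma mat_op23_op12:
  assumes A: "linear_map K MM MM A" and B: "linear_map K MM MM B"
    and i: "p \<in> N" "i \<in> N" "j \<in> N" "q \<in> N" "a \<in> N" "b \<in> N"
  shows "tcoord3 p i j (op12 K M A (op23 K M B (tens K M MM (m q) (mm a b))))
    = (\<Oplus>\<^bsub>K\<^esub>u\<in>N. mat B u j a b \<otimes>\<^bsub>K\<^esub> mat A p i q u)"
proof -
  interpret cring K by (rule cring)
  let ?f = "\<lambda>s. tcoord3 p i j (op12 K M A (tens K M MM (m q) s))"
  have f: "linear_map K MM (KK) ?f"
    by (intro linear_map_comp[OF linear_tcoord3[OF i(1-3)]] linear_map_comp[OF linear_op12[OF A]]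
        lin_intros MM is_module basis_closed i)
  have fm: "?f (mm u v) = mat A p i q u \<otimes>\<^bsub>K\<^esub> (if j = v then \<one>\<^bsub>K\<^esub> else \<zero>\<^bsub>K\<^esub>)"
    if "u \<in> N" "v \<in> N" for u v
    by (simp add: that i basis_closed op12_tens[OF A] tcoord3_assoc mm_closed linear_map_closed[OF A]
        coord_basis mat_def)
  have c: "mat B u v a b \<otimes>\<^bsub>K\<^esub> (mat A p i q u \<otimes>\<^bsub>K\<^esub> (if j = v then \<one>\<^bsub>K\<^esub> else \<zero>\<^bsub>K\<^esub>)) \<in> carrier K"
    if "u \<in> N" "v \<in> N" for u v
    by (simp add: that i mat_closed A B)
  have "tcoord3 p i j (op12 K M A (op23 K M B (tens K M MM (m q) (mm a b)))) = ?f (B (mm a b))"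
    by (simp add: op23_tens[OF B] basis_closed mm_closed i)
  also have "\<dots> = (\<Oplus>\<^bsub>KK\<^esub>u\<in>N. \<Oplus>\<^bsub>KK\<^esub>v\<in>N. tcoord u v (B (mm a b)) \<odot>\<^bsub>KK\<^esub> ?f (mm u v))"
    by (rule tensor_expansion[OF self f linear_map_closed[OF B mm_closed[OF i(5,6)]]])
  also have "\<dots> = (\<Oplus>\<^bsub>KK\<^esub>u\<in>N. \<Oplus>\<^bsub>KK\<^esub>v\<in>N.
      mat B u v a b \<otimes>\<^bsub>K\<^esub> (mat A p i q u \<otimes>\<^bsub>K\<^esub> (if j = v then \<one>\<^bsub>K\<^esub> else \<zero>\<^bsub>K\<^esub>)))"
    by (intro module_finsum_cong[OF self] module_finsum_closed[OF self])
      (simp_all add: c fm mat_def[symmetric] del: finsum_self_module)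
  also have "\<dots> = (\<Oplus>\<^bsub>KK\<^esub>u\<in>N.
      mat B u j a b \<otimes>\<^bsub>K\<^esub> (mat A p i q u \<otimes>\<^bsub>K\<^esub> (if j = j then \<one>\<^bsub>K\<^esub> else \<zero>\<^bsub>K\<^esub>)))"
    by (intro module_finsum_cong[OF self] module_finsum_single[OF self _ i(3)])
      (auto simp: c mat_closed A B i simp del: finsum_self_module)
  also have "\<dots> = (\<Oplus>\<^bsub>KK\<^esub>u\<in>N. mat B u j a b \<otimes>\<^bsub>K\<^esub> mat A p i q u)"
    by (intro module_finsum_cong[OF self]) (simp_all add: mat_closed A B i)
  finally show ?thesis by simp
qed

text \<open>One matrix entry of the commutation of A^12 with B^23. For B = R the two sums are those
  obtained by pairing c_pq, through the entries of \<open>A\<close>, with the two halves of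
  \<open>obstr i j a b\<close>.\<close>

lemma mat_commute:
  assumes "linear_map K MM MM A" "linear_map K MM MM B"
    "\<And>t. t \<in> carrier MtMM \<Longrightarrow> op12 K M A (op23 K M B t) = op23 K M B (op12 K M A t)"
    "p \<in> N" "i \<in> N" "j \<in> N" "q \<in> N" "a \<in> N" "b \<in> N"
  shows "(\<Oplus>\<^bsub>K\<^esub>u\<in>N. mat A p u q a \<otimes>\<^bsub>K\<^esub> mat B i j u b) = (\<Oplus>\<^bsub>K\<^esub>u\<in>N. mat B u j a b \<otimes>\<^bsub>K\<^esub> mat A p i q u)"
  using assms(3)[of "tens K M MM (m q) (mm a b)"] assms(4-)
  by (simp add: mat_op12_op23[OF assms(1,2), symmetric] mat_op23_op12[OF assms(1,2), symmetric]
      tens_closed is_module MM basis_closed)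

text \<open>The left-hand side has the shape of a convolution product on matrix elements, so this
  turns inverse operators into convolution inverse forms.\<close>

lemma mat_comp:
  assumes "linear_map K MM MM A" "linear_map K MM MM B"
    "i \<in> N" "j \<in> N" "a \<in> N" "b \<in> N"
  shows "(\<Oplus>\<^bsub>K\<^esub>u\<in>N. \<Oplus>\<^bsub>K\<^esub>v\<in>N. mat A i j u v \<otimes>\<^bsub>K\<^esub> mat B u v a b) = mat (\<lambda>t. A (B t)) i j a b"
proof -
  interpret cring K by (rule cring)
  have "mat (\<lambda>t. A (B t)) i j a b = (\<Oplus>\<^bsub>KK\<^esub>u\<in>N. \<Oplus>\<^bsub>KK\<^esub>v\<in>N.
      tcoord u v (B (mm a b)) \<odot>\<^bsub>KK\<^esub> tcoord i j (A (mm u v)))"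
    unfolding mat_def
    by (rule tensor_expansion[OF self linear_map_comp[OF linear_tcoord assms(1)] linear_map_closed[OF assms(2)]])
      (intro assms mm_closed)+
  also have "\<dots> = (\<Oplus>\<^bsub>KK\<^esub>u\<in>N. \<Oplus>\<^bsub>KK\<^esub>v\<in>N. mat A i j u v \<otimes>\<^bsub>K\<^esub> mat B u v a b)"
    by (intro module_finsum_cong[OF self] module_finsum_closed[OF self])
      (simp_all add: mat_def[symmetric] mat_closed assms m_comm del: finsum_self_module)
  finally show ?thesis by simp
qed

text \<open>The flip exchanges the two input indices and the two output indices; commuting with it
  therefore makes the matrix invariant under exchanging both at once.\<close>

lemma mat_flip:
  assumes "linear_map K MM MM A" "\<And>t. t \<in> carrier MM \<Longrightarrow> A (flip K M t) = flip K M (A t)"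
    "i \<in> N" "j \<in> N" "a \<in> N" "b \<in> N"
  shows "mat A i j a b = mat A j i b a"
proof -
  interpret cring K by (rule cring)
  have b: "bilinear K M M MM (\<lambda>x y. tens K M M y x)"
    by (intro bilinearI lin_intros is_module)
  have lf: "linear_map K MM MM (flip K M)"
    unfolding flip_def by (intro linear_map_tens_lift is_module MM b)
  have flip: "flip K M (tens K M M x y) = tens K M M y x" if "x \<in> carrier M" "y \<in> carrier M" for x y
    unfolding flip_def by (intro tens_lift_tens is_module MM b that)
  have tf: "tcoord i j (flip K M t) = tcoord j i t" if "t \<in> carrier MM" for t
    by (rule tensor_eq_on_tens[OF is_module is_module self linear_map_comp[OF linear_tcoord lf] linear_tcoord _ that])
      (simp_all add: assms flip tcoord_tens coord(1) m_comm)
  have "mat A j i b a = tcoord i j (flip K M (A (mm b a)))"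
    unfolding mat_def using assms by (intro tf[symmetric] linear_map_closed[OF assms(1)] mm_closed)
  also have "\<dots> = mat A i j a b"
    using assms(2)[of "mm b a"] assms by (simp add: mat_def mm_closed flip basis_closed)
  finally show ?thesis ..
qed

end

end

section \<open>Coalgebras spanned by a comatrix basis\<close>

lemma linear_map_sweedler_param:
  assumes "module K C" "module K U" "module K V"
    "\<And>x. x \<in> carrier V \<Longrightarrow> bilinear K C C U (b x)"
    "\<And>c d. c \<in> carrier C \<Longrightarrow> d \<in> carrier C \<Longrightarrow> linear_map K V U (\<lambda>x. b x c d)"
    "comult C c \<in> carrier (tensor K C C)"
  shows "linear_map K V U (\<lambda>x. sweedler K C U (b x) c)"
  unfolding sweedler_def by (rule linear_map_tens_lift_param[OF assms(1,1,2-6)])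

lemma lspan_image:
  assumes "module K V" "module K W" "linear_map K V W p" "p ` carrier V = carrier W"
    "carrier V \<subseteq> lspan K V S" "S \<subseteq> carrier V"
  shows "carrier W \<subseteq> lspan K W (p ` S)"
proof -
  have "p ` S \<subseteq> carrier W" using assms(4,6) by blast
  then have L: "submodule (lspan K W (p ` S)) K W" by (rule submodule_lspan[OF assms(2)])
  have "lspan K V S \<subseteq> {x \<in> carrier V. p x \<in> lspan K W (p ` S)}"
  proof (rule lspan_least[OF submodule_preimage[OF assms(1-3) L]])
    show "S \<subseteq> {x \<in> carrier V. p x \<in> lspan K W (p ` S)}"
      using assms(6) subsetD[OF lspan_base imageI, of _ S p K W] by blast
  qed
  then have "p x \<in> lspan K W (p ` S)" if "x \<in> carrier V" for x using assms(5) that by blast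
  then have "p ` carrier V \<subseteq> lspan K W (p ` S)" by (rule image_subsetI)
  then show ?thesis unfolding assms(4) .
qed

text \<open>Spanning rather than independence is asked of the \<open>e i j\<close>, so that
  quotients of the comatrix coalgebra are instances as well. The coalgebra axioms are not assumed;
  they follow from the formulas on the \<open>e i j\<close>.\<close>

locale matrix_coalgebra =
  fixes K :: "('k, 'x) ring_scheme" and C :: "('k, 'c, 'y) coalg_scheme"
    and n :: nat and e :: "nat \<Rightarrow> nat \<Rightarrow> 'c"
  assumes C: "module K C"
    and comult_linear: "linear_map K C (tensor K C C) (comult C)"
    and counit_linear: "linear_map K C (self_module K) (counit C)"
    and e_closed: "i \<in> {1..n} \<Longrightarrow> j \<in> {1..n} \<Longrightarrow> e i j \<in> carrier C"
    and e_span: "carrier C \<subseteq> lspan K C (case_prod e ` ({1..n} \<times> {1..n}))"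
    and comult_e: "i \<in> {1..n} \<Longrightarrow> j \<in> {1..n} \<Longrightarrow>
      comult C (e i j) = (\<Oplus>\<^bsub>tensor K C C\<^esub>u\<in>{1..n}. tens K C C (e i u) (e u j))"
    and counit_e: "i \<in> {1..n} \<Longrightarrow> j \<in> {1..n} \<Longrightarrow>
      counit C (e i j) = (if i = j then \<one>\<^bsub>K\<^esub> else \<zero>\<^bsub>K\<^esub>)"
begin

lemma K_cring: "cring K"
  using C by (simp add: module_def)

lemma K_self: "module K (self_module K)"
  by (rule module_self_module[OF K_cring])

abbreviation "CC \<equiv> tensor K C C"

lemma CC: "module K CC"
  by (rule module_tensor[OF C C])

lemma comult_closed: "c \<in> carrier C \<Longrightarrow> comult C c \<in> carrier CC"
  by (rule linear_map_closed[OF comult_linear])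

lemma counit_closed: "c \<in> carrier C \<Longrightarrow> counit C c \<in> carrier K"
  using linear_map_closed[OF counit_linear] by simp

lemma e_subset: "case_prod e ` ({1..n} \<times> {1..n}) \<subseteq> carrier C"
  using e_closed by auto

lemma eq_on_e:
  assumes "module K U" "linear_map K C U f" "linear_map K C U g"
    "\<And>i j. i \<in> {1..n} \<Longrightarrow> j \<in> {1..n} \<Longrightarrow> f (e i j) = g (e i j)" "c \<in> carrier C"
  shows "f c = g c"
  by (rule linear_map_eq_on_lspan[OF C assms(1-3) e_span e_subset _ assms(5)]) (use assms(4) in auto)

lemma linear_sweedler:
  assumes "module K U" "bilinear K C C U b"
  shows "linear_map K C U (sweedler K C U b)"
  unfolding sweedler_def by (rule linear_map_tens_lift_arg[OF C C assms comult_linear])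

lemma sweedler_e:
  assumes "module K U" "bilinear K C C U b" "i \<in> {1..n}" "j \<in> {1..n}"
  shows "sweedler K C U b (e i j) = (\<Oplus>\<^bsub>U\<^esub>u\<in>{1..n}. b (e i u) (e u j))"
proof -
  have "sweedler K C U b (e i j) = (\<Oplus>\<^bsub>U\<^esub>u\<in>{1..n}. tens_lift K C C U b (tens K C C (e i u) (e u j)))"
    unfolding sweedler_def comult_e[OF assms(3,4)]
    by (rule linear_map_finsum[OF linear_map_tens_lift[OF C C assms(1,2)] CC assms(1)])
      (intro finite_atLeastAtMost tens_closed C e_closed assms(3,4); assumption)+
  also have "\<dots> = (\<Oplus>\<^bsub>U\<^esub>u\<in>{1..n}. b (e i u) (e u j))"
    by (rule module_finsum_cong[OF assms(1)])
      (intro tens_lift_tens C e_closed bilinear_closed[OF assms(2)] assms; assumption)+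
  finally show ?thesis .
qed

text \<open>Both sides of coassociativity are linear and send \<open>e i j\<close> to the double sum
  of e_iu \<otimes> (e_uv \<otimes> e_vj), summed in the two possible orders. The counit laws hold
  because the delta leaves one summand.\<close>

lemma coalgebra: "coalgebra K C"
proof (rule coalgebra.intro)
  interpret C: module K C by (rule C)
  let ?T = "tensor K C CC"
  note lin = linear_map_tens_left linear_map_tens_right linear_map_ident comult_linear
  note N = finite_atLeastAtMost
  have T: "module K ?T" by (intro module_tensor C CC)
  have b1: "bilinear K C C ?T (\<lambda>x y. tens K C CC x (comult C y))"
    by (intro bilinearI lin C CC comult_closed)
  have b2: "bilinear K C C ?T (\<lambda>x1 x2. tens K C CC x1 (tens K C C x2 y))" if "y \<in> carrier C" for y
    by (intro bilinearI lin C CC tens_closed that)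
  have b3: "bilinear K C C ?T (\<lambda>x y. sweedler K C ?T (\<lambda>x1 x2. tens K C CC x1 (tens K C C x2 y)) x)"
    by (intro bilinearI linear_map_sweedler_param linear_sweedler b2 lin C CC T tens_closed comult_closed)
  have b4: "bilinear K C C C (\<lambda>x y. counit C x \<odot>\<^bsub>C\<^esub> y)"
    by (intro bilinearI linear_map_smult_fun linear_map_scale C counit_linear linear_map_ident counit_closed)
  have b5: "bilinear K C C C (\<lambda>x y. counit C y \<odot>\<^bsub>C\<^esub> x)"
    by (rule bilinearI, rule linear_map_scale[OF C counit_linear], assumption)
      (rule linear_map_smult_fun[OF C linear_map_ident counit_closed])
  have tc: "tens K C CC (e i u) (tens K C C (e u v) (e v j)) \<in> carrier ?T"
    if "i \<in> {1..n}" "j \<in> {1..n}" "u \<in> {1..n}" "v \<in> {1..n}" for i j u v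
    by (intro tens_closed C CC e_closed that)
  show "module K C" by (rule C)
  show "linear_map K C CC (comult C)" "linear_map K C (self_module K) (counit C)"
    by (rule comult_linear counit_linear)+
  fix c assume c: "c \<in> carrier C"
  show "sweedler K C ?T (\<lambda>x y. tens K C CC x (comult C y)) c =
      sweedler K C ?T (\<lambda>x y. sweedler K C ?T (\<lambda>x1 x2. tens K C CC x1 (tens K C C x2 y)) x) c"
  proof (rule eq_on_e[OF T linear_sweedler[OF T b1] linear_sweedler[OF T b3] _ c])
    fix i j assume ij: "i \<in> {1..n}" "j \<in> {1..n}"
    have "sweedler K C ?T (\<lambda>x y. tens K C CC x (comult C y)) (e i j) =
        (\<Oplus>\<^bsub>?T\<^esub>u\<in>{1..n}. tens K C CC (e i u) (comult C (e u j)))"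
      by (rule sweedler_e[OF T b1 ij])
    also have "\<dots> = (\<Oplus>\<^bsub>?T\<^esub>u\<in>{1..n}. \<Oplus>\<^bsub>?T\<^esub>v\<in>{1..n}. tens K C CC (e i u) (tens K C C (e u v) (e v j)))"
    proof (rule module_finsum_cong[OF T])
      fix u assume u: "u \<in> {1..n}"
      show "tens K C CC (e i u) (comult C (e u j)) =
          (\<Oplus>\<^bsub>?T\<^esub>v\<in>{1..n}. tens K C CC (e i u) (tens K C C (e u v) (e v j)))"
        unfolding comult_e[OF u ij(2)]
        by (rule linear_map_finsum[OF bilinear_right[OF bilinear_tens[OF C CC] e_closed[OF ij(1) u]] CC T N])
          (intro tens_closed C e_closed u ij; assumption)
      show "(\<Oplus>\<^bsub>?T\<^esub>v\<in>{1..n}. tens K C CC (e i u) (tens K C C (e u v) (e v j))) \<in> carrier ?T"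
        by (rule module_finsum_closed[OF T tc[OF ij u]])
    qed
    also have "\<dots> = (\<Oplus>\<^bsub>?T\<^esub>v\<in>{1..n}. \<Oplus>\<^bsub>?T\<^esub>u\<in>{1..n}. tens K C CC (e i u) (tens K C C (e u v) (e v j)))"
      by (rule module_finsum_swap[OF T N N tc[OF ij]])
    also have "\<dots> = (\<Oplus>\<^bsub>?T\<^esub>v\<in>{1..n}. sweedler K C ?T (\<lambda>x1 x2. tens K C CC x1 (tens K C C x2 (e v j))) (e i v))"
    proof (rule module_finsum_cong[OF T])
      fix v assume v: "v \<in> {1..n}"
      show "(\<Oplus>\<^bsub>?T\<^esub>u\<in>{1..n}. tens K C CC (e i u) (tens K C C (e u v) (e v j))) =
          sweedler K C ?T (\<lambda>x1 x2. tens K C CC x1 (tens K C C x2 (e v j))) (e i v)"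
        by (rule sweedler_e[OF T b2[OF e_closed[OF v ij(2)]] ij(1) v, symmetric])
      show "sweedler K C ?T (\<lambda>x1 x2. tens K C CC x1 (tens K C C x2 (e v j))) (e i v) \<in> carrier ?T"
        by (rule linear_map_closed[OF linear_sweedler[OF T b2]]) (intro e_closed v ij)+
    qed
    also have "\<dots> = sweedler K C ?T (\<lambda>x y. sweedler K C ?T (\<lambda>x1 x2. tens K C CC x1 (tens K C C x2 y)) x) (e i j)"
      by (rule sweedler_e[OF T b3 ij, symmetric])
    finally show "sweedler K C ?T (\<lambda>x y. tens K C CC x (comult C y)) (e i j) =
      sweedler K C ?T (\<lambda>x y. sweedler K C ?T (\<lambda>x1 x2. tens K C CC x1 (tens K C C x2 y)) x) (e i j)" .
  qed
  show "sweedler K C C (\<lambda>x y. counit C x \<odot>\<^bsub>C\<^esub> y) c = c"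
  proof (rule eq_on_e[OF C linear_sweedler[OF C b4] linear_map_ident _ c])
    fix i j assume ij: "i \<in> {1..n}" "j \<in> {1..n}"
    show "sweedler K C C (\<lambda>x y. counit C x \<odot>\<^bsub>C\<^esub> y) (e i j) = e i j"
      unfolding sweedler_e[OF C b4 ij]
      by (subst module_finsum_single[OF C N ij(1)]) (use ij in \<open>simp_all add: counit_e e_closed del: atLeastAtMost_iff\<close>)
  qed
  show "sweedler K C C (\<lambda>x y. counit C y \<odot>\<^bsub>C\<^esub> x) c = c"
  proof (rule eq_on_e[OF C linear_sweedler[OF C b5] linear_map_ident _ c])
    fix i j assume ij: "i \<in> {1..n}" "j \<in> {1..n}"
    show "sweedler K C C (\<lambda>x y. counit C y \<odot>\<^bsub>C\<^esub> x) (e i j) = e i j"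
      unfolding sweedler_e[OF C b5 ij]
      by (subst module_finsum_single[OF C N ij(2)]) (use ij in \<open>simp_all add: counit_e e_closed del: atLeastAtMost_iff\<close>)
  qed
qed

text \<open>On \<open>e i a\<close> each Sweedler sum becomes a sum over one middle index, and both
  sides are linear in \<open>c\<close> and in \<open>d\<close>. Surjectivity of \<open>p\<close>
  makes the \<open>p (e j b)\<close> span \<open>Q\<close>. The class map gives the criterion for
  D-maps, the identity the one for strongly D-maps.\<close>

lemma D_conditionI:
  assumes Q: "module K Q" and p: "linear_map K C Q p" "p ` carrier C = carrier Q"
    and \<sigma>: "\<sigma> \<in> lin_hom K (tensor K C Q) (self_module K)"
    and eq: "\<And>i j a b. i \<in> {1..n} \<Longrightarrow> j \<in> {1..n} \<Longrightarrow> a \<in> {1..n} \<Longrightarrow> b \<in> {1..n} \<Longrightarrow>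
      (\<Oplus>\<^bsub>Q\<^esub>u\<in>{1..n}. \<sigma> (tens K C Q (e i u) (p (e j b))) \<odot>\<^bsub>Q\<^esub> p (e u a)) =
      (\<Oplus>\<^bsub>Q\<^esub>u\<in>{1..n}. \<sigma> (tens K C Q (e u a) (p (e j b))) \<odot>\<^bsub>Q\<^esub> p (e i u))"
  shows "D_condition K C Q p \<sigma>"
  unfolding D_condition_def
proof (intro conjI \<sigma> ballI)
  note \<sigma>l = lin_homD[OF \<sigma>]
  have \<sigma>c: "\<sigma> (tens K C Q x d) \<in> carrier K" if "x \<in> carrier C" "d \<in> carrier Q" for x d
    using linear_map_closed[OF \<sigma>l tens_closed[OF C Q that]] by simp
  have \<sigma>1: "linear_map K C (self_module K) (\<lambda>x. \<sigma> (tens K C Q x d))" if "d \<in> carrier Q" for d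
    by (rule linear_map_comp[OF \<sigma>l bilinear_left[OF bilinear_tens[OF C Q] that]])
  have \<sigma>2: "linear_map K Q (self_module K) (\<lambda>d. \<sigma> (tens K C Q x d))" if "x \<in> carrier C" for x
    by (rule linear_map_comp[OF \<sigma>l bilinear_right[OF bilinear_tens[OF C Q] that]])
  note pc = linear_map_closed[OF p(1)]
  have b1: "bilinear K C C Q (\<lambda>x y. \<sigma> (tens K C Q x d) \<odot>\<^bsub>Q\<^esub> p y)" if "d \<in> carrier Q" for d
    by (intro bilinearI linear_map_smult_fun linear_map_scale Q \<sigma>1 that p \<sigma>c pc)
  have b2: "bilinear K C C Q (\<lambda>x y. \<sigma> (tens K C Q y d) \<odot>\<^bsub>Q\<^esub> p x)" if "d \<in> carrier Q" for d
    by (intro bilinearI linear_map_smult_fun linear_map_scale Q \<sigma>1 that p \<sigma>c pc)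
  fix c d assume c: "c \<in> carrier C" and d: "d \<in> carrier Q"
  have gen: "sweedler K C Q (\<lambda>x y. \<sigma> (tens K C Q x (p (e j b))) \<odot>\<^bsub>Q\<^esub> p y) c =
      sweedler K C Q (\<lambda>x y. \<sigma> (tens K C Q y (p (e j b))) \<odot>\<^bsub>Q\<^esub> p x) c"
    if "j \<in> {1..n}" "b \<in> {1..n}" for j b
  proof -
    note d = pc[OF e_closed[OF that]]
    show ?thesis
      by (rule eq_on_e[OF Q linear_sweedler[OF Q b1[OF d]] linear_sweedler[OF Q b2[OF d]] _ c])
        (unfold sweedler_e[OF Q b1[OF d]] sweedler_e[OF Q b2[OF d]], rule eq[OF _ that(1) _ that(2)])
  qed
  \<comment> \<open>With \<open>c\<close> now arbitrary, linearity in \<open>d\<close> extends the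
    identity from the spanning elements \<open>p (e j b)\<close> to all of \<open>Q\<close>.\<close>
  have l1: "linear_map K Q Q (\<lambda>d. sweedler K C Q (\<lambda>x y. \<sigma> (tens K C Q x d) \<odot>\<^bsub>Q\<^esub> p y) c)"
    by (rule linear_map_sweedler_param[OF C Q Q b1 _ comult_closed[OF c]];
      (assumption | (intro linear_map_scale Q \<sigma>2 pc; assumption)))
  have l2: "linear_map K Q Q (\<lambda>d. sweedler K C Q (\<lambda>x y. \<sigma> (tens K C Q y d) \<odot>\<^bsub>Q\<^esub> p x) c)"
    by (rule linear_map_sweedler_param[OF C Q Q b2 _ comult_closed[OF c]];
      (assumption | (intro linear_map_scale Q \<sigma>2 pc; assumption)))
  show "sweedler K C Q (\<lambda>x y. \<sigma> (tens K C Q x d) \<odot>\<^bsub>Q\<^esub> p y) c =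
      sweedler K C Q (\<lambda>x y. \<sigma> (tens K C Q y d) \<odot>\<^bsub>Q\<^esub> p x) c"
    by (rule linear_map_eq_on_lspan[OF Q Q l1 l2 lspan_image[OF C Q p e_span e_subset] _ _ d])
      (use gen pc[OF e_closed] in auto)
qed

text \<open>The tensors of \<open>e i a\<close> with \<open>p (e j b)\<close> span the tensor
  product, so a form is determined by these values. This is the uniqueness half of both
  items.\<close>

lemma form_eqI:
  assumes Q: "module K Q" and p: "linear_map K C Q p" "p ` carrier C = carrier Q"
    and "\<sigma> \<in> lin_hom K (tensor K C Q) (self_module K)" "\<sigma>' \<in> lin_hom K (tensor K C Q) (self_module K)"
    and eq: "\<And>i j a b. i \<in> {1..n} \<Longrightarrow> j \<in> {1..n} \<Longrightarrow> a \<in> {1..n} \<Longrightarrow> b \<in> {1..n} \<Longrightarrow>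
      \<sigma> (tens K C Q (e i a) (p (e j b))) = \<sigma>' (tens K C Q (e i a) (p (e j b)))"
  shows "\<sigma> = \<sigma>'"
proof (rule lin_hom_eqI[OF assms(4,5)])
  have ps: "p ` case_prod e ` ({1..n} \<times> {1..n}) \<subseteq> carrier Q"
    using linear_map_closed[OF p(1) e_closed] by auto
  show "\<sigma> t = \<sigma>' t" if "t \<in> carrier (tensor K C Q)" for t
    by (rule tensor_eq_on_lspan[OF C Q e_span e_subset lspan_image[OF C Q p e_span e_subset] ps K_self
        lin_homD[OF assms(4)] lin_homD[OF assms(5)] _ that])
      (use eq in auto)
qed

end

section \<open>Comodules and the induced operator\<close>

locale matrix_comodule = based_module K M n m + matrix_coalgebra K C n e
  for K :: "('k, 'x) ring_scheme" and M :: "('k, 'm, 'z) module_scheme"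
    and C :: "('k, 'c, 'y) coalg_scheme" and n :: nat and m :: "nat \<Rightarrow> 'm" and e :: "nat \<Rightarrow> nat \<Rightarrow> 'c" +
  fixes \<rho> :: "'m \<Rightarrow> ('k, 'm, 'c) tens"
  assumes coaction_linear: "linear_map K M (tensor K M C) \<rho>"
    and coaction_basis: "l \<in> {1..n} \<Longrightarrow> \<rho> (m l) = (\<Oplus>\<^bsub>tensor K M C\<^esub>v\<in>{1..n}. tens K M C (m v) (e v l))"
begin

lemma MC: "module K (tensor K M C)"
  by (rule module_tensor[OF is_module C])

lemma coaction_closed: "x \<in> carrier M \<Longrightarrow> \<rho> x \<in> carrier (tensor K M C)"
  by (rule linear_map_closed[OF coaction_linear])

lemma lift_coaction_basis:
  assumes "module K U" "bilinear K M C U b" "l \<in> N"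
  shows "tens_lift K M C U b (\<rho> (m l)) = (\<Oplus>\<^bsub>U\<^esub>v\<in>N. b (m v) (e v l))"
proof -
  have "tens_lift K M C U b (\<rho> (m l)) = (\<Oplus>\<^bsub>U\<^esub>v\<in>N. tens_lift K M C U b (tens K M C (m v) (e v l)))"
    unfolding coaction_basis[OF assms(3)]
    by (rule linear_map_finsum[OF linear_map_tens_lift[OF is_module C assms(1,2)] MC assms(1)])
      (intro finite_atLeastAtMost tens_closed is_module C e_closed basis_closed assms(3); assumption)+
  also have "\<dots> = (\<Oplus>\<^bsub>U\<^esub>v\<in>N. b (m v) (e v l))"
    by (rule module_finsum_cong[OF assms(1)])
      (intro tens_lift_tens is_module C e_closed basis_closed bilinear_closed[OF assms(2)] assms; assumption)+
  finally show ?thesis .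
qed

lemma linear_lift_coaction:
  "module K U \<Longrightarrow> bilinear K M C U b \<Longrightarrow> linear_map K M U (\<lambda>x. tens_lift K M C U b (\<rho> x))"
  by (intro linear_map_tens_lift_arg is_module C coaction_linear)

text \<open>The computation for coassociativity with the left matrix element replaced by a basis
  vector: both sides send m_l to the double sum of m_u \<otimes> (e_uv \<otimes> e_vl).\<close>

lemma comodule: "right_comodule K C M \<rho>"
proof (rule right_comodule.intro)
  interpret M: module K M by (rule is_module)
  let ?T = "tensor K M CC"
  note lin = linear_map_tens_left linear_map_tens_right linear_map_ident comult_linear
  note N = finite_atLeastAtMost
  have T: "module K ?T" by (intro module_tensor is_module CC)
  have b1: "bilinear K M C ?T (\<lambda>x c. tens K M CC x (comult C c))"
    by (intro bilinearI lin is_module C CC comult_closed)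
  have b2: "bilinear K M C ?T (\<lambda>x0 x1. tens K M CC x0 (tens K C C x1 c))" if "c \<in> carrier C" for c
    by (intro bilinearI lin is_module C CC tens_closed that)
  have b3: "bilinear K M C ?T (\<lambda>x c. tens_lift K M C ?T (\<lambda>x0 x1. tens K M CC x0 (tens K C C x1 c)) (\<rho> x))"
    by (intro bilinearI linear_map_tens_lift_param linear_lift_coaction b2 lin is_module C CC T
        tens_closed coaction_closed)
  have b4: "bilinear K M C M (\<lambda>x c. counit C c \<odot>\<^bsub>M\<^esub> x)"
    by (intro bilinearI linear_map_smult_fun linear_map_scale is_module counit_linear linear_map_ident counit_closed)
  have tc: "tens K M CC (m u) (tens K C C (e u v) (e v l)) \<in> carrier ?T"
    if "l \<in> N" "u \<in> N" "v \<in> N" for l u v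
    by (intro tens_closed is_module C CC e_closed basis_closed that)
  show "module K M" "linear_map K M (tensor K M C) \<rho>"
    by (rule is_module coaction_linear)+
  fix x assume x: "x \<in> carrier M"
  show "tens_lift K M C ?T (\<lambda>x c. tens K M CC x (comult C c)) (\<rho> x) =
    tens_lift K M C ?T (\<lambda>x c. tens_lift K M C ?T (\<lambda>x0 x1. tens K M CC x0 (tens K C C x1 c)) (\<rho> x)) (\<rho> x)"
  proof (rule linear_eq_on_basis[OF T linear_lift_coaction[OF T b1] linear_lift_coaction[OF T b3] _ x])
    fix l assume l: "l \<in> N"
    have "tens_lift K M C ?T (\<lambda>x c. tens K M CC x (comult C c)) (\<rho> (m l)) =
        (\<Oplus>\<^bsub>?T\<^esub>u\<in>N. tens K M CC (m u) (comult C (e u l)))"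
      by (rule lift_coaction_basis[OF T b1 l])
    also have "\<dots> = (\<Oplus>\<^bsub>?T\<^esub>u\<in>N. \<Oplus>\<^bsub>?T\<^esub>v\<in>N. tens K M CC (m u) (tens K C C (e u v) (e v l)))"
    proof (rule module_finsum_cong[OF T])
      fix u assume u: "u \<in> N"
      show "tens K M CC (m u) (comult C (e u l)) =
          (\<Oplus>\<^bsub>?T\<^esub>v\<in>N. tens K M CC (m u) (tens K C C (e u v) (e v l)))"
        unfolding comult_e[OF u l]
        by (rule linear_map_finsum[OF bilinear_right[OF bilinear_tens[OF is_module CC] basis_closed[OF u]] CC T N])
          (intro tens_closed C e_closed u l; assumption)
      show "(\<Oplus>\<^bsub>?T\<^esub>v\<in>N. tens K M CC (m u) (tens K C C (e u v) (e v l))) \<in> carrier ?T"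
        by (rule module_finsum_closed[OF T tc[OF l u]])
    qed
    also have "\<dots> = (\<Oplus>\<^bsub>?T\<^esub>v\<in>N. \<Oplus>\<^bsub>?T\<^esub>u\<in>N. tens K M CC (m u) (tens K C C (e u v) (e v l)))"
      by (rule module_finsum_swap[OF T N N tc[OF l]])
    also have "\<dots> = (\<Oplus>\<^bsub>?T\<^esub>v\<in>N. tens_lift K M C ?T (\<lambda>x0 x1. tens K M CC x0 (tens K C C x1 (e v l))) (\<rho> (m v)))"
    proof (rule module_finsum_cong[OF T])
      fix v assume v: "v \<in> N"
      show "(\<Oplus>\<^bsub>?T\<^esub>u\<in>N. tens K M CC (m u) (tens K C C (e u v) (e v l))) =
          tens_lift K M C ?T (\<lambda>x0 x1. tens K M CC x0 (tens K C C x1 (e v l))) (\<rho> (m v))"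
        by (rule lift_coaction_basis[OF T b2[OF e_closed[OF v l]] v, symmetric])
      show "tens_lift K M C ?T (\<lambda>x0 x1. tens K M CC x0 (tens K C C x1 (e v l))) (\<rho> (m v)) \<in> carrier ?T"
        by (rule linear_map_closed[OF linear_lift_coaction[OF T b2]]) (intro e_closed basis_closed v l)+
    qed
    also have "\<dots> = tens_lift K M C ?T (\<lambda>x c. tens_lift K M C ?T (\<lambda>x0 x1. tens K M CC x0 (tens K C C x1 c)) (\<rho> x)) (\<rho> (m l))"
      by (rule lift_coaction_basis[OF T b3 l, symmetric])
    finally show "tens_lift K M C ?T (\<lambda>x c. tens K M CC x (comult C c)) (\<rho> (m l)) =
      tens_lift K M C ?T (\<lambda>x c. tens_lift K M C ?T (\<lambda>x0 x1. tens K M CC x0 (tens K C C x1 c)) (\<rho> x)) (\<rho> (m l))" .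
  qed
  show "tens_lift K M C M (\<lambda>x c. counit C c \<odot>\<^bsub>M\<^esub> x) (\<rho> x) = x"
  proof (rule linear_eq_on_basis[OF is_module linear_lift_coaction[OF is_module b4] linear_map_ident _ x])
    fix l assume l: "l \<in> N"
    show "tens_lift K M C M (\<lambda>x c. counit C c \<odot>\<^bsub>M\<^esub> x) (\<rho> (m l)) = m l"
      unfolding lift_coaction_basis[OF is_module b4 l]
      by (subst module_finsum_single[OF is_module N l]) (use l in \<open>simp_all add: counit_e basis_closed del: atLeastAtMost_iff\<close>)
  qed
qed

section \<open>The operator induced by a form, in coordinates\<close>

context
  fixes Q :: "('k, 'q, 'w) module_scheme" and p :: "'c \<Rightarrow> 'q" and \<sigma> :: "('k, 'c, 'q) tens \<Rightarrow> 'k"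
  assumes Q: "module K Q" and p: "linear_map K C Q p"
    and \<sigma>: "linear_map K (tensor K C Q) (KK) \<sigma>"
begin

lemma bilinear_induced:
  "bilinear K M M MM (\<lambda>x y. tens_lift K M C MM (\<lambda>m0 m1. tens_lift K M C MM
    (\<lambda>n0 n1. \<sigma> (tens K C Q m1 (p n1)) \<odot>\<^bsub>MM\<^esub> tens K M M m0 n0) (\<rho> y)) (\<rho> x))" (is ?A)
  and lift_lift_induced: "a \<in> N \<Longrightarrow> b \<in> N \<Longrightarrow>
    tens_lift K M C MM (\<lambda>m0 m1. tens_lift K M C MM
    (\<lambda>n0 n1. \<sigma> (tens K C Q m1 (p n1)) \<odot>\<^bsub>MM\<^esub> tens K M M m0 n0) (\<rho> (m b))) (\<rho> (m a))
    = (\<Oplus>\<^bsub>MM\<^esub>v\<in>N. \<Oplus>\<^bsub>MM\<^esub>w\<in>N. \<sigma> (tens K C Q (e v a) (p (e w b))) \<odot>\<^bsub>MM\<^esub> mm v w)"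
    (is "_ \<Longrightarrow> _ \<Longrightarrow> ?B")
proof -
  note pc = linear_map_closed[OF p]
  have \<sigma>c: "\<sigma> (tens K C Q x d) \<in> carrier K" if "x \<in> carrier C" "d \<in> carrier Q" for x d
    using linear_map_closed[OF \<sigma> tens_closed[OF C Q that]] by simp
  have \<sigma>1: "linear_map K C (KK) (\<lambda>x. \<sigma> (tens K C Q x d))" if "d \<in> carrier Q" for d
    by (rule linear_map_comp[OF \<sigma> bilinear_left[OF bilinear_tens[OF C Q] that]])
  have \<sigma>2: "linear_map K C (KK) (\<lambda>y. \<sigma> (tens K C Q x (p y)))" if "x \<in> carrier C" for x
    by (rule linear_map_comp[OF linear_map_comp[OF \<sigma> bilinear_right[OF bilinear_tens[OF C Q] that]] p])
  note intros = linear_map_smult_fun linear_map_scale linear_map_tens_left linear_map_tens_right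
    linear_map_ident \<sigma>1 \<sigma>2 \<sigma>c pc is_module MM C tens_closed
  have b1: "bilinear K M C MM (\<lambda>n0 n1. \<sigma> (tens K C Q m1 (p n1)) \<odot>\<^bsub>MM\<^esub> tens K M M m0 n0)"
    if "m0 \<in> carrier M" "m1 \<in> carrier C" for m0 m1
    by (intro bilinearI intros that)
  have b2: "bilinear K M C MM (\<lambda>m0 m1. tens_lift K M C MM
      (\<lambda>n0 n1. \<sigma> (tens K C Q m1 (p n1)) \<odot>\<^bsub>MM\<^esub> tens K M M m0 n0) (\<rho> y))" if "y \<in> carrier M" for y
    by (intro bilinearI linear_map_tens_lift_param b1 coaction_closed that intros)
  show ?A
    by (intro bilinearI linear_lift_coaction linear_map_tens_lift_param b1 b2 coaction_closed intros)
  show ?B if ab: "a \<in> N" "b \<in> N"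
  proof -
    have "tens_lift K M C MM (\<lambda>m0 m1. tens_lift K M C MM
      (\<lambda>n0 n1. \<sigma> (tens K C Q m1 (p n1)) \<odot>\<^bsub>MM\<^esub> tens K M M m0 n0) (\<rho> (m b))) (\<rho> (m a))
      = (\<Oplus>\<^bsub>MM\<^esub>v\<in>N. tens_lift K M C MM
      (\<lambda>n0 n1. \<sigma> (tens K C Q (e v a) (p n1)) \<odot>\<^bsub>MM\<^esub> tens K M M (m v) n0) (\<rho> (m b)))"
      by (rule lift_coaction_basis[OF MM b2[OF basis_closed[OF ab(2)]] ab(1)])
    also have "\<dots> = (\<Oplus>\<^bsub>MM\<^esub>v\<in>N. \<Oplus>\<^bsub>MM\<^esub>w\<in>N. \<sigma> (tens K C Q (e v a) (p (e w b))) \<odot>\<^bsub>MM\<^esub> mm v w)"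
    proof (rule module_finsum_cong[OF MM])
      fix v assume v: "v \<in> N"
      show "tens_lift K M C MM (\<lambda>n0 n1. \<sigma> (tens K C Q (e v a) (p n1)) \<odot>\<^bsub>MM\<^esub> tens K M M (m v) n0) (\<rho> (m b))
        = (\<Oplus>\<^bsub>MM\<^esub>w\<in>N. \<sigma> (tens K C Q (e v a) (p (e w b))) \<odot>\<^bsub>MM\<^esub> mm v w)"
        by (rule lift_coaction_basis[OF MM b1[OF basis_closed[OF v] e_closed[OF v ab(1)]] ab(2)])
      interpret MM: module K MM by (rule MM)
      show "(\<Oplus>\<^bsub>MM\<^esub>w\<in>N. \<sigma> (tens K C Q (e v a) (p (e w b))) \<odot>\<^bsub>MM\<^esub> mm v w) \<in> carrier MM"
        by (intro module_finsum_closed[OF MM] MM.smult_closed mm_closed \<sigma>c pc e_closed v ab)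
    qed
    finally show ?thesis .
  qed
qed

lemma induced_op_lin_hom: "induced_op K C Q p M \<rho> \<sigma> \<in> lin_hom K MM MM"
  unfolding induced_op_def Let_def by (intro tens_lift_lin_hom is_module MM bilinear_induced)

text \<open>Inserting the coaction of m_a and of m_b puts the coefficient \<sigma>(e_va \<otimes>
  p(e_wb)) in front of m_v \<otimes> m_w, and coordinates read it off.\<close>

lemma mat_induced_op:
  assumes "i \<in> N" "j \<in> N" "a \<in> N" "b \<in> N"
  shows "mat (induced_op K C Q p M \<rho> \<sigma>) i j a b = \<sigma> (tens K C Q (e i a) (p (e j b)))"
proof -
  have \<sigma>c: "\<sigma> (tens K C Q x d) \<in> carrier K" if "x \<in> carrier C" "d \<in> carrier Q" for x d
    using linear_map_closed[OF \<sigma> tens_closed[OF C Q that]] by simp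
  have "induced_op K C Q p M \<rho> \<sigma> (mm a b)
    = (\<Oplus>\<^bsub>MM\<^esub>v\<in>N. \<Oplus>\<^bsub>MM\<^esub>w\<in>N. \<sigma> (tens K C Q (e v a) (p (e w b))) \<odot>\<^bsub>MM\<^esub> mm v w)"
    unfolding induced_op_def Let_def
    by (subst tens_lift_tens[OF is_module is_module MM bilinear_induced basis_closed[OF assms(3)] basis_closed[OF assms(4)]])
      (rule lift_lift_induced[OF assms(3,4)])
  then show ?thesis unfolding mat_def
    by (simp only:) (intro tcoord_sum[where s = "\<lambda>v w. \<sigma> (tens K C Q (e v a) (p (e w b)))"]
      \<sigma>c e_closed linear_map_closed[OF p] assms)
qed

text \<open>Both operators are extensional and linear, so they agree exactly when their matrices do.
  The operator equation becomes a list of prescribed values for \<sigma>, which serves existence and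
  uniqueness alike.\<close>

lemma eq_induced_op_iff:
  assumes "R \<in> lin_hom K MM MM"
  shows "R = induced_op K C Q p M \<rho> \<sigma> \<longleftrightarrow>
    (\<forall>i\<in>N. \<forall>j\<in>N. \<forall>a\<in>N. \<forall>b\<in>N. \<sigma> (tens K C Q (e i a) (p (e j b))) = mat R i j a b)"
proof
  assume "R = induced_op K C Q p M \<rho> \<sigma>"
  then show "\<forall>i\<in>N. \<forall>j\<in>N. \<forall>a\<in>N. \<forall>b\<in>N. \<sigma> (tens K C Q (e i a) (p (e j b))) = mat R i j a b"
    by (intro ballI) (simp only: mat_induced_op)
next
  assume *: "\<forall>i\<in>N. \<forall>j\<in>N. \<forall>a\<in>N. \<forall>b\<in>N. \<sigma> (tens K C Q (e i a) (p (e j b))) = mat R i j a b"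
  note lR = lin_homD[OF assms] and lI = lin_homD[OF induced_op_lin_hom]
  show "R = induced_op K C Q p M \<rho> \<sigma>"
  proof (rule lin_hom_eqI[OF assms induced_op_lin_hom])
    fix t assume "t \<in> carrier MM"
    show "R t = induced_op K C Q p M \<rho> \<sigma> t"
    proof (rule tensor_eq_on_basis[OF MM lR lI _ \<open>t \<in> carrier MM\<close>])
      fix a b assume ab: "a \<in> N" "b \<in> N"
      show "R (mm a b) = induced_op K C Q p M \<rho> \<sigma> (mm a b)"
      proof (rule tensor_eqI[OF linear_map_closed[OF lR mm_closed[OF ab]] linear_map_closed[OF lI mm_closed[OF ab]]])
        fix i j assume ij: "i \<in> N" "j \<in> N"
        have "mat R i j a b = mat (induced_op K C Q p M \<rho> \<sigma>) i j a b"
          unfolding mat_induced_op[OF ij ab] using *[rule_format, OF ij ab] by (rule sym)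
        then show "tcoord i j (R (mm a b)) = tcoord i j (induced_op K C Q p M \<rho> \<sigma> (mm a b))"
          by (simp only: mat_def)
      qed
    qed
  qed
qed

end

end

section \<open>Records extending a vector space\<close>

lemma extend_simps [simp]:
  "carrier (module.extend V x) = carrier V" "add (module.extend V x) = add V"
  "zero (module.extend V x) = zero V" "smult (module.extend V x) = smult V"
  by (simp_all add: module.defs)

lemma coalg_fields_simps [simp]:
  "comult (module.extend V (coalg.fields \<Delta> \<epsilon>)) = \<Delta>"
  "counit (module.extend V (coalg.fields \<Delta> \<epsilon>)) = \<epsilon>"
  by (simp_all add: module.defs coalg.defs)

text \<open>Tensor products see only the carrier, addition and scalar multiplication of their
  factors. So the comultiplication and counit carried by a coalgebra may be stripped, and facts
  about free modules and quotient spaces apply to it.\<close>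

lemma tensor_rels_extend [simp]:
  "tensor_rels K (module.extend V x) W = tensor_rels K V W"
  "tensor_rels K V' (module.extend W' y) = tensor_rels K V' W'"
  by (simp_all only: tensor_rels_def extend_simps)

lemma tensor_extend [simp]:
  "tensor K (module.extend V x) W = tensor K V W"
  "tensor K V' (module.extend W' y) = tensor K V' W'"
  by (simp_all only: tensor_def tensor_null_def tensor_rels_extend extend_simps)

lemma tens_extend [simp]:
  "tens K (module.extend V x) W = tens K V W"
  "tens K V' (module.extend W' y) = tens K V' W'"
  by (simp_all only: fun_eq_iff tens_def tensor_null_def tensor_rels_extend extend_simps simp_thms)

lemma lin_hom_extend [simp]:
  "lin_hom K (module.extend V x) W = lin_hom K V W"
  "lin_hom K V' (module.extend W' y) = lin_hom K V' W'"
  by (simp_all only: lin_hom_def linear_map_def extend_simps)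

lemma linear_map_extend [simp]:
  "linear_map K (module.extend V x) W f = linear_map K V W f"
  "linear_map K V' (module.extend W' y) g = linear_map K V' W' g"
  by (simp_all only: linear_map_def extend_simps)

lemma tens_lift_extend [simp]:
  "tens_lift K (module.extend V x) W U b = tens_lift K V W U b"
  "tens_lift K V' (module.extend W' y) U' b' = tens_lift K V' W' U' b'"
  by (simp_all only: tens_lift_def tensor_extend tens_extend extend_simps)

lemma module_transfer:
  assumes "module K V" "carrier W = carrier V" "add W = add V" "zero W = zero V" "smult W = smult V"
  shows "module K W"
proof -
  interpret V: module K V by fact
  have W: "abelian_group W"
    by (rule abelian_groupI; unfold assms(2-4))
      (auto simp: V.M.a_assoc intro: V.M.a_comm bexI[where x = "\<ominus>\<^bsub>V\<^esub> x" for x] V.M.l_neg)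
  show ?thesis
    by (rule moduleI[OF V.R.is_cring W]; unfold assms(2-5))
      (simp_all only: V.smult_closed V.smult_l_distr V.smult_r_distr V.smult_assoc1 V.smult_one)
qed

lemma module_extend [simp]: "module K (module.extend V x) = module K V"
  by (rule iffI; erule module_transfer) simp_all

lemma submodule_extend [simp]: "submodule I K (module.extend V x) = submodule I K V"
  by (simp add: submodule_def subgroup_def submodule_axioms_def m_inv_def)

lemma lspan_extend [simp]: "lspan K (module.extend V x) S = lspan K V S"
  by (simp add: lspan_def)

lemma finsum_extend [simp]: "finsum (module.extend V x) = finsum V"
  by (simp add: fun_eq_iff finsum_def finprod_def)

section \<open>The comatrix coalgebra and its quotients\<close>

lemma free_gen_pair: "free_gen K (a, b) (u, v) = (if u = a \<and> v = b then \<one>\<^bsub>K\<^esub> else \<zero>\<^bsub>K\<^esub>)"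
  by (simp add: free_gen_def)

text \<open>The structure maps are linear in the coefficients \<open>f (j, l)\<close>; at a free
  generator the double sum collapses to the prescribed value.\<close>

lemma matrix_coalgebra_comatrix:
  assumes "cring K"
  shows "matrix_coalgebra K (comatrix K n) n (\<lambda>i j. free_gen K (i, j))"
proof -
  interpret cring K by fact
  let ?F = "free_mod K ({1..n} \<times> {1..n})"
  let ?FF = "tensor K ?F ?F"
  let ?\<delta> = "\<lambda>j l. \<Oplus>\<^bsub>?FF\<^esub>u\<in>{1..n}. tens K ?F ?F (free_gen K (j, u)) (free_gen K (u, l))"
  have F: "module K ?F" by (rule module_free_mod[OF assms])
  have FF: "module K ?FF" by (rule module_tensor[OF F F])
  have S: "module K (self_module K)" by (rule module_self_module[OF assms])
  have g: "free_gen K (i, j) \<in> carrier ?F" if "i \<in> {1..n}" "j \<in> {1..n}" for i j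
    by (rule free_gen_closed[OF assms]) (use that in auto)
  have \<delta>: "?\<delta> j l \<in> carrier ?FF" if "j \<in> {1..n}" "l \<in> {1..n}" for j l
    by (intro module_finsum_closed[OF FF] tens_closed F g that)
  note N = finite_atLeastAtMost
  have 1: "linear_map K ?F ?FF (\<lambda>f. \<Oplus>\<^bsub>?FF\<^esub>j\<in>{1..n}. \<Oplus>\<^bsub>?FF\<^esub>l\<in>{1..n}. f (j, l) \<odot>\<^bsub>?FF\<^esub> ?\<delta> j l)"
    by (intro linear_map_finsum_fun linear_map_scale FF linear_map_eval \<delta> N)
  have 2: "linear_map K ?F (self_module K) (\<lambda>f. \<Oplus>\<^bsub>K\<^esub>j\<in>{1..n}. \<Oplus>\<^bsub>K\<^esub>l\<in>{1..n}.
            f (j, l) \<otimes>\<^bsub>K\<^esub> (if j = l then \<one>\<^bsub>K\<^esub> else \<zero>\<^bsub>K\<^esub>))"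
    unfolding finsum_self_module[of K, symmetric]
    by (intro linear_map_finsum_fun linear_map_mult_right S linear_map_eval N assms) simp
  have 3: "(\<Oplus>\<^bsub>?FF\<^esub>j\<in>{1..n}. \<Oplus>\<^bsub>?FF\<^esub>l\<in>{1..n}. free_gen K (a, b) (j, l) \<odot>\<^bsub>?FF\<^esub> ?\<delta> j l) = ?\<delta> a b"
    if "a \<in> {1..n}" "b \<in> {1..n}" for a b
    unfolding free_gen_pair by (rule double_sum_delta[OF FF N N that, where g = ?\<delta>]) (rule \<delta>)
  have 4: "(\<Oplus>\<^bsub>K\<^esub>j\<in>{1..n}. \<Oplus>\<^bsub>K\<^esub>l\<in>{1..n}. free_gen K (a, b) (j, l) \<otimes>\<^bsub>K\<^esub> (if j = l then \<one>\<^bsub>K\<^esub> else \<zero>\<^bsub>K\<^esub>))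
    = (if a = b then \<one>\<^bsub>K\<^esub> else \<zero>\<^bsub>K\<^esub>)"
    if "a \<in> {1..n}" "b \<in> {1..n}" for a b
    unfolding free_gen_pair
    using double_sum_delta[OF S N N that, where g = "\<lambda>j l. if j = l then \<one>\<^bsub>K\<^esub> else \<zero>\<^bsub>K\<^esub>"] by simp
  show ?thesis unfolding comatrix_def Let_def
  proof (rule matrix_coalgebra.intro; unfold extend_simps coalg_fields_simps tensor_extend tens_extend
      linear_map_extend module_extend lspan_extend)
    show "carrier ?F \<subseteq> lspan K ?F ((\<lambda>(i, j). free_gen K (i, j)) ` ({1..n} \<times> {1..n}))"
      by (rule lspan_free_gen[OF assms]) (use g in auto)
  qed (rule F g 1 2 3 4; assumption)+
qed

text \<open>Freeness allows arbitrary values on pairs of generators. The quotient offers no such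
  freedom, so forms on it start here and descend.\<close>

lemma bilinear_form_on_free:
  assumes "cring K" "finite S" "finite T" "\<And>x y. x \<in> S \<Longrightarrow> y \<in> T \<Longrightarrow> \<tau> x y \<in> carrier K"
  obtains s where "bilinear K (free_mod K S) (free_mod K T) (self_module K) s"
    "\<And>x y. x \<in> S \<Longrightarrow> y \<in> T \<Longrightarrow> s (free_gen K x) (free_gen K y) = \<tau> x y"
proof
  interpret cring K by fact
  have SM: "module K (self_module K)" by (rule module_self_module[OF assms(1)])
  let ?s = "\<lambda>f g. \<Oplus>\<^bsub>self_module K\<^esub>x\<in>S. \<Oplus>\<^bsub>self_module K\<^esub>y\<in>T. f x \<otimes>\<^bsub>K\<^esub> g y \<otimes>\<^bsub>K\<^esub> \<tau> x y"
  show "bilinear K (free_mod K S) (free_mod K T) (self_module K) ?s"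
    by (intro bilinearI linear_map_finsum_fun linear_map_mult_left linear_map_mult_right
        linear_map_eval SM assms) (auto simp: free_mod_carrier)
  fix a b assume ab: "a \<in> S" "b \<in> T"
  have "?s (free_gen K a) (free_gen K b) = (\<Oplus>\<^bsub>self_module K\<^esub>x\<in>S. \<Oplus>\<^bsub>self_module K\<^esub>y\<in>T.
      (if x = a \<and> y = b then \<one>\<^bsub>K\<^esub> else \<zero>\<^bsub>K\<^esub>) \<odot>\<^bsub>self_module K\<^esub> \<tau> x y)"
    by (intro module_finsum_cong[OF SM] module_finsum_closed[OF SM])
      (auto simp: free_gen_def assms(4) simp del: finsum_self_module)
  also have "\<dots> = \<tau> a b"
    by (rule double_sum_delta[OF SM assms(2,3) ab]) (simp add: assms(4))
  finally show "?s (free_gen K a) (free_gen K b) = \<tau> a b" .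
qed

text \<open>One-sided on purpose: in general a form of the kind used here descends in its second
  argument. Descent in the first argument is obtained by applying this to the form with swapped
  arguments.\<close>

lemma bilinear_quot_right:
  assumes "module K V" "module K W" "module K U" "bilinear K V W U b" "submodule N K W"
    "\<And>v w. v \<in> carrier V \<Longrightarrow> w \<in> N \<Longrightarrow> b v w = \<zero>\<^bsub>U\<^esub>"
  shows "bilinear K V (quot_mod K W N) U (\<lambda>v X. the_elem (b v ` X))"
    and "v \<in> carrier V \<Longrightarrow> w \<in> carrier W \<Longrightarrow> the_elem (b v ` (N +>\<^bsub>W\<^esub> w)) = b v w"
proof -
  show *: "the_elem (b v ` (N +>\<^bsub>W\<^esub> w)) = b v w" if "v \<in> carrier V" "w \<in> carrier W" for v w
    by (rule the_elem_image_coset[OF assms(2,3,5) bilinear_right[OF assms(4) that(1)] assms(6)[OF that(1)] that(2)])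
  show "bilinear K V (quot_mod K W N) U (\<lambda>v X. the_elem (b v ` X))"
  proof (rule bilinearI)
    fix v assume v: "v \<in> carrier V"
    show "linear_map K (quot_mod K W N) U (\<lambda>X. the_elem (b v ` X))"
      by (rule linear_map_quot_mod[OF assms(2,3,5) bilinear_right[OF assms(4) v] assms(6)[OF v]])
  next
    fix X assume "X \<in> carrier (quot_mod K W N)"
    then obtain w where w: "w \<in> carrier W" "X = N +>\<^bsub>W\<^esub> w" by (rule quot_mod_carrierE[OF assms(2,5)])
    show "linear_map K V U (\<lambda>v. the_elem (b v ` X))" unfolding w(2)
      by (rule linear_map_cong[OF bilinear_left[OF assms(4) w(1)] assms(1) *[OF _ w(1)]])
  qed
qed

lemma bilinear_flip: "bilinear K V W U b \<Longrightarrow> bilinear K W V U (\<lambda>w v. b v w)"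
  by (simp add: bilinear_def)

text \<open>The coideal conditions make both structure maps vanish on \<open>I\<close>, hence
  constant on cosets. The classes of the \<open>e i j\<close> span the quotient and inherit the
  matrix formulas.\<close>

lemma matrix_coalgebra_quot:
  assumes "matrix_coalgebra K C n e" "coideal K C I"
  shows "matrix_coalgebra K (quot_coalg K C I) n (\<lambda>i j. I +>\<^bsub>C\<^esub> e i j)"
proof -
  interpret matrix_coalgebra K C n e by fact
  let ?Q = "quot_mod K C I"
  let ?QQ = "tensor K ?Q ?Q"
  let ?L = "{tens K C C x c | x c. x \<in> I \<and> c \<in> carrier C}" and ?R = "{tens K C C c x | x c. x \<in> I \<and> c \<in> carrier C}"
  let ?p = "\<lambda>x. I +>\<^bsub>C\<^esub> x"
  have I: "submodule I K C" and I0: "\<And>x. x \<in> I \<Longrightarrow> counit C x = \<zero>\<^bsub>K\<^esub>"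
    and I\<Delta>: "comult C ` I \<subseteq> lspan K CC
       (?L \<union> ?R)"
    using assms(2) unfolding coideal_def by blast+
  have IC: "x \<in> carrier C" if "x \<in> I" for x
    using module.submoduleE(1)[OF C I] that by (rule subsetD)
  have Q: "module K ?Q" by (rule module_quot_mod[OF C I])
  have QQ: "module K ?QQ" by (rule module_tensor[OF Q Q])
  note p = linear_map_coset[OF C I]
  have p0: "?p x = \<zero>\<^bsub>?Q\<^esub>" if "x \<in> I" for x
    using coset_eq_zero_iff[OF C I IC[OF that]] that by simp
  have pc: "?p x \<in> carrier ?Q" if "x \<in> carrier C" for x by (rule linear_map_closed[OF p that])
  let ?b = "\<lambda>x y. tens K ?Q ?Q (?p x) (?p y)"
  \<comment> \<open>The kernel of the map induced by the projection on both tensor factors. Tensors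
    with one factor in \<open>I\<close> lie in it, so the coideal condition places the
    comultiplication of \<open>I\<close> there.\<close>
  let ?Z = "{t \<in> carrier CC. tens_lift K C C ?QQ ?b t \<in> {\<zero>\<^bsub>?QQ\<^esub>}}"
  let ?h = "sweedler K C ?QQ ?b"
  have b: "bilinear K C C ?QQ ?b"
    by (intro bilinearI linear_map_tens_left linear_map_tens_right Q p pc)
  note bt = bilinear_tens[OF Q Q]
  note L = linear_map_tens_lift[OF C C QQ b]
  have b0: "?b x y = \<zero>\<^bsub>?QQ\<^esub>" if "x \<in> I" "y \<in> carrier C" for x y
    unfolding p0[OF that(1)] by (rule linear_map_zero[OF bilinear_left[OF bt pc[OF that(2)]] Q QQ])
  have b0': "?b y x = \<zero>\<^bsub>?QQ\<^esub>" if "x \<in> I" "y \<in> carrier C" for x y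
    unfolding p0[OF that(1)] by (rule linear_map_zero[OF bilinear_right[OF bt pc[OF that(2)]] Q QQ])
  have "lspan K CC (?L \<union> ?R)
      \<subseteq> ?Z"
  proof (rule lspan_least[OF submodule_preimage[OF CC QQ L submodule_zero[OF QQ]]], rule Un_least)
    have "tens K C C x c \<in> carrier CC \<and> tens_lift K C C ?QQ ?b (tens K C C x c) = \<zero>\<^bsub>?QQ\<^esub>"
      if "x \<in> I" "c \<in> carrier C" for x c
      using tens_closed[OF C C IC[OF that(1)] that(2)] tens_lift_tens[OF C C QQ b IC[OF that(1)] that(2)] b0[OF that]
      by simp
    then show "?L \<subseteq> ?Z"
      by blast
    have "tens K C C c x \<in> carrier CC \<and> tens_lift K C C ?QQ ?b (tens K C C c x) = \<zero>\<^bsub>?QQ\<^esub>"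
      if "x \<in> I" "c \<in> carrier C" for x c
      using tens_closed[OF C C that(2) IC[OF that(1)]] tens_lift_tens[OF C C QQ b that(2) IC[OF that(1)]] b0'[OF that]
      by simp
    then show "?R \<subseteq> ?Z"
      by blast
  qed
  then have h0: "?h x = \<zero>\<^bsub>?QQ\<^esub>" if "x \<in> I" for x
    using I\<Delta> that unfolding sweedler_def by blast
  note h = linear_sweedler[OF QQ b]
  have surj: "?p ` carrier C = carrier ?Q"
    by (auto simp: A_RCOSETS_def RCOSETS_def a_r_coset_def)
  show ?thesis unfolding quot_coalg_def Let_def
  proof (rule matrix_coalgebra.intro; unfold extend_simps coalg_fields_simps tensor_extend tens_extend
      linear_map_extend module_extend lspan_extend finsum_extend)
    show "module K ?Q" by (rule Q)
    show "linear_map K ?Q ?QQ (\<lambda>X. the_elem (?h ` X))" by (rule linear_map_quot_mod[OF C QQ I h h0])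
    show "linear_map K ?Q (self_module K) (\<lambda>X. the_elem (counit C ` X))"
      by (rule linear_map_quot_mod[OF C K_self I counit_linear]) (simp add: I0)
    have "(\<lambda>(i, j). ?p (e i j)) ` ({1..n} \<times> {1..n}) = ?p ` case_prod e ` ({1..n} \<times> {1..n})"
      by (simp only: image_image case_prod_unfold)
    then show "carrier ?Q \<subseteq> lspan K ?Q ((\<lambda>(i, j). ?p (e i j)) ` ({1..n} \<times> {1..n}))"
      using lspan_image[OF C Q p surj e_span e_subset] by (simp only:)
    fix i j assume ij: "i \<in> {1..n}" "j \<in> {1..n}"
    show "?p (e i j) \<in> carrier ?Q" by (rule pc[OF e_closed[OF ij]])
    show "the_elem (?h ` ?p (e i j)) = (\<Oplus>\<^bsub>?QQ\<^esub>u\<in>{1..n}. ?b (e i u) (e u j))"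
      by (rule trans[OF the_elem_image_coset[OF C QQ I h _ e_closed[OF ij]] sweedler_e[OF QQ b ij]]) (rule h0)
    have "the_elem (counit C ` ?p (e i j)) = counit C (e i j)"
      by (rule the_elem_image_coset[OF C K_self I counit_linear _ e_closed[OF ij]]) (simp add: I0)
    then show "the_elem (counit C ` ?p (e i j)) = (if i = j then \<one>\<^bsub>K\<^esub> else \<zero>\<^bsub>K\<^esub>)"
      unfolding counit_e[OF ij] .
  qed
qed

section \<open>Convolution\<close>

text \<open>The comultiplication of C \<otimes> D sends e_ia \<otimes> f_jb to the sum over
  \<open>u\<close>, \<open>v\<close> of (e_iu \<otimes> f_jv) \<otimes> (e_ua \<otimes> f_vb).
  Convolution on matrix elements is thus multiplication of matrices indexed by pairs.\<close>

lemma convolution_mult: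
  assumes "matrix_coalgebra K C n e" "matrix_coalgebra K D n f"
    and \<sigma>: "\<sigma> \<in> lin_hom K (tensor K C D) (self_module K)"
    and \<tau>: "\<tau> \<in> lin_hom K (tensor K C D) (self_module K)"
  shows "\<sigma> \<otimes>\<^bsub>convolution_algebra K (tensor_coalg K C D)\<^esub> \<tau> \<in> lin_hom K (tensor K C D) (self_module K)"
    and "i \<in> {1..n} \<Longrightarrow> j \<in> {1..n} \<Longrightarrow> a \<in> {1..n} \<Longrightarrow> b \<in> {1..n} \<Longrightarrow>
      (\<sigma> \<otimes>\<^bsub>convolution_algebra K (tensor_coalg K C D)\<^esub> \<tau>) (tens K C D (e i a) (f j b)) =
      (\<Oplus>\<^bsub>K\<^esub>u\<in>{1..n}. \<Oplus>\<^bsub>K\<^esub>v\<in>{1..n}. \<sigma> (tens K C D (e i u) (f j v)) \<otimes>\<^bsub>K\<^esub> \<tau> (tens K C D (e u a) (f v b)))"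
proof -
  interpret C: matrix_coalgebra K C n e by fact
  interpret D: matrix_coalgebra K D n f by fact
  let ?T = "tensor K C D"
  let ?TT = "tensor K ?T ?T"
  let ?S = "self_module K"
  have T: "module K ?T" by (rule module_tensor[OF C.C D.C])
  have TT: "module K ?TT" by (rule module_tensor[OF T T])
  note S = C.K_self and N = finite_atLeastAtMost
  let ?d = "\<lambda>c1 c2 d1 d2. tens K ?T ?T (tens K C D c1 d1) (tens K C D c2 d2)"
  let ?\<Delta> = "tens_lift K C D ?TT (\<lambda>c d. sweedler K C ?TT (\<lambda>c1 c2. sweedler K D ?TT (?d c1 c2) d) c)"
  let ?B = "\<lambda>x y. \<sigma> x \<otimes>\<^bsub>K\<^esub> \<tau> y"
  have B: "bilinear K ?T ?T ?S ?B"
    using linear_map_closed[OF lin_homD[OF \<sigma>]] linear_map_closed[OF lin_homD[OF \<tau>]]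
    by (intro bilinearI linear_map_mult_left linear_map_mult_right C.K_cring lin_homD[OF \<sigma>] lin_homD[OF \<tau>]) simp_all
  note lin = linear_map_tens_left linear_map_tens_right linear_map_ident
  have b1: "bilinear K D D ?TT (?d c1 c2)" if "c1 \<in> carrier C" "c2 \<in> carrier C" for c1 c2
    by (intro bilinearI lin T C.C D.C tens_closed that)
  have b2: "bilinear K C C ?TT (\<lambda>c1 c2. sweedler K D ?TT (?d c1 c2) d)" if "d \<in> carrier D" for d
    by (intro bilinearI linear_map_sweedler_param b1 lin T TT C.C D.C tens_closed D.comult_closed that)
  have b3: "bilinear K C D ?TT (\<lambda>c d. sweedler K C ?TT (\<lambda>c1 c2. sweedler K D ?TT (?d c1 c2) d) c)"
    by (intro bilinearI linear_map_sweedler_param C.linear_sweedler D.linear_sweedler b1 b2 T TT C.C D.C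
        C.comult_closed)
  have \<Delta>: "linear_map K ?T ?TT ?\<Delta>" by (rule linear_map_tens_lift[OF C.C D.C TT b3])
  let ?g = "\<lambda>t. tens_lift K ?T ?T ?S ?B (?\<Delta> t)"
  have g: "linear_map K ?T ?S ?g" by (rule linear_map_tens_lift_arg[OF T T S B \<Delta>])
  have conv: "\<sigma> \<otimes>\<^bsub>convolution_algebra K (tensor_coalg K C D)\<^esub> \<tau> = restrict ?g (carrier ?T)"
    by (simp only: convolution_algebra_def sweedler_def tensor_coalg_def Let_def extend_simps monoid.simps
        coalg_fields_simps tens_lift_extend)
  show "\<sigma> \<otimes>\<^bsub>convolution_algebra K (tensor_coalg K C D)\<^esub> \<tau> \<in> lin_hom K ?T ?S"
    unfolding conv by (rule restrict_in_lin_hom[OF T g])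
  assume i: "i \<in> {1..n}" "j \<in> {1..n}" "a \<in> {1..n}" "b \<in> {1..n}"
  have dc: "?d (e i u) (e u a) (f j v) (f v b) \<in> carrier ?TT" if "u \<in> {1..n}" "v \<in> {1..n}" for u v
    by (intro tens_closed T C.C D.C C.e_closed D.e_closed that i)
  have "?\<Delta> (tens K C D (e i a) (f j b)) =
      sweedler K C ?TT (\<lambda>c1 c2. sweedler K D ?TT (?d c1 c2) (f j b)) (e i a)"
    by (rule tens_lift_tens[OF C.C D.C TT b3 C.e_closed[OF i(1,3)] D.e_closed[OF i(2,4)]])
  also have "\<dots> = (\<Oplus>\<^bsub>?TT\<^esub>u\<in>{1..n}. sweedler K D ?TT (?d (e i u) (e u a)) (f j b))"
    by (rule C.sweedler_e[OF TT b2[OF D.e_closed[OF i(2,4)]] i(1,3)])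
  also have "\<dots> = (\<Oplus>\<^bsub>?TT\<^esub>u\<in>{1..n}. \<Oplus>\<^bsub>?TT\<^esub>v\<in>{1..n}. ?d (e i u) (e u a) (f j v) (f v b))"
  proof (rule module_finsum_cong[OF TT])
    fix u assume u: "u \<in> {1..n}"
    show "(\<Oplus>\<^bsub>?TT\<^esub>v\<in>{1..n}. ?d (e i u) (e u a) (f j v) (f v b)) \<in> carrier ?TT"
      by (rule module_finsum_closed[OF TT dc[OF u]])
    show "sweedler K D ?TT (?d (e i u) (e u a)) (f j b) =
        (\<Oplus>\<^bsub>?TT\<^esub>v\<in>{1..n}. ?d (e i u) (e u a) (f j v) (f v b))"
      by (rule D.sweedler_e[OF TT b1[OF C.e_closed[OF i(1) u] C.e_closed[OF u i(3)]] i(2,4)])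
  qed
  finally have \<Delta>e: "?\<Delta> (tens K C D (e i a) (f j b)) =
      (\<Oplus>\<^bsub>?TT\<^esub>u\<in>{1..n}. \<Oplus>\<^bsub>?TT\<^esub>v\<in>{1..n}. ?d (e i u) (e u a) (f j v) (f v b))" .
  note fs = linear_map_finsum[OF linear_map_tens_lift[OF T T S B] TT S N]
  have te: "tens K C D (e i a) (f j b) \<in> carrier ?T" by (intro tens_closed C.C D.C C.e_closed D.e_closed i)
  have Bc: "?B (tens K C D (e i u) (f j v)) (tens K C D (e u a) (f v b)) \<in> carrier ?S"
    if "u \<in> {1..n}" "v \<in> {1..n}" for u v
    by (intro bilinear_closed[OF B] tens_closed C.C D.C C.e_closed D.e_closed that i)
  have "?g (tens K C D (e i a) (f j b)) =
      (\<Oplus>\<^bsub>?S\<^esub>u\<in>{1..n}. tens_lift K ?T ?T ?S ?B (\<Oplus>\<^bsub>?TT\<^esub>v\<in>{1..n}. ?d (e i u) (e u a) (f j v) (f v b)))"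
    unfolding \<Delta>e by (rule fs) (rule module_finsum_closed[OF TT dc])
  also have "\<dots> = (\<Oplus>\<^bsub>?S\<^esub>u\<in>{1..n}. \<Oplus>\<^bsub>?S\<^esub>v\<in>{1..n}. ?B (tens K C D (e i u) (f j v)) (tens K C D (e u a) (f v b)))"
  proof (rule module_finsum_cong[OF S])
    fix u assume u: "u \<in> {1..n}"
    show "(\<Oplus>\<^bsub>?S\<^esub>v\<in>{1..n}. ?B (tens K C D (e i u) (f j v)) (tens K C D (e u a) (f v b))) \<in> carrier ?S"
      by (rule module_finsum_closed[OF S Bc[OF u]])
    have "tens_lift K ?T ?T ?S ?B (\<Oplus>\<^bsub>?TT\<^esub>v\<in>{1..n}. ?d (e i u) (e u a) (f j v) (f v b)) =
       (\<Oplus>\<^bsub>?S\<^esub>v\<in>{1..n}. tens_lift K ?T ?T ?S ?B (?d (e i u) (e u a) (f j v) (f v b)))"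
      by (rule fs) (rule dc[OF u])
    also have "\<dots> = (\<Oplus>\<^bsub>?S\<^esub>v\<in>{1..n}. ?B (tens K C D (e i u) (f j v)) (tens K C D (e u a) (f v b)))"
      by (rule module_finsum_cong[OF S Bc[OF u]], assumption)
        (intro tens_lift_tens[OF T T S B] tens_closed C.C D.C C.e_closed D.e_closed u i; assumption)
    finally show "tens_lift K ?T ?T ?S ?B (\<Oplus>\<^bsub>?TT\<^esub>v\<in>{1..n}. ?d (e i u) (e u a) (f j v) (f v b)) =
       (\<Oplus>\<^bsub>?S\<^esub>v\<in>{1..n}. ?B (tens K C D (e i u) (f j v)) (tens K C D (e u a) (f v b)))" .
  qed
  finally show "(\<sigma> \<otimes>\<^bsub>convolution_algebra K (tensor_coalg K C D)\<^esub> \<tau>) (tens K C D (e i a) (f j b)) =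
      (\<Oplus>\<^bsub>K\<^esub>u\<in>{1..n}. \<Oplus>\<^bsub>K\<^esub>v\<in>{1..n}. \<sigma> (tens K C D (e i u) (f j v)) \<otimes>\<^bsub>K\<^esub> \<tau> (tens K C D (e u a) (f v b)))"
    unfolding conv by (simp only: restrict_apply' te finsum_self_module)
qed

text \<open>The unit of convolution is the product of the counits, whose values on matrix elements
  form the identity matrix; a spanning set decides equality.\<close>

lemma convolution_eq_oneI:
  assumes "matrix_coalgebra K C n e" "matrix_coalgebra K D n f"
    and \<sigma>: "\<sigma> \<in> lin_hom K (tensor K C D) (self_module K)"
    and eq: "\<And>i j a b. i \<in> {1..n} \<Longrightarrow> j \<in> {1..n} \<Longrightarrow> a \<in> {1..n} \<Longrightarrow> b \<in> {1..n} \<Longrightarrow>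
      \<sigma> (tens K C D (e i a) (f j b)) = (if i = a \<and> j = b then \<one>\<^bsub>K\<^esub> else \<zero>\<^bsub>K\<^esub>)"
  shows "\<sigma> = \<one>\<^bsub>convolution_algebra K (tensor_coalg K C D)\<^esub>"
proof -
  interpret C: matrix_coalgebra K C n e by fact
  interpret D: matrix_coalgebra K D n f by fact
  interpret cring K by (rule C.K_cring)
  let ?T = "tensor K C D"
  let ?S = "self_module K"
  let ?\<epsilon> = "tens_lift K C D ?S (\<lambda>c d. counit C c \<otimes>\<^bsub>K\<^esub> counit D d)"
  have T: "module K ?T" by (rule module_tensor[OF C.C D.C])
  note S = C.K_self
  have b: "bilinear K C D ?S (\<lambda>c d. counit C c \<otimes>\<^bsub>K\<^esub> counit D d)"
    by (intro bilinearI linear_map_mult_left linear_map_mult_right C.K_cring C.counit_linear D.counit_linear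
        C.counit_closed D.counit_closed)
  have one: "\<one>\<^bsub>convolution_algebra K (tensor_coalg K C D)\<^esub> = restrict ?\<epsilon> (carrier ?T)"
    by (simp only: convolution_algebra_def tensor_coalg_def Let_def extend_simps monoid.simps coalg_fields_simps)
  have \<epsilon>: "restrict ?\<epsilon> (carrier ?T) \<in> lin_hom K ?T ?S"
    by (rule restrict_in_lin_hom[OF T linear_map_tens_lift[OF C.C D.C S b]])
  have gen: "\<sigma> (tens K C D (e i a) (f j b)) = restrict ?\<epsilon> (carrier ?T) (tens K C D (e i a) (f j b))"
    if i: "i \<in> {1..n}" "a \<in> {1..n}" "j \<in> {1..n}" "b \<in> {1..n}" for i a j b
  proof -
    have "?\<epsilon> (tens K C D (e i a) (f j b)) = counit C (e i a) \<otimes>\<^bsub>K\<^esub> counit D (f j b)"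
      by (rule tens_lift_tens[OF C.C D.C S b C.e_closed[OF i(1,2)] D.e_closed[OF i(3,4)]])
    moreover have "tens K C D (e i a) (f j b) \<in> carrier ?T"
      by (intro tens_closed C.C D.C C.e_closed D.e_closed i)
    ultimately show ?thesis
      using eq[OF i(1,3,2,4)] by (simp add: C.counit_e[OF i(1,2)] D.counit_e[OF i(3,4)])
  qed
  show ?thesis unfolding one
  proof (rule lin_hom_eqI[OF \<sigma> \<epsilon>])
    show "\<sigma> t = restrict ?\<epsilon> (carrier ?T) t" if "t \<in> carrier ?T" for t
      by (rule tensor_eq_on_lspan[OF C.C D.C C.e_span C.e_subset D.e_span D.e_subset S
          lin_homD[OF \<sigma>] lin_homD[OF \<epsilon>] _ that])
        (use gen in auto)
  qed
qed

lemma convolution_UnitsI: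
  assumes "matrix_coalgebra K C n e" "matrix_coalgebra K D n f"
    and \<sigma>: "\<sigma> \<in> lin_hom K (tensor K C D) (self_module K)"
    and \<tau>: "\<tau> \<in> lin_hom K (tensor K C D) (self_module K)"
    and eq: "\<And>i j a b. i \<in> {1..n} \<Longrightarrow> j \<in> {1..n} \<Longrightarrow> a \<in> {1..n} \<Longrightarrow> b \<in> {1..n} \<Longrightarrow>
      (\<Oplus>\<^bsub>K\<^esub>u\<in>{1..n}. \<Oplus>\<^bsub>K\<^esub>v\<in>{1..n}. \<sigma> (tens K C D (e i u) (f j v)) \<otimes>\<^bsub>K\<^esub> \<tau> (tens K C D (e u a) (f v b)))
        = (if i = a \<and> j = b then \<one>\<^bsub>K\<^esub> else \<zero>\<^bsub>K\<^esub>)"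
    "\<And>i j a b. i \<in> {1..n} \<Longrightarrow> j \<in> {1..n} \<Longrightarrow> a \<in> {1..n} \<Longrightarrow> b \<in> {1..n} \<Longrightarrow>
      (\<Oplus>\<^bsub>K\<^esub>u\<in>{1..n}. \<Oplus>\<^bsub>K\<^esub>v\<in>{1..n}. \<tau> (tens K C D (e i u) (f j v)) \<otimes>\<^bsub>K\<^esub> \<sigma> (tens K C D (e u a) (f v b)))
        = (if i = a \<and> j = b then \<one>\<^bsub>K\<^esub> else \<zero>\<^bsub>K\<^esub>)"
  shows "\<sigma> \<in> Units (convolution_algebra K (tensor_coalg K C D))"
proof -
  let ?A = "convolution_algebra K (tensor_coalg K C D)"
  have car: "carrier ?A = lin_hom K (tensor K C D) (self_module K)"
    by (simp add: convolution_algebra_def tensor_coalg_def Let_def)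
  note m = convolution_mult[OF assms(1,2)] and one = convolution_eq_oneI[OF assms(1,2)]
  have "\<sigma> \<otimes>\<^bsub>?A\<^esub> \<tau> = \<one>\<^bsub>?A\<^esub>"
    by (rule one[OF m(1)[OF \<sigma> \<tau>]], subst m(2)[OF \<sigma> \<tau>], assumption+, rule eq(1), assumption+)
  moreover have "\<tau> \<otimes>\<^bsub>?A\<^esub> \<sigma> = \<one>\<^bsub>?A\<^esub>"
    by (rule one[OF m(1)[OF \<tau> \<sigma>]], subst m(2)[OF \<tau> \<sigma>], assumption+, rule eq(2), assumption+)
  ultimately show ?thesis using \<sigma> \<tau> unfolding Units_def car by blast
qed

section \<open>Solutions of the D-equation\<close>

text \<open>\<open>basis_coaction\<close> is a definite description. Linear extension from the basis
  gives existence; uniqueness holds because a linear map is fixed by its values on a basis and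
  members of \<open>lin_hom\<close> are extensional.\<close>

lemma basis_coaction_props:
  assumes "module K M" "is_basis K M n m"
  shows "linear_map K M (tensor K M (comatrix K n)) (basis_coaction K M n m)"
    and "l \<in> {1..n} \<Longrightarrow> basis_coaction K M n m (m l) = (\<Oplus>\<^bsub>tensor K M (comatrix K n)\<^esub>v\<in>{1..n}.
          tens K M (comatrix K n) (m v) (free_gen K (v, l)))"
proof -
  interpret based_module K M n m by (rule based_module.intro) fact+
  interpret matrix_coalgebra K "comatrix K n" n "\<lambda>i j. free_gen K (i, j)"
    by (rule matrix_coalgebra_comatrix[OF cring])
  let ?U = "tensor K M (comatrix K n)"
  let ?\<phi> = "\<lambda>l. \<Oplus>\<^bsub>?U\<^esub>v\<in>{1..n}. tens K M (comatrix K n) (m v) (free_gen K (v, l))"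
  have U: "module K ?U" by (rule module_tensor[OF is_module C])
  have \<phi>: "?\<phi> l \<in> carrier ?U" if "l \<in> {1..n}" for l
    by (intro module_finsum_closed[OF U] tens_closed is_module C basis_closed e_closed that)
  let ?f = "restrict (basis_ext ?U ?\<phi>) (carrier M)"
  let ?P = "\<lambda>\<rho>. \<rho> \<in> lin_hom K M ?U \<and> (\<forall>l\<in>{1..n}. \<rho> (m l) = ?\<phi> l)"
  have f: "?f \<in> lin_hom K M ?U"
    by (rule restrict_in_lin_hom[OF is_module linear_basis_ext[OF U \<phi>]])
  have fm: "?f (m l) = ?\<phi> l" if "l \<in> {1..n}" for l
    unfolding restrict_apply'[OF basis_closed[OF that]] by (rule basis_ext_basis[OF U \<phi> that])
  have uniq: "\<rho> = ?f" if \<rho>: "?P \<rho>" for \<rho>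
  proof (rule lin_hom_eqI[OF conjunct1[OF \<rho>] f])
    show "\<rho> x = ?f x" if "x \<in> carrier M" for x
      by (rule linear_eq_on_basis[OF U lin_homD[OF conjunct1[OF \<rho>]] lin_homD[OF f] _ that])
        (simp only: fm bspec[OF conjunct2[OF \<rho>]])
  qed
  have "?P ?f" using f fm by blast
  then have "?P (THE \<rho>. ?P \<rho>)" by (rule theI[where P = ?P and a = ?f]) (rule uniq)
  then have "?P (basis_coaction K M n m)" unfolding basis_coaction_def .
  then show "linear_map K M ?U (basis_coaction K M n m)"
    "l \<in> {1..n} \<Longrightarrow> basis_coaction K M n m (m l) = ?\<phi> l"
    using lin_homD by blast+
qed

locale D_solution = based_module K M n m
  for K :: "('k, 'x) ring_scheme" and M :: "('k, 'm, 'y) module_scheme" and n m +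
  fixes R :: "('k, 'm, 'm) tens \<Rightarrow> ('k, 'm, 'm) tens"
  assumes R: "R \<in> lin_hom K (tensor K M M) (tensor K M M)"
    and D_eq: "D_equation K M R"
begin

abbreviation "F \<equiv> comatrix K n"
abbreviation c :: "nat \<Rightarrow> nat \<Rightarrow> nat \<times> nat \<Rightarrow> 'k" where "c i j \<equiv> free_gen K (i, j)"
abbreviation "r \<equiv> mat R"

sublocale F: matrix_coalgebra K F n "\<lambda>i j. free_gen K (i, j)"
  by (rule matrix_coalgebra_comatrix[OF cring])

lemma R_linear: "linear_map K MM MM R"
  by (rule lin_homD[OF R])

lemma r_closed: "i \<in> N \<Longrightarrow> j \<in> N \<Longrightarrow> a \<in> N \<Longrightarrow> b \<in> N \<Longrightarrow> r i j a b \<in> carrier K"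
  by (rule mat_closed[OF R_linear])

text \<open>The D-condition for a form with \<open>\<sigma>(c\<^sub>i\<^sub>a \<otimes> c\<^sub>j\<^sub>b) = r i j a b\<close> says that the classes of
  the following elements vanish.\<close>

definition obstr :: "nat \<Rightarrow> nat \<Rightarrow> nat \<Rightarrow> nat \<Rightarrow> nat \<times> nat \<Rightarrow> 'k" where
  "obstr i j a b = (\<Oplus>\<^bsub>F\<^esub>u\<in>N. r i j u b \<odot>\<^bsub>F\<^esub> c u a) \<ominus>\<^bsub>F\<^esub> (\<Oplus>\<^bsub>F\<^esub>u\<in>N. r u j a b \<odot>\<^bsub>F\<^esub> c i u)"

definition obstrs :: "(nat \<times> nat \<Rightarrow> 'k) set" where
  "obstrs = {obstr i j a b | i j a b. i \<in> N \<and> j \<in> N \<and> a \<in> N \<and> b \<in> N}"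

definition "I = lspan K F obstrs"

context
  fixes i j a b assumes ij: "i \<in> N" "j \<in> N" "a \<in> N" "b \<in> N"
begin

lemma obstr_terms:
  "u \<in> N \<Longrightarrow> r i j u b \<odot>\<^bsub>F\<^esub> c u a \<in> carrier F"
  "u \<in> N \<Longrightarrow> r u j a b \<odot>\<^bsub>F\<^esub> c i u \<in> carrier F"
proof -
  interpret M: module K F by (rule F.C)
  show "u \<in> N \<Longrightarrow> r i j u b \<odot>\<^bsub>F\<^esub> c u a \<in> carrier F" "u \<in> N \<Longrightarrow> r u j a b \<odot>\<^bsub>F\<^esub> c i u \<in> carrier F"
    by (intro M.smult_closed F.e_closed r_closed ij; assumption)+
qed

lemma obstr_closed: "obstr i j a b \<in> carrier F"
proof -
  interpret M: module K F by (rule F.C)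
  show ?thesis unfolding obstr_def
    by (intro M.M.minus_closed module_finsum_closed[OF F.C] obstr_terms)
qed

text \<open>One formula for all uses of a generator: \<open>f\<close> is instantiated with the
  counit, the comultiplication, tensoring with a fixed matrix element, the projection to the
  quotient, and a form with one argument fixed.\<close>

lemma linear_obstr:
  assumes "module K U" "linear_map K F U f"
  shows "f (obstr i j a b) = (\<Oplus>\<^bsub>U\<^esub>u\<in>N. r i j u b \<odot>\<^bsub>U\<^esub> f (c u a)) \<ominus>\<^bsub>U\<^esub> (\<Oplus>\<^bsub>U\<^esub>u\<in>N. r u j a b \<odot>\<^bsub>U\<^esub> f (c i u))"
proof -
  interpret U: module K U by fact
  have fc: "f (c u v) \<in> carrier U" if "u \<in> N" "v \<in> N" for u v
    by (rule linear_map_closed[OF assms(2) F.e_closed[OF that]])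
  note fin = linear_map_finsum[OF assms(2) F.C assms(1) finite_atLeastAtMost]
  have "f (\<Oplus>\<^bsub>F\<^esub>u\<in>N. r i j u b \<odot>\<^bsub>F\<^esub> c u a) = (\<Oplus>\<^bsub>U\<^esub>u\<in>N. f (r i j u b \<odot>\<^bsub>F\<^esub> c u a))"
    by (rule fin[OF obstr_terms(1)])
  also have "\<dots> = (\<Oplus>\<^bsub>U\<^esub>u\<in>N. r i j u b \<odot>\<^bsub>U\<^esub> f (c u a))"
    by (rule module_finsum_cong[OF assms(1)])
      (intro U.smult_closed fc linear_map_smult[OF assms(2)] F.e_closed r_closed ij; assumption)+
  finally have 1: "f (\<Oplus>\<^bsub>F\<^esub>u\<in>N. r i j u b \<odot>\<^bsub>F\<^esub> c u a) = (\<Oplus>\<^bsub>U\<^esub>u\<in>N. r i j u b \<odot>\<^bsub>U\<^esub> f (c u a))" .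
  have "f (\<Oplus>\<^bsub>F\<^esub>u\<in>N. r u j a b \<odot>\<^bsub>F\<^esub> c i u) = (\<Oplus>\<^bsub>U\<^esub>u\<in>N. f (r u j a b \<odot>\<^bsub>F\<^esub> c i u))"
    by (rule fin[OF obstr_terms(2)])
  also have "\<dots> = (\<Oplus>\<^bsub>U\<^esub>u\<in>N. r u j a b \<odot>\<^bsub>U\<^esub> f (c i u))"
    by (rule module_finsum_cong[OF assms(1)])
      (intro U.smult_closed fc linear_map_smult[OF assms(2)] F.e_closed r_closed ij; assumption)+
  finally have 2: "f (\<Oplus>\<^bsub>F\<^esub>u\<in>N. r u j a b \<odot>\<^bsub>F\<^esub> c i u) = (\<Oplus>\<^bsub>U\<^esub>u\<in>N. r u j a b \<odot>\<^bsub>U\<^esub> f (c i u))" .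
  show ?thesis
    unfolding obstr_def 1[symmetric] 2[symmetric]
    by (rule linear_map_minus[OF assms(2) F.C assms(1)]) (intro module_finsum_closed[OF F.C] obstr_terms; assumption)+
qed

end

lemma obstrs_subset: "obstrs \<subseteq> carrier F"
  unfolding obstrs_def using obstr_closed by blast

lemma submodule_I: "submodule I K F"
  unfolding I_def by (rule submodule_lspan[OF F.C obstrs_subset])

lemma obstr_in_I: "i \<in> N \<Longrightarrow> j \<in> N \<Longrightarrow> a \<in> N \<Longrightarrow> b \<in> N \<Longrightarrow> obstr i j a b \<in> I"
  unfolding I_def by (rule subsetD[OF lspan_base]) (unfold obstrs_def, blast)

text \<open>The preimage of \<open>L\<close> under \<open>f\<close> is a submodule containing the
  generators, hence all of \<open>I\<close>. With \<open>L\<close> zero this proves vanishing on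
  \<open>I\<close>.\<close>

lemma I_induct:
  assumes "module K U" "linear_map K F U f" "submodule L K U"
    "\<And>i j a b. i \<in> N \<Longrightarrow> j \<in> N \<Longrightarrow> a \<in> N \<Longrightarrow> b \<in> N \<Longrightarrow> f (obstr i j a b) \<in> L" "x \<in> I"
  shows "f x \<in> L"
proof -
  have "obstrs \<subseteq> {x \<in> carrier F. f x \<in> L}"
    using obstrs_subset assms(4) unfolding obstrs_def by blast
  then have "I \<subseteq> {x \<in> carrier F. f x \<in> L}"
    unfolding I_def by (rule lspan_least[OF submodule_preimage[OF F.C assms(1-3)]])
  then show ?thesis using assms(5) by blast
qed

text \<open>The counit keeps only u = a in the first sum and u = i in the second, and both then
  equal \<open>r i j a b\<close>.\<close>

lemma counit_obstr:
  assumes ij: "i \<in> N" "j \<in> N" "a \<in> N" "b \<in> N"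
  shows "counit F (obstr i j a b) = \<zero>\<^bsub>K\<^esub>"
proof -
  interpret cring K by (rule cring)
  interpret S: module K "KK" by (rule self)
  have 1: "(\<Oplus>\<^bsub>KK\<^esub>u\<in>N. r i j u b \<odot>\<^bsub>KK\<^esub> counit F (c u a)) = r i j a b"
    by (subst module_finsum_single[OF self _ ij(3)])
      (use ij in \<open>simp_all add: F.counit_e r_closed del: atLeastAtMost_iff\<close>)
  have 2: "(\<Oplus>\<^bsub>KK\<^esub>u\<in>N. r u j a b \<odot>\<^bsub>KK\<^esub> counit F (c i u)) = r i j a b"
    by (subst module_finsum_single[OF self _ ij(1)])
      (use ij in \<open>simp_all add: F.counit_e r_closed del: atLeastAtMost_iff\<close>)
  show ?thesis
    using S.M.r_neg[of "r i j a b"] r_closed[OF ij]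
    unfolding linear_obstr[OF ij self F.counit_linear] 1 2 a_minus_def by simp
qed

text \<open>A telescoping identity: the comultiplication is A - B, the first sum on the right is A -
  D and the second is D - B. Every summand on the right has a generator of \<open>I\<close> as one
  tensor factor, which is the coideal condition.\<close>

lemma comult_obstr:
  assumes ij: "i \<in> N" "j \<in> N" "a \<in> N" "b \<in> N"
  shows "comult F (obstr i j a b) = (\<Oplus>\<^bsub>F.CC\<^esub>v\<in>N. tens K F F (obstr i j v b) (c v a))
    \<oplus>\<^bsub>F.CC\<^esub> (\<Oplus>\<^bsub>F.CC\<^esub>w\<in>N. tens K F F (c i w) (obstr w j a b))"
proof -
  let ?T = "F.CC"
  interpret T: module K ?T by (rule F.CC)
  interpret M: module K F by (rule F.C)
  note fin = finite_atLeastAtMost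
  note t = bilinear_tens[OF F.C F.C]
  let ?t = "tens K F F"
  have tc: "?t (c p q) (c u v) \<in> carrier ?T" if "p \<in> N" "q \<in> N" "u \<in> N" "v \<in> N" for p q u v
    by (intro tens_closed F.C F.e_closed that)
  have sum: "x \<odot>\<^bsub>?T\<^esub> comult F (c p q) = (\<Oplus>\<^bsub>?T\<^esub>v\<in>N. x \<odot>\<^bsub>?T\<^esub> ?t (c p v) (c v q))"
    if "x \<in> carrier K" "p \<in> N" "q \<in> N" for x p q
    unfolding F.comult_e[OF that(2,3)] using tc that by (intro T.finsum_smult_ldistr) auto
  define A where "A = (\<Oplus>\<^bsub>?T\<^esub>u\<in>N. \<Oplus>\<^bsub>?T\<^esub>v\<in>N. r i j u b \<odot>\<^bsub>?T\<^esub> ?t (c u v) (c v a))"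
  define B where "B = (\<Oplus>\<^bsub>?T\<^esub>u\<in>N. \<Oplus>\<^bsub>?T\<^esub>w\<in>N. r u j a b \<odot>\<^bsub>?T\<^esub> ?t (c i w) (c w u))"
  \<comment> \<open>The mixed sum that cancels: it comes from the second half of
    \<open>obstr i j v b\<close> and from the first half of \<open>obstr w j a b\<close>.\<close>
  define D where "D = (\<Oplus>\<^bsub>?T\<^esub>v\<in>N. \<Oplus>\<^bsub>?T\<^esub>u\<in>N. r u j v b \<odot>\<^bsub>?T\<^esub> ?t (c i u) (c v a))"
  have Ac: "r i j u b \<odot>\<^bsub>?T\<^esub> ?t (c u v) (c v a) \<in> carrier ?T" if "u \<in> N" "v \<in> N" for u v
    by (intro T.smult_closed tc r_closed ij that)
  have Bc: "r u j a b \<odot>\<^bsub>?T\<^esub> ?t (c i w) (c w u) \<in> carrier ?T" if "u \<in> N" "w \<in> N" for u w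
    by (intro T.smult_closed tc r_closed ij that)
  have Dc: "r u j v b \<odot>\<^bsub>?T\<^esub> ?t (c i u) (c v a) \<in> carrier ?T" if "v \<in> N" "u \<in> N" for v u
    by (intro T.smult_closed tc r_closed ij that)
  note cl = module_finsum_closed[OF F.CC]
  have ABD: "A \<in> carrier ?T" "B \<in> carrier ?T" "D \<in> carrier ?T"
    unfolding A_def B_def D_def by (intro cl Ac Bc Dc; assumption)+
  have lhs: "comult F (obstr i j a b) = A \<ominus>\<^bsub>?T\<^esub> B"
  proof -
    have "(\<Oplus>\<^bsub>?T\<^esub>u\<in>N. r i j u b \<odot>\<^bsub>?T\<^esub> comult F (c u a)) = A" unfolding A_def
      by (rule module_finsum_cong[OF F.CC]) (intro cl Ac sum r_closed ij; assumption)+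
    moreover have "(\<Oplus>\<^bsub>?T\<^esub>u\<in>N. r u j a b \<odot>\<^bsub>?T\<^esub> comult F (c i u)) = B" unfolding B_def
      by (rule module_finsum_cong[OF F.CC]) (intro cl Bc sum r_closed ij; assumption)+
    ultimately show ?thesis unfolding linear_obstr[OF ij F.CC F.comult_linear] by (simp only:)
  qed
  have "(\<Oplus>\<^bsub>?T\<^esub>v\<in>N. ?t (obstr i j v b) (c v a)) = (\<Oplus>\<^bsub>?T\<^esub>v\<in>N.
      (\<Oplus>\<^bsub>?T\<^esub>u\<in>N. r i j u b \<odot>\<^bsub>?T\<^esub> ?t (c u v) (c v a)) \<ominus>\<^bsub>?T\<^esub> (\<Oplus>\<^bsub>?T\<^esub>u\<in>N. r u j v b \<odot>\<^bsub>?T\<^esub> ?t (c i u) (c v a)))"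
  proof (rule module_finsum_cong[OF F.CC])
    fix v assume v: "v \<in> N"
    show "?t (obstr i j v b) (c v a) = (\<Oplus>\<^bsub>?T\<^esub>u\<in>N. r i j u b \<odot>\<^bsub>?T\<^esub> ?t (c u v) (c v a))
        \<ominus>\<^bsub>?T\<^esub> (\<Oplus>\<^bsub>?T\<^esub>u\<in>N. r u j v b \<odot>\<^bsub>?T\<^esub> ?t (c i u) (c v a))"
      by (rule linear_obstr[OF ij(1,2) v ij(4) F.CC bilinear_left[OF t F.e_closed[OF v ij(3)]]])
    show "(\<Oplus>\<^bsub>?T\<^esub>u\<in>N. r i j u b \<odot>\<^bsub>?T\<^esub> ?t (c u v) (c v a))
        \<ominus>\<^bsub>?T\<^esub> (\<Oplus>\<^bsub>?T\<^esub>u\<in>N. r u j v b \<odot>\<^bsub>?T\<^esub> ?t (c i u) (c v a)) \<in> carrier ?T"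
      by (intro T.M.minus_closed cl Ac Dc v; assumption)
  qed
  also have "\<dots> = (\<Oplus>\<^bsub>?T\<^esub>v\<in>N. \<Oplus>\<^bsub>?T\<^esub>u\<in>N. r i j u b \<odot>\<^bsub>?T\<^esub> ?t (c u v) (c v a)) \<ominus>\<^bsub>?T\<^esub> D"
    unfolding D_def by (rule module_finsum_minus[OF F.CC fin]) (intro cl Ac Dc; assumption)+
  also have "(\<Oplus>\<^bsub>?T\<^esub>v\<in>N. \<Oplus>\<^bsub>?T\<^esub>u\<in>N. r i j u b \<odot>\<^bsub>?T\<^esub> ?t (c u v) (c v a)) = A"
    unfolding A_def by (rule module_finsum_swap[OF F.CC fin fin Ac])
  finally have 1: "(\<Oplus>\<^bsub>?T\<^esub>v\<in>N. ?t (obstr i j v b) (c v a)) = A \<ominus>\<^bsub>?T\<^esub> D" .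
  have "(\<Oplus>\<^bsub>?T\<^esub>w\<in>N. ?t (c i w) (obstr w j a b)) = (\<Oplus>\<^bsub>?T\<^esub>w\<in>N.
      (\<Oplus>\<^bsub>?T\<^esub>v\<in>N. r w j v b \<odot>\<^bsub>?T\<^esub> ?t (c i w) (c v a)) \<ominus>\<^bsub>?T\<^esub> (\<Oplus>\<^bsub>?T\<^esub>u\<in>N. r u j a b \<odot>\<^bsub>?T\<^esub> ?t (c i w) (c w u)))"
  proof (rule module_finsum_cong[OF F.CC])
    fix w assume w: "w \<in> N"
    show "?t (c i w) (obstr w j a b) = (\<Oplus>\<^bsub>?T\<^esub>v\<in>N. r w j v b \<odot>\<^bsub>?T\<^esub> ?t (c i w) (c v a))
        \<ominus>\<^bsub>?T\<^esub> (\<Oplus>\<^bsub>?T\<^esub>u\<in>N. r u j a b \<odot>\<^bsub>?T\<^esub> ?t (c i w) (c w u))"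
      by (rule linear_obstr[OF w ij(2-4) F.CC bilinear_right[OF t F.e_closed[OF ij(1) w]]])
    show "(\<Oplus>\<^bsub>?T\<^esub>v\<in>N. r w j v b \<odot>\<^bsub>?T\<^esub> ?t (c i w) (c v a))
        \<ominus>\<^bsub>?T\<^esub> (\<Oplus>\<^bsub>?T\<^esub>u\<in>N. r u j a b \<odot>\<^bsub>?T\<^esub> ?t (c i w) (c w u)) \<in> carrier ?T"
      by (intro T.M.minus_closed cl Bc Dc w; assumption)
  qed
  also have "\<dots> = (\<Oplus>\<^bsub>?T\<^esub>w\<in>N. \<Oplus>\<^bsub>?T\<^esub>v\<in>N. r w j v b \<odot>\<^bsub>?T\<^esub> ?t (c i w) (c v a))
      \<ominus>\<^bsub>?T\<^esub> (\<Oplus>\<^bsub>?T\<^esub>w\<in>N. \<Oplus>\<^bsub>?T\<^esub>u\<in>N. r u j a b \<odot>\<^bsub>?T\<^esub> ?t (c i w) (c w u))"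
    by (rule module_finsum_minus[OF F.CC fin]) (intro cl Bc Dc; assumption)+
  also have "(\<Oplus>\<^bsub>?T\<^esub>w\<in>N. \<Oplus>\<^bsub>?T\<^esub>v\<in>N. r w j v b \<odot>\<^bsub>?T\<^esub> ?t (c i w) (c v a)) = D"
    unfolding D_def by (rule module_finsum_swap[OF F.CC fin fin Dc])
  also have "(\<Oplus>\<^bsub>?T\<^esub>w\<in>N. \<Oplus>\<^bsub>?T\<^esub>u\<in>N. r u j a b \<odot>\<^bsub>?T\<^esub> ?t (c i w) (c w u)) = B"
    unfolding B_def by (rule module_finsum_swap[OF F.CC fin fin Bc])
  finally have 2: "(\<Oplus>\<^bsub>?T\<^esub>w\<in>N. ?t (c i w) (obstr w j a b)) = D \<ominus>\<^bsub>?T\<^esub> B" .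
  have "(A \<ominus>\<^bsub>?T\<^esub> D) \<oplus>\<^bsub>?T\<^esub> (D \<ominus>\<^bsub>?T\<^esub> B) = A \<ominus>\<^bsub>?T\<^esub> B"
  proof -
    have "(A \<ominus>\<^bsub>?T\<^esub> D) \<oplus>\<^bsub>?T\<^esub> (D \<ominus>\<^bsub>?T\<^esub> B) = A \<oplus>\<^bsub>?T\<^esub> ((\<ominus>\<^bsub>?T\<^esub> D \<oplus>\<^bsub>?T\<^esub> D) \<ominus>\<^bsub>?T\<^esub> B)"
      using ABD by (simp only: a_minus_def T.M.a_assoc T.M.a_closed T.M.a_inv_closed)
    then show ?thesis using ABD by (simp add: a_minus_def T.M.l_neg)
  qed
  then show ?thesis unfolding lhs 1 2 by (rule sym)
qed

lemma coideal_I: "coideal K F I"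
  unfolding coideal_def
proof (intro conjI submodule_I ballI image_subsetI)
  let ?G = "{tens K F F x c | x c. x \<in> I \<and> c \<in> carrier F} \<union> {tens K F F c x | x c. x \<in> I \<and> c \<in> carrier F}"
  have IF: "x \<in> carrier F" if "x \<in> I" for x
    using module.submoduleE(1)[OF F.C submodule_I] that by (rule subsetD)
  have "?G \<subseteq> carrier F.CC"
    by (intro Un_least subsetI; elim CollectE exE conjE; hypsubst)
      (rule tens_closed[OF F.C F.C IF] tens_closed[OF F.C F.C _ IF]; assumption)+
  then have L: "submodule (lspan K F.CC ?G) K F.CC" by (rule submodule_lspan[OF F.CC])
  have gl: "tens K F F x y \<in> lspan K F.CC ?G" if "x \<in> I" "y \<in> carrier F" for x y
    by (rule subsetD[OF lspan_base]) (use that in blast)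
  have gr: "tens K F F y x \<in> lspan K F.CC ?G" if "x \<in> I" "y \<in> carrier F" for x y
    by (rule subsetD[OF lspan_base]) (use that in blast)
  fix x assume x: "x \<in> I"
  show "comult F x \<in> lspan K F.CC ?G"
  proof (rule I_induct[OF F.CC F.comult_linear L _ x])
    fix i j a b assume ij: "i \<in> N" "j \<in> N" "a \<in> N" "b \<in> N"
    show "comult F (obstr i j a b) \<in> lspan K F.CC ?G"
      unfolding comult_obstr[OF ij]
      by (intro module.submoduleE(5)[OF F.CC L] submodule_finsum[OF F.CC L finite_atLeastAtMost]
        gl gr obstr_in_I F.e_closed ij; assumption)
  qed
  have "counit F x \<in> {\<zero>\<^bsub>KK\<^esub>}"
    by (rule I_induct[OF self F.counit_linear submodule_zero[OF self] _ x]) (simp add: counit_obstr)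
  then show "counit F x = \<zero>\<^bsub>K\<^esub>" by simp
qed

section \<open>The quotient coalgebra and forms that descend to it\<close>

abbreviation "Q \<equiv> quot_coalg K F I"
abbreviation "p \<equiv> \<lambda>x. I +>\<^bsub>F\<^esub> x"

sublocale Q: matrix_coalgebra K Q n "\<lambda>i j. p (free_gen K (i, j))"
  by (rule matrix_coalgebra_quot[OF F.matrix_coalgebra_axioms coideal_I])

lemma Q_simps: "carrier Q = carrier (quot_mod K F I)" "tensor K V Q = tensor K V (quot_mod K F I)"
  "tensor K Q V = tensor K (quot_mod K F I) V" "tens K V Q = tens K V (quot_mod K F I)"
  "linear_map K V Q f = linear_map K V (quot_mod K F I) f"
  "linear_map K Q V g = linear_map K (quot_mod K F I) V g"
  "zero Q = zero (quot_mod K F I)"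
  by (simp_all add: quot_coalg_def Let_def del: quot_mod_simps)

lemma p_linear: "linear_map K F Q p"
  unfolding Q_simps by (rule linear_map_coset[OF F.C submodule_I])

lemma p_surj: "p ` carrier F = carrier Q"
  unfolding Q_simps by (auto simp: A_RCOSETS_def RCOSETS_def a_r_coset_def)

text \<open>The class of \<open>obstr i j a b\<close> is zero, and its two halves are separated.
  This is the D-condition on matrix elements for a form with values \<open>r\<close>.\<close>

lemma p_obstr:
  assumes ij: "i \<in> N" "j \<in> N" "a \<in> N" "b \<in> N"
  shows "(\<Oplus>\<^bsub>Q\<^esub>u\<in>N. r i j u b \<odot>\<^bsub>Q\<^esub> p (c u a)) = (\<Oplus>\<^bsub>Q\<^esub>u\<in>N. r u j a b \<odot>\<^bsub>Q\<^esub> p (c i u))" (is "?x = ?y")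
proof -
  interpret Q': module K Q by (rule Q.C)
  have xy: "?x \<in> carrier Q" "?y \<in> carrier Q"
    by (intro module_finsum_closed[OF Q.C] Q'.smult_closed r_closed Q.e_closed ij; assumption)+
  have "p (obstr i j a b) = \<zero>\<^bsub>Q\<^esub>"
    unfolding Q_simps using coset_eq_zero_iff[OF F.C submodule_I obstr_closed[OF ij]] obstr_in_I[OF ij] by (rule iffD2)
  then have "?x \<ominus>\<^bsub>Q\<^esub> ?y = \<zero>\<^bsub>Q\<^esub>"
    unfolding linear_obstr[OF ij Q.C p_linear] .
  moreover have "?x = (?x \<ominus>\<^bsub>Q\<^esub> ?y) \<oplus>\<^bsub>Q\<^esub> ?y"
    using xy by (simp add: a_minus_def Q'.M.a_assoc Q'.M.l_neg)
  ultimately show ?thesis using xy by simp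
qed

text \<open>The operator \<open>A\<close> supplies the values, while \<open>I\<close> comes from
  \<open>R\<close>; vanishing on \<open>I\<close> in the second argument is the commutation of A^12
  with R^23, entry by entry. It is applied with A = R for \<sigma> and with A = S, the inverse of R,
  for the convolution inverse.\<close>

lemma form_exists:
  assumes A: "linear_map K MM MM A"
    and comm: "\<And>t. t \<in> carrier MtMM \<Longrightarrow> op12 K M A (op23 K M R t) = op23 K M R (op12 K M A t)"
  obtains s where "bilinear K F Q (KK) s"
    "\<And>i j a b. i \<in> N \<Longrightarrow> j \<in> N \<Longrightarrow> a \<in> N \<Longrightarrow> b \<in> N \<Longrightarrow> s (c i a) (p (c j b)) = mat A i j a b"
proof -
  interpret cring K by (rule cring)
  interpret S: module K "KK" by (rule self)
  obtain s where s: "bilinear K (free_mod K (N \<times> N)) (free_mod K (N \<times> N)) (KK) s"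
    "\<And>x y. x \<in> N \<times> N \<Longrightarrow> y \<in> N \<times> N \<Longrightarrow>
      s (free_gen K x) (free_gen K y) = mat A (fst x) (fst y) (snd x) (snd y)"
    by (rule bilinear_form_on_free[OF cring, of "N \<times> N" "N \<times> N"
      "\<lambda>x y. mat A (fst x) (fst y) (snd x) (snd y)"]) (auto intro!: mat_closed[OF A] simp del: atLeastAtMost_iff)
  have b: "bilinear K F F (KK) s"
    using s(1) by (simp add: bilinear_def comatrix_def Let_def)
  have sc: "s (c i a) (c j b) = mat A i j a b" if "i \<in> N" "j \<in> N" "a \<in> N" "b \<in> N" for i j a b
    using s(2)[of "(i, a)" "(j, b)"] that by simp
  have sI: "s v w = \<zero>\<^bsub>KK\<^esub>" if v: "v \<in> carrier F" and w: "w \<in> I" for v w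
  proof -
    have "s v w \<in> {\<zero>\<^bsub>KK\<^esub>}"
    proof (rule I_induct[OF self bilinear_right[OF b v] submodule_zero[OF self] _ w])
      fix i j a b' assume ij: "i \<in> N" "j \<in> N" "a \<in> N" "b' \<in> N"
      have "s v (obstr i j a b') = \<zero>\<^bsub>KK\<^esub>"
      proof (rule F.eq_on_e[OF self bilinear_left[OF b obstr_closed[OF ij]] linear_map_zero_fun[OF self] _ v])
        fix q' q assume q: "q' \<in> N" "q \<in> N"
        have 1: "(\<Oplus>\<^bsub>KK\<^esub>u\<in>N. r i j u b' \<odot>\<^bsub>KK\<^esub> s (c q' q) (c u a)) =
          (\<Oplus>\<^bsub>KK\<^esub>u\<in>N. mat A q' u q a \<otimes>\<^bsub>K\<^esub> r i j u b')"
          by (rule module_finsum_cong[OF self])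
            (use ij q in \<open>simp_all add: sc r_closed mat_closed[OF A] m_comm del: atLeastAtMost_iff\<close>)
        have 2: "(\<Oplus>\<^bsub>KK\<^esub>u\<in>N. r u j a b' \<odot>\<^bsub>KK\<^esub> s (c q' q) (c i u)) =
          (\<Oplus>\<^bsub>KK\<^esub>u\<in>N. r u j a b' \<otimes>\<^bsub>K\<^esub> mat A q' i q u)"
          by (rule module_finsum_cong[OF self])
            (use ij q in \<open>simp_all add: sc r_closed mat_closed[OF A] del: atLeastAtMost_iff\<close>)
        \<comment> \<open>The commutation hypothesis enters here, at the entry with row (q', i, j)
          and column (q, a, b').\<close>
        have 3: "(\<Oplus>\<^bsub>KK\<^esub>u\<in>N. mat A q' u q a \<otimes>\<^bsub>K\<^esub> r i j u b') =
          (\<Oplus>\<^bsub>KK\<^esub>u\<in>N. r u j a b' \<otimes>\<^bsub>K\<^esub> mat A q' i q u)"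
          using mat_commute[OF A R_linear comm q(1) ij(1,2) q(2) ij(3,4)] by simp
        have "(\<Oplus>\<^bsub>KK\<^esub>u\<in>N. r u j a b' \<otimes>\<^bsub>K\<^esub> mat A q' i q u) \<in> carrier (KK)"
          by (rule module_finsum_closed[OF self])
            (use ij q in \<open>simp add: r_closed mat_closed[OF A] del: atLeastAtMost_iff\<close>)
        then show "s (c q' q) (obstr i j a b') = \<zero>\<^bsub>KK\<^esub>"
          unfolding linear_obstr[OF ij self bilinear_right[OF b F.e_closed[OF q]]] 1 2 3
          unfolding a_minus_def by (rule S.M.r_neg)
      qed
      then show "s v (obstr i j a b') \<in> {\<zero>\<^bsub>KK\<^esub>}" by simp
    qed
    then show ?thesis by simp
  qed
  have q1: "bilinear K F (quot_mod K F I) (KK) (\<lambda>v X. the_elem (s v ` X))"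
    by (rule bilinear_quot_right(1)[OF F.C F.C self b submodule_I]) (rule sI)
  have q2: "the_elem (s v ` p w) = s v w" if "v \<in> carrier F" "w \<in> carrier F" for v w
    by (rule bilinear_quot_right(2)[OF F.C F.C self b submodule_I _ that]) (rule sI)
  show ?thesis
  proof (rule that)
    show "bilinear K F Q (KK) (\<lambda>v X. the_elem (s v ` X))"
      using q1 by (simp add: bilinear_def Q_simps del: quot_mod_simps)
    show "the_elem (s (c i a) ` p (c j b)) = mat A i j a b" if "i \<in> N" "j \<in> N" "a \<in> N" "b \<in> N" for i j a b
      by (rule trans[OF q2[OF F.e_closed[OF that(1,3)] F.e_closed[OF that(2,4)]] sc[OF that]])
  qed
qed

lemma lift_form:
  assumes "bilinear K F Q (KK) s"
    "\<And>i j a b. i \<in> N \<Longrightarrow> j \<in> N \<Longrightarrow> a \<in> N \<Longrightarrow> b \<in> N \<Longrightarrow> s (c i a) (p (c j b)) = mat A i j a b"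
  shows "tens_lift K F Q (KK) s \<in> lin_hom K (tensor K F Q) (KK)"
    and "i \<in> N \<Longrightarrow> j \<in> N \<Longrightarrow> a \<in> N \<Longrightarrow> b \<in> N \<Longrightarrow>
      tens_lift K F Q (KK) s (tens K F Q (c i a) (p (c j b))) = mat A i j a b"
proof -
  show "tens_lift K F Q (KK) s \<in> lin_hom K (tensor K F Q) (KK)"
    by (rule tens_lift_lin_hom[OF F.C Q.C self assms(1)])
  assume ij: "i \<in> N" "j \<in> N" "a \<in> N" "b \<in> N"
  show "tens_lift K F Q (KK) s (tens K F Q (c i a) (p (c j b))) = mat A i j a b"
    by (rule trans[OF tens_lift_tens[OF F.C Q.C self assms(1) F.e_closed[OF ij(1,3)] Q.e_closed[OF ij(2,4)]] assms(2)[OF ij]])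
qed

lemma R_comm: "t \<in> carrier MtMM \<Longrightarrow> op12 K M R (op23 K M R t) = op23 K M R (op12 K M R t)"
  using D_eq unfolding D_equation_def by blast

text \<open>Linearity of the inverse follows by applying \<open>R\<close> to both sides. The
  commutation of S^12 with R^23 comes from the D-equation by conjugating with R^12, whose inverse is
  S^12.\<close>

lemma inverse_form_exists:
  assumes bij: "bij_betw R (carrier MM) (carrier MM)"
  obtains S where "linear_map K MM MM S"
    "\<And>t. t \<in> carrier MM \<Longrightarrow> S (R t) = t" "\<And>t. t \<in> carrier MM \<Longrightarrow> R (S t) = t"
    "\<And>t. t \<in> carrier MtMM \<Longrightarrow> op12 K M S (op23 K M R t) = op23 K M R (op12 K M S t)"
proof -
  interpret T: module K MM by (rule MM)
  let ?S = "inv_into (carrier MM) R"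
  have SR: "?S (R t) = t" if "t \<in> carrier MM" for t by (rule bij_betw_inv_into_left[OF bij that])
  have RS: "R (?S t) = t" if "t \<in> carrier MM" for t by (rule bij_betw_inv_into_right[OF bij that])
  have Sc: "?S t \<in> carrier MM" if "t \<in> carrier MM" for t
    using bij_betw_apply[OF bij_betw_inv_into[OF bij] that] .
  have lS: "linear_map K MM MM ?S"
  proof (rule linear_mapI[OF Sc])
    fix x y assume xy: "x \<in> carrier MM" "y \<in> carrier MM"
    have "R (?S x \<oplus>\<^bsub>MM\<^esub> ?S y) = x \<oplus>\<^bsub>MM\<^esub> y"
      unfolding linear_map_add[OF R_linear Sc[OF xy(1)] Sc[OF xy(2)]] RS[OF xy(1)] RS[OF xy(2)] ..
    then show "?S (x \<oplus>\<^bsub>MM\<^esub> y) = ?S x \<oplus>\<^bsub>MM\<^esub> ?S y"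
      using SR[OF T.M.a_closed[OF Sc[OF xy(1)] Sc[OF xy(2)]]] by (simp only:)
  next
    fix k x assume kx: "k \<in> carrier K" "x \<in> carrier MM"
    have "R (k \<odot>\<^bsub>MM\<^esub> ?S x) = k \<odot>\<^bsub>MM\<^esub> x"
      unfolding linear_map_smult[OF R_linear kx(1) Sc[OF kx(2)]] RS[OF kx(2)] ..
    then show "?S (k \<odot>\<^bsub>MM\<^esub> x) = k \<odot>\<^bsub>MM\<^esub> ?S x"
      using SR[OF T.smult_closed[OF kx(1) Sc[OF kx(2)]]] by (simp only:)
  qed
  note c23 = linear_map_closed[OF linear_op23[OF R_linear]] and c12 = linear_map_closed[OF linear_op12[OF lS]]
  have "op12 K M ?S (op23 K M R t) = op23 K M R (op12 K M ?S t)" if t: "t \<in> carrier MtMM" for t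
  proof -
    \<comment> \<open>Here \<open>t\<close> is written as R^12 S^12 t, so that R^12 can be moved
      past R^23 and cancelled against the outer S^12.\<close>
    have "op12 K M ?S (op23 K M R t) = op12 K M ?S (op23 K M R (op12 K M R (op12 K M ?S t)))"
      by (subst op12_comp[OF R_linear lS _ t]) (simp_all only: RS)
    also have "\<dots> = op12 K M ?S (op12 K M R (op23 K M R (op12 K M ?S t)))"
      unfolding R_comm[OF c12[OF t]] ..
    also have "\<dots> = op23 K M R (op12 K M ?S t)"
      by (rule op12_comp[OF lS R_linear _ c23[OF c12[OF t]]]) (rule SR)
    finally show ?thesis .
  qed
  with lS SR RS show ?thesis by (rule that)
qed

lemma mat_id:
  assumes "\<And>t. t \<in> carrier MM \<Longrightarrow> f t = t" "i \<in> N" "j \<in> N" "a \<in> N" "b \<in> N"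
  shows "mat f i j a b = (if i = a \<and> j = b then \<one>\<^bsub>K\<^esub> else \<zero>\<^bsub>K\<^esub>)"
  unfolding mat_def assms(1)[OF mm_closed[OF assms(4,5)]] by (rule tcoord_mm[OF assms(2-5)])

sublocale FM: matrix_comodule K M F n m "\<lambda>i j. free_gen K (i, j)" "basis_coaction K M n m"
  using basis_coaction_props[OF is_module basis] by unfold_locales

theorem comatrix_part:
  "\<exists>\<sigma>. D_map K F I \<sigma> \<and> R = R_of K F I M (basis_coaction K M n m) \<sigma> \<and>
    (\<forall>\<sigma>'. D_map K F I \<sigma>' \<and> R = R_of K F I M (basis_coaction K M n m) \<sigma>' \<longrightarrow> \<sigma>' = \<sigma>) \<and>
    (bij_betw R (carrier MM) (carrier MM) \<longrightarrow> \<sigma> \<in> Units (convolution_algebra K (tensor_coalg K F Q)))"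
proof -
  obtain s where s: "bilinear K F Q (KK) s"
    "\<And>i j a b. i \<in> N \<Longrightarrow> j \<in> N \<Longrightarrow> a \<in> N \<Longrightarrow> b \<in> N \<Longrightarrow> s (c i a) (p (c j b)) = r i j a b"
    by (rule form_exists[OF R_linear R_comm], assumption) (rule that)
  let ?\<sigma> = "tens_lift K F Q (KK) s"
  have \<sigma>1: "tens_lift K F Q (KK) s \<in> lin_hom K (tensor K F Q) (KK)"
    by (rule lift_form(1)[OF s(1)]) (rule s(2))
  have \<sigma>2: "tens_lift K F Q (KK) s (tens K F Q (c i a) (p (c j b))) = mat R i j a b"
    if "i \<in> N" "j \<in> N" "a \<in> N" "b \<in> N" for i j a b
    by (rule lift_form(2)[OF s(1) _ that]) (rule s(2))
  note \<sigma> = \<sigma>1 \<sigma>2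
  have D: "D_map K F I ?\<sigma>" unfolding D_map_def
  proof (rule F.D_conditionI[OF Q.C p_linear p_surj \<sigma>(1)])
    fix i j a b assume ij: "i \<in> N" "j \<in> N" "a \<in> N" "b \<in> N"
    have "(\<Oplus>\<^bsub>Q\<^esub>u\<in>N. ?\<sigma> (tens K F Q (c i u) (p (c j b))) \<odot>\<^bsub>Q\<^esub> p (c u a)) = (\<Oplus>\<^bsub>Q\<^esub>u\<in>N. r i j u b \<odot>\<^bsub>Q\<^esub> p (c u a))"
      by (rule module_finsum_cong[OF Q.C])
        (simp_all only: \<sigma>(2) ij module.smult_closed[OF Q.C] Q.e_closed r_closed)
    \<comment> \<open>The defining relations of \<open>I\<close> exchange the two sums in the
      quotient; the surrounding steps only replace values of the form by entries of
      \<open>R\<close>.\<close>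
    also note p_obstr[OF ij]
    also have "(\<Oplus>\<^bsub>Q\<^esub>u\<in>N. r u j a b \<odot>\<^bsub>Q\<^esub> p (c i u)) = (\<Oplus>\<^bsub>Q\<^esub>u\<in>N. ?\<sigma> (tens K F Q (c u a) (p (c j b))) \<odot>\<^bsub>Q\<^esub> p (c i u))"
      by (rule module_finsum_cong[OF Q.C])
        (simp_all only: \<sigma>(2) ij module.smult_closed[OF Q.C] Q.e_closed r_closed)
    finally show "(\<Oplus>\<^bsub>Q\<^esub>u\<in>N. ?\<sigma> (tens K F Q (c i u) (p (c j b))) \<odot>\<^bsub>Q\<^esub> p (c u a)) =
      (\<Oplus>\<^bsub>Q\<^esub>u\<in>N. ?\<sigma> (tens K F Q (c u a) (p (c j b))) \<odot>\<^bsub>Q\<^esub> p (c i u))" .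
  qed
  \<comment> \<open>Any competing D-map has the same values on a spanning set by this equivalence,
    and the constructed form satisfies the equation by its other direction.\<close>
  have iff: "R = R_of K F I M (basis_coaction K M n m) \<sigma>' \<longleftrightarrow>
      (\<forall>i\<in>N. \<forall>j\<in>N. \<forall>a\<in>N. \<forall>b\<in>N. \<sigma>' (tens K F Q (c i a) (p (c j b))) = r i j a b)"
    if "\<sigma>' \<in> lin_hom K (tensor K F Q) (KK)" for \<sigma>'
    unfolding R_of_def by (rule FM.eq_induced_op_iff[OF Q.C p_linear lin_homD[OF that] R])
  have "\<sigma>' = ?\<sigma>" if \<sigma>': "D_map K F I \<sigma>'" "R = R_of K F I M (basis_coaction K M n m) \<sigma>'" for \<sigma>'
  proof -
    have l: "\<sigma>' \<in> lin_hom K (tensor K F Q) (KK)"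
      using \<sigma>'(1) unfolding D_map_def D_condition_def by (rule conjunct1)
    note e = iffD1[OF iff[OF l] \<sigma>'(2), rule_format]
    show ?thesis
    proof (rule F.form_eqI[OF Q.C p_linear p_surj l \<sigma>(1)])
      fix i j a b assume ij: "i \<in> N" "j \<in> N" "a \<in> N" "b \<in> N"
      show "\<sigma>' (tens K F Q (c i a) (p (c j b))) = ?\<sigma> (tens K F Q (c i a) (p (c j b)))"
        by (rule trans[OF e[OF ij] \<sigma>(2)[OF ij, symmetric]])
    qed
  qed
  moreover have "?\<sigma> \<in> Units (convolution_algebra K (tensor_coalg K F Q))"
    if bij: "bij_betw R (carrier MM) (carrier MM)"
  proof -
    obtain S where S: "linear_map K MM MM S"
      "\<And>t. t \<in> carrier MM \<Longrightarrow> S (R t) = t" "\<And>t. t \<in> carrier MM \<Longrightarrow> R (S t) = t"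
      "\<And>t. t \<in> carrier MtMM \<Longrightarrow> op12 K M S (op23 K M R t) = op23 K M R (op12 K M S t)"
      using inverse_form_exists[OF bij] by blast
    \<comment> \<open>The candidate for the inverse: a form on the same quotient, with entries of
      \<open>S\<close>. That it descends is the commutation of S^12 with R^23.\<close>
    obtain s' where s': "bilinear K F Q (KK) s'"
      "\<And>i j a b. i \<in> N \<Longrightarrow> j \<in> N \<Longrightarrow> a \<in> N \<Longrightarrow> b \<in> N \<Longrightarrow> s' (c i a) (p (c j b)) = mat S i j a b"
      by (rule form_exists[OF S(1,4)], assumption) (rule that)
    have \<tau>1: "tens_lift K F Q (KK) s' \<in> lin_hom K (tensor K F Q) (KK)"
      by (rule lift_form(1)[OF s'(1)]) (rule s'(2))
    have \<tau>2: "tens_lift K F Q (KK) s' (tens K F Q (c i a) (p (c j b))) = mat S i j a b"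
      if "i \<in> N" "j \<in> N" "a \<in> N" "b \<in> N" for i j a b
      by (rule lift_form(2)[OF s'(1) _ that]) (rule s'(2))
    note \<tau> = \<tau>1 \<tau>2
    have cong: "(\<Oplus>\<^bsub>K\<^esub>u\<in>N. \<Oplus>\<^bsub>K\<^esub>v\<in>N. f u v) = (\<Oplus>\<^bsub>K\<^esub>u\<in>N. \<Oplus>\<^bsub>K\<^esub>v\<in>N. g u v)"
      if "\<And>u v. u \<in> N \<Longrightarrow> v \<in> N \<Longrightarrow> f u v = g u v" "\<And>u v. u \<in> N \<Longrightarrow> v \<in> N \<Longrightarrow> g u v \<in> carrier K" for f g
      unfolding finsum_self_module[of K, symmetric] using that
      by (intro module_finsum_cong[OF self] module_finsum_closed[OF self]; simp only: self_module_simps)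
    have mc: "x \<otimes>\<^bsub>K\<^esub> y \<in> carrier K" if "x \<in> carrier K" "y \<in> carrier K" for x y
      using cring that by (rule cring.cring_simprules)
    show ?thesis
    proof (rule convolution_UnitsI[OF F.matrix_coalgebra_axioms Q.matrix_coalgebra_axioms \<sigma>(1) \<tau>(1)])
      fix i j a b assume ij: "i \<in> N" "j \<in> N" "a \<in> N" "b \<in> N"
      let ?\<tau> = "tens_lift K F Q (KK) s'"
      have "(\<Oplus>\<^bsub>K\<^esub>u\<in>N. \<Oplus>\<^bsub>K\<^esub>v\<in>N. ?\<sigma> (tens K F Q (c i u) (p (c j v))) \<otimes>\<^bsub>K\<^esub> ?\<tau> (tens K F Q (c u a) (p (c v b))))
        = (\<Oplus>\<^bsub>K\<^esub>u\<in>N. \<Oplus>\<^bsub>K\<^esub>v\<in>N. r i j u v \<otimes>\<^bsub>K\<^esub> mat S u v a b)"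
        by (rule cong) (simp_all only: \<sigma>(2) \<tau>(2) ij mc r_closed mat_closed[OF S(1)])
      also have "\<dots> = mat (\<lambda>t. R (S t)) i j a b" by (rule mat_comp[OF R_linear S(1) ij])
      also have "\<dots> = (if i = a \<and> j = b then \<one>\<^bsub>K\<^esub> else \<zero>\<^bsub>K\<^esub>)" by (rule mat_id[OF S(3) ij])
      finally show "(\<Oplus>\<^bsub>K\<^esub>u\<in>N. \<Oplus>\<^bsub>K\<^esub>v\<in>N. ?\<sigma> (tens K F Q (c i u) (p (c j v))) \<otimes>\<^bsub>K\<^esub> ?\<tau> (tens K F Q (c u a) (p (c v b))))
        = (if i = a \<and> j = b then \<one>\<^bsub>K\<^esub> else \<zero>\<^bsub>K\<^esub>)" .
      have "(\<Oplus>\<^bsub>K\<^esub>u\<in>N. \<Oplus>\<^bsub>K\<^esub>v\<in>N. ?\<tau> (tens K F Q (c i u) (p (c j v))) \<otimes>\<^bsub>K\<^esub> ?\<sigma> (tens K F Q (c u a) (p (c v b))))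
        = (\<Oplus>\<^bsub>K\<^esub>u\<in>N. \<Oplus>\<^bsub>K\<^esub>v\<in>N. mat S i j u v \<otimes>\<^bsub>K\<^esub> r u v a b)"
        by (rule cong) (simp_all only: \<sigma>(2) \<tau>(2) ij mc r_closed mat_closed[OF S(1)])
      also have "\<dots> = mat (\<lambda>t. S (R t)) i j a b" by (rule mat_comp[OF S(1) R_linear ij])
      also have "\<dots> = (if i = a \<and> j = b then \<one>\<^bsub>K\<^esub> else \<zero>\<^bsub>K\<^esub>)" by (rule mat_id[OF S(2) ij])
      finally show "(\<Oplus>\<^bsub>K\<^esub>u\<in>N. \<Oplus>\<^bsub>K\<^esub>v\<in>N. ?\<tau> (tens K F Q (c i u) (p (c j v))) \<otimes>\<^bsub>K\<^esub> ?\<sigma> (tens K F Q (c u a) (p (c v b))))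
        = (if i = a \<and> j = b then \<one>\<^bsub>K\<^esub> else \<zero>\<^bsub>K\<^esub>)" .
    qed
  qed
  moreover have "R = R_of K F I M (basis_coaction K M n m) ?\<sigma>"
    unfolding iff[OF \<sigma>(1)] using \<sigma>(2) by blast
  ultimately show ?thesis using D by blast
qed

lemma quotient_part:
  assumes flip: "\<And>t. t \<in> carrier MM \<Longrightarrow> R (flip K M t) = flip K M (R t)"
  shows "\<exists>\<rho>. coalgebra K Q \<and> right_comodule K Q M \<rho> \<and>
    (\<exists>!\<sigma>. strongly_D_map K Q \<sigma> \<and> R = strong_R_of K Q M \<rho> \<sigma>)"
proof -
  interpret Q': module K Q by (rule Q.C)
  let ?S = "KK" and ?Q = "quot_mod K F I"
  let ?e = "\<lambda>i j. p (c i j)"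
  have r_sym: "r i j a b = r j i b a" if "i \<in> N" "j \<in> N" "a \<in> N" "b \<in> N" for i j a b
    by (rule mat_flip[OF R_linear flip that])
  obtain s where s: "bilinear K F Q ?S s"
    "\<And>i j a b. i \<in> N \<Longrightarrow> j \<in> N \<Longrightarrow> a \<in> N \<Longrightarrow> b \<in> N \<Longrightarrow> s (c i a) (p (c j b)) = r i j a b"
    by (rule form_exists[OF R_linear R_comm], assumption) (rule that)
  let ?s = "\<lambda>X v. s v X"
  have b: "bilinear K Q F ?S ?s" by (rule bilinear_flip[OF s(1)])
  \<comment> \<open>Symmetry is stated with the projection in the second slot on both sides, since
    \<open>s\<close> takes its second argument in the quotient. On matrix elements it is the
    symmetry of \<open>r\<close>.\<close>
  have sym: "s (c i a) (p y) = s y (p (c i a))" if y: "y \<in> carrier F" and i: "i \<in> N" "a \<in> N" for y i a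
  proof (rule F.eq_on_e[OF self linear_map_comp[OF bilinear_right[OF s(1) F.e_closed[OF i]] p_linear]
        bilinear_left[OF s(1) Q.e_closed[OF i]] _ y])
    fix j b assume j: "j \<in> N" "b \<in> N"
    show "s (c i a) (p (c j b)) = s (c j b) (p (c i a))"
      unfolding s(2)[OF i(1) j(1) i(2) j(2)] s(2)[OF j(1) i(1) j(2) i(2)]
      by (rule r_sym[OF i(1) j(1) i(2) j(2)])
  qed
  \<comment> \<open>For X the class of a matrix element, symmetry moves \<open>w\<close> into the
    second slot, where its class is zero.\<close>
  have s0: "s w X = \<zero>\<^bsub>?S\<^esub>" if X: "X \<in> carrier Q" and w: "w \<in> I" for X w
  proof -
    have wF: "w \<in> carrier F" using module.submoduleE(1)[OF F.C submodule_I] w by (rule subsetD)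
    have pw: "p w = \<zero>\<^bsub>Q\<^esub>"
      unfolding Q_simps using coset_eq_zero_iff[OF F.C submodule_I wF] w by (rule iffD2)
    show ?thesis
    proof (rule Q.eq_on_e[OF self bilinear_right[OF s(1) wF] linear_map_zero_fun[OF self] _ X])
      fix i a assume i: "i \<in> N" "a \<in> N"
      show "s w (p (c i a)) = \<zero>\<^bsub>?S\<^esub>"
        unfolding sym[OF wF i, symmetric] pw
        by (rule linear_map_zero[OF bilinear_right[OF s(1) F.e_closed[OF i]] Q.C self])
    qed
  qed
  have q1: "bilinear K Q (quot_mod K F I) ?S (\<lambda>X Y. the_elem (?s X ` Y))"
    by (rule bilinear_quot_right(1)[OF Q.C F.C self b submodule_I]) (rule s0)
  have q2: "the_elem (?s X ` p w) = s w X" if "X \<in> carrier Q" "w \<in> carrier F" for X w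
    by (rule bilinear_quot_right(2)[OF Q.C F.C self b submodule_I _ that]) (rule s0)
  \<comment> \<open>The descent was carried out for the swapped form \<open>?s\<close>; swapping
    back gives a form on Q \<otimes> Q whose first argument is the one that descended.\<close>
  define t where "t = (\<lambda>Y X. the_elem (?s X ` Y))"
  have t: "bilinear K Q Q ?S t"
    using bilinear_flip[OF q1] unfolding t_def by (simp add: bilinear_def Q_simps del: quot_mod_simps)
  have te: "t (?e i a) (?e j b) = r i j a b" if "i \<in> N" "j \<in> N" "a \<in> N" "b \<in> N" for i j a b
    unfolding t_def by (rule trans[OF q2[OF Q.e_closed[OF that(2,4)] F.e_closed[OF that(1,3)]] s(2)[OF that]])
  let ?\<sigma> = "tens_lift K Q Q ?S t"
  have \<sigma>: "?\<sigma> \<in> lin_hom K (tensor K Q Q) ?S"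
    by (rule tens_lift_lin_hom[OF Q.C Q.C self t])
  have \<sigma>e: "?\<sigma> (tens K Q Q (?e i a) (?e j b)) = r i j a b" if "i \<in> N" "j \<in> N" "a \<in> N" "b \<in> N" for i j a b
    by (rule trans[OF tens_lift_tens[OF Q.C Q.C self t Q.e_closed[OF that(1,3)] Q.e_closed[OF that(2,4)]] te[OF that]])
  have surj: "(\<lambda>x. x) ` carrier Q = carrier Q" by (rule image_ident)
  have D: "strongly_D_map K Q ?\<sigma>" unfolding strongly_D_map_def
  proof (rule Q.D_conditionI[OF Q.C linear_map_ident surj \<sigma>])
    fix i j a b assume ij: "i \<in> N" "j \<in> N" "a \<in> N" "b \<in> N"
    have "(\<Oplus>\<^bsub>Q\<^esub>u\<in>N. ?\<sigma> (tens K Q Q (?e i u) (?e j b)) \<odot>\<^bsub>Q\<^esub> ?e u a) = (\<Oplus>\<^bsub>Q\<^esub>u\<in>N. r i j u b \<odot>\<^bsub>Q\<^esub> ?e u a)"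
      by (rule module_finsum_cong[OF Q.C]) (simp_all only: \<sigma>e ij Q'.smult_closed Q.e_closed r_closed)
    also note p_obstr[OF ij]
    also have "(\<Oplus>\<^bsub>Q\<^esub>u\<in>N. r u j a b \<odot>\<^bsub>Q\<^esub> ?e i u) = (\<Oplus>\<^bsub>Q\<^esub>u\<in>N. ?\<sigma> (tens K Q Q (?e u a) (?e j b)) \<odot>\<^bsub>Q\<^esub> ?e i u)"
      by (rule module_finsum_cong[OF Q.C]) (simp_all only: \<sigma>e ij Q'.smult_closed Q.e_closed r_closed)
    finally show "(\<Oplus>\<^bsub>Q\<^esub>u\<in>N. ?\<sigma> (tens K Q Q (?e i u) (?e j b)) \<odot>\<^bsub>Q\<^esub> ?e u a) =
      (\<Oplus>\<^bsub>Q\<^esub>u\<in>N. ?\<sigma> (tens K Q Q (?e u a) (?e j b)) \<odot>\<^bsub>Q\<^esub> ?e i u)" .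
  qed
  let ?U = "tensor K M Q"
  have U: "module K ?U" by (rule module_tensor[OF is_module Q.C])
  let ?\<phi> = "\<lambda>l. \<Oplus>\<^bsub>?U\<^esub>v\<in>N. tens K M Q (m v) (?e v l)"
  have \<phi>: "?\<phi> l \<in> carrier ?U" if "l \<in> N" for l
    by (intro module_finsum_closed[OF U] tens_closed is_module Q.C basis_closed Q.e_closed that)
  \<comment> \<open>The comatrix coaction pushed forward along the projection, with matrix elements
    replaced by their classes.\<close>
  let ?\<rho> = "basis_ext ?U ?\<phi>"
  interpret QM: matrix_comodule K M Q n m ?e ?\<rho>
  proof (rule matrix_comodule.intro[OF based_module_axioms Q.matrix_coalgebra_axioms], rule matrix_comodule_axioms.intro)
    show "linear_map K M ?U ?\<rho>" by (rule linear_basis_ext[OF U \<phi>])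
    show "?\<rho> (m l) = ?\<phi> l" if "l \<in> N" for l by (rule basis_ext_basis[OF U \<phi> that])
  qed
  have iff: "R = strong_R_of K Q M ?\<rho> \<sigma>' \<longleftrightarrow>
      (\<forall>i\<in>N. \<forall>j\<in>N. \<forall>a\<in>N. \<forall>b\<in>N. \<sigma>' (tens K Q Q (?e i a) (?e j b)) = r i j a b)"
    if "\<sigma>' \<in> lin_hom K (tensor K Q Q) ?S" for \<sigma>'
    unfolding strong_R_of_def by (rule QM.eq_induced_op_iff[OF Q.C linear_map_ident lin_homD[OF that] R])
  have R\<sigma>: "R = strong_R_of K Q M ?\<rho> ?\<sigma>"
    unfolding iff[OF \<sigma>] using \<sigma>e by blast
  have uniq: "\<sigma>' = ?\<sigma>" if \<sigma>': "strongly_D_map K Q \<sigma>' \<and> R = strong_R_of K Q M ?\<rho> \<sigma>'" for \<sigma>'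
  proof -
    have l: "\<sigma>' \<in> lin_hom K (tensor K Q Q) ?S"
      using \<sigma>' unfolding strongly_D_map_def D_condition_def by blast
    note e = iffD1[OF iff[OF l] conjunct2[OF \<sigma>'], rule_format]
    show ?thesis
    proof (rule Q.form_eqI[OF Q.C linear_map_ident surj l \<sigma>])
      fix i j a b assume ij: "i \<in> N" "j \<in> N" "a \<in> N" "b \<in> N"
      show "\<sigma>' (tens K Q Q (?e i a) (?e j b)) = ?\<sigma> (tens K Q Q (?e i a) (?e j b))"
        by (rule trans[OF e[OF ij] \<sigma>e[OF ij, symmetric]])
    qed
  qed
  have "\<exists>!\<sigma>. strongly_D_map K Q \<sigma> \<and> R = strong_R_of K Q M ?\<rho> \<sigma>"
    using D R\<sigma> uniq by (intro ex1I[of _ ?\<sigma>] conjI)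
  then show ?thesis using Q.coalgebra QM.comodule by blast
qed

end

theorem theorem5p4:
  fixes K :: "('k, 'x) ring_scheme"
    and n :: nat
    and M :: "('k, 'm, 'y) module_scheme"
    and R :: "('k, 'm, 'm) tens \<Rightarrow> ('k, 'm, 'm) tens"
  assumes "field K"
    and "n \<ge> 1"
    and "module K M"
    and "has_dim K M n"
    and "R \<in> lin_hom K (tensor K M M) (tensor K M M)"
    and "D_equation K M R"
  shows "(\<forall>m. is_basis K M n m \<longrightarrow>
            right_comodule K (comatrix K n) M (basis_coaction K M n m) \<and>
            (\<exists>I \<sigma>. coideal K (comatrix K n) I \<and>
              D_map K (comatrix K n) I \<sigma> \<and>
              R = R_of K (comatrix K n) I M (basis_coaction K M n m) \<sigma> \<and>
              (\<forall>\<sigma>'. D_map K (comatrix K n) I \<sigma>' \<and>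
                R = R_of K (comatrix K n) I M (basis_coaction K M n m) \<sigma>' \<longrightarrow> \<sigma>' = \<sigma>) \<and>
              (bij_betw R (carrier (tensor K M M)) (carrier (tensor K M M)) \<longrightarrow>
                \<sigma> \<in> Units (convolution_algebra K
                  (tensor_coalg K (comatrix K n) (quot_coalg K (comatrix K n) I)))))) \<and>
         ((\<forall>t\<in>carrier (tensor K M M). R (flip K M t) = flip K M (R t)) \<longrightarrow>
            (\<exists>(C :: ('k, (nat \<times> nat \<Rightarrow> 'k) set) coalg) \<rho>.
              coalgebra K C \<and> right_comodule K C M \<rho> \<and>
              (\<exists>!\<sigma>. strongly_D_map K C \<sigma> \<and> R = strong_R_of K C M \<rho> \<sigma>)))"
proof (intro conjI allI impI)
  have sol: "D_solution K M n m R" if "is_basis K M n m" for m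
    using assms(3,5,6) that by (intro D_solution.intro based_module.intro D_solution_axioms.intro)
  fix m assume "is_basis K M n m"
  then interpret D_solution K M n m R by (rule sol)
  show "right_comodule K (comatrix K n) M (basis_coaction K M n m)"
    by (rule FM.comodule)
  show "\<exists>I \<sigma>. coideal K (comatrix K n) I \<and>
              D_map K (comatrix K n) I \<sigma> \<and>
              R = R_of K (comatrix K n) I M (basis_coaction K M n m) \<sigma> \<and>
              (\<forall>\<sigma>'. D_map K (comatrix K n) I \<sigma>' \<and>
                R = R_of K (comatrix K n) I M (basis_coaction K M n m) \<sigma>' \<longrightarrow> \<sigma>' = \<sigma>) \<and>
              (bij_betw R (carrier (tensor K M M)) (carrier (tensor K M M)) \<longrightarrow>
                \<sigma> \<in> Units (convolution_algebra K
                  (tensor_coalg K (comatrix K n) (quot_coalg K (comatrix K n) I))))"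
    using coideal_I comatrix_part by blast
next
  assume flip: "\<forall>t\<in>carrier (tensor K M M). R (flip K M t) = flip K M (R t)"
  \<comment> \<open>Any basis will do: the coalgebra and the coaction are existentially quantified
    and may depend on it.\<close>
  obtain m where "is_basis K M n m" using assms(4) unfolding has_dim_def by blast
  then interpret D_solution K M n m R
    using assms(3,5,6) by (intro D_solution.intro based_module.intro D_solution_axioms.intro)
  show "\<exists>(C :: ('k, (nat \<times> nat \<Rightarrow> 'k) set) coalg) \<rho>.
              coalgebra K C \<and> right_comodule K C M \<rho> \<and>
              (\<exists>!\<sigma>. strongly_D_map K C \<sigma> \<and> R = strong_R_of K C M \<rho> \<sigma>)"
    using quotient_part flip by blast
qed

end
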